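(* Let $1\le r\le n\le m$ be integers, let $k$ be a field, let $S=k[x_{ij}\mid 1\le i\le n,\ 1\le j\le m]$, and let $<$ be any diagonal term order on $S$. Let $\Delta$ be a pure $(r-1)$-dimensional simplicial complex on the vertex set $[m]$ with maximal clique decomposition $\Delta=\bigcup_{i=1}^c\Delta_i$, and let $V(\Delta_i)$ denote the vertex set of $\Delta_i$. Assume that the associated ideal $J_\Delta\subseteq S$ is a unit interval $r$-DFI with $|V(\Delta_i)\cap V(\Delta_j)|\le\max\{0,\,2r-n-1\}$ for all $i\ne j$. If $|V(\Delta_i)|=r$ for each $i=1,\dots,c$, then $$\beta_{ij}(S/J_\Delta)=\beta_{ij}(S/\operatorname{in}_<(J_\Delta))\quad\text{for all } i,j.$$
   Context: Let $M=(x_{ij})$ be the $n\times m$ matrix of indeterminates of $S$. Write $[m]=\{1,\dots,m\}$. For $\mathbf a=\{a_1<\dots<a_r\}\subseteq[n]$ and $\mathbf b=\{b_1<\dots<b_r\}\subseteq[m]$, $[\mathbf a\mid\mathbf b]=\det(x_{a_p,b_q})_{1\le p,q\le r}$ is the $r$-minor of $M$ with rows $\mathbf a$ and columns $\mathbf b$. The $r$-determinantal facet ideal ($r$-DFI) $J_\Delta\subseteq S$ is the ideal generated by all minors $[\mathbf a\mid\mathbf b]$ with $\mathbf a\subseteq[n]$, $|\mathbf a|=r$, and $\mathbf b$ an $(r-1)$-dimensional face of $\Delta$. Maximal cliques: for a simplicial complex $\Gamma$, $\Gamma^{(i)}$ denotes the $i$-th skeleton, the subcomplex of faces of dimension at most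 $i$. Let $\mathcal S$ be the set of simplices $\Gamma$ with vertices in $[m]$, $\dim\Gamma\ge r-1$ and $\Gamma^{(r-1)}\subseteq\Delta$. Let $\Gamma_1,\dots,\Gamma_c$ be the elements of $\mathcal S$ maximal under inclusion (the maximal cliques) and $\Delta_i:=\Gamma_i^{(r-1)}$. The decomposition $\Delta=\Delta_1\cup\dots\cup\Delta_c$ is the maximal clique decomposition of $\Delta$. Unit interval: $J_\Delta$ is a unit interval $r$-DFI if the vertex set of each $\Delta_i$ is an interval $[a_i,b_i]=\{a_i,a_i+1,\dots,b_i-1,b_i\}$ for integers $a_i<b_i$ (so $\Delta_i$ is the $(r-1)$-skeleton of the simplex on this interval). For a term order $<$, $\operatorname{in}_<(f)$ denotes the leading term of $f$ and $\operatorname{in}_<(I)$ the initial ideal of $I$. A term order is diagonal if the leading term of every minor of $M$ is the product of the entries on its main diagonal, i.e. $\operatorname{in}_<([\mathbf a\mid\mathbf b])=x_{a_1b_1}\cdots x_{a_rb_r}$, for minors of all sizes. $\beta_{ij}(S/I)=\dim_k\operatorname{Tor}_i^S(S/I,k)_j$ denotes the graded Betti numbers, with $S$ standard graded. *)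

theory Defs
  imports Jordan_Normal_Form.Determinant "HOL-Library.Poly_Mapping" "HOL-Library.Cardinality"
begin

section \<open>Polynomials, ideals and finitely generated free modules\<close>

text \<open>
  Exponent vectors in indeterminates indexed by \<open>'x\<close>, and the polynomial ring over \<open>'k\<close> as the
  monoid algebra of these. For finite \<open>'x\<close> and a field \<open>'k\<close>, the whole type is
  \<open>k[x_v | v :: 'x]\<close>.
\<close>
type_synonym 'x monomial = "'x \<Rightarrow>\<^sub>0 nat"
type_synonym ('x, 'k) polynomial = "'x monomial \<Rightarrow>\<^sub>0 'k"

definition var :: "'x \<Rightarrow> ('x, 'k::comm_ring_1) polynomial" where
  "var v = Poly_Mapping.single (Poly_Mapping.single v 1) 1"

definition monomial_degree :: "'x monomial \<Rightarrow> nat" where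
  "monomial_degree t = (\<Sum>v\<in>Poly_Mapping.keys t. Poly_Mapping.lookup t v)"

text \<open>The zero polynomial is homogeneous of every degree, and the only one of negative degree.\<close>
definition homogeneous :: "int \<Rightarrow> ('x, 'k::zero) polynomial \<Rightarrow> bool" where
  "homogeneous d f \<longleftrightarrow> (\<forall>t\<in>Poly_Mapping.keys f. int (monomial_degree t) = d)"

text \<open>A commutative ring as a module over itself: spans are the ideals generated by a set.\<close>
lemma module_ring_itself: "Modules.module ((*) :: 'a::comm_ring_1 \<Rightarrow> 'a \<Rightarrow> 'a)"
  by unfold_locales (simp_all add: algebra_simps)

definition ideal_generated :: "'a::comm_ring_1 set \<Rightarrow> 'a set" where
  "ideal_generated G = Modules.module.span (*) G"

definition scale_vec :: "'a::comm_ring_1 \<Rightarrow> (nat \<Rightarrow>\<^sub>0 'a) \<Rightarrow> (nat \<Rightarrow>\<^sub>0 'a)" where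
  "scale_vec c v = Poly_Mapping.map ((*) c) v"

lemma lookup_scale_vec: "Poly_Mapping.lookup (scale_vec c v) q = c * Poly_Mapping.lookup v q"
  by (simp add: scale_vec_def Poly_Mapping.map.rep_eq when_def)

lemma module_scale_vec: "Modules.module (scale_vec :: 'a::comm_ring_1 \<Rightarrow> _)"
  by unfold_locales
     (simp_all add: poly_mapping_eq_iff fun_eq_iff lookup_scale_vec Poly_Mapping.lookup_add algebra_simps)

lemma vector_space_scale_vec: "Vector_Spaces.vector_space (scale_vec :: 'k::field \<Rightarrow> _)"
  by unfold_locales
     (simp_all add: poly_mapping_eq_iff fun_eq_iff lookup_scale_vec Poly_Mapping.lookup_add algebra_simps)

text \<open>The free module of rank \<open>b\<close>, inside the finitely supported sequences.\<close>
definition free_module :: "nat \<Rightarrow> (nat \<Rightarrow>\<^sub>0 'a::zero) set" where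
  "free_module b = {v. Poly_Mapping.keys v \<subseteq> {..<b}}"

text \<open>The linear map that sends the \<open>q\<close>-th basis vector to \<open>g q\<close>.\<close>
definition lin_map :: "(nat \<Rightarrow> (nat \<Rightarrow>\<^sub>0 'a)) \<Rightarrow> (nat \<Rightarrow>\<^sub>0 'a) \<Rightarrow> (nat \<Rightarrow>\<^sub>0 'a::comm_ring_1)" where
  "lin_map g v = (\<Sum>q\<in>Poly_Mapping.keys v. scale_vec (Poly_Mapping.lookup v q) (g q))"


section \<open>Graded Betti numbers\<close>

text \<open>
  Data of an augmented complex of finitely generated graded free \<open>S\<close>-modules
  \<open>\<dots> \<rightarrow> F_2 \<rightarrow> F_1 \<rightarrow> F_0 \<rightarrow> S/I\<close>. The list \<open>shifts F i\<close> contains the degrees of the basis vectors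
  of \<open>F_i\<close>, that is, \<open>F_i\<close> is the direct sum of the \<open>S(-d)\<close> with \<open>d\<close> running through the list.
  \<open>differential F i q\<close> is the image in \<open>F_i\<close> of the \<open>q\<close>-th basis vector of \<open>F_{i+1}\<close>, and \<open>aug F q\<close>
  represents the class in \<open>S/I\<close> of the image of the \<open>q\<close>-th basis vector of \<open>F_0\<close>.
\<close>
record (overloaded) ('x, 'k) free_complex =
  shifts :: "nat \<Rightarrow> int list"
  differential :: "nat \<Rightarrow> nat \<Rightarrow> (nat \<Rightarrow>\<^sub>0 ('x, 'k) polynomial)"
  aug :: "nat \<Rightarrow> ('x, 'k) polynomial"

definition rank_at :: "('x, 'k::field) free_complex \<Rightarrow> nat \<Rightarrow> nat" where
  "rank_at F i = length (shifts F i)"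

definition aug_map ::
    "('x, 'k::field) free_complex \<Rightarrow> (nat \<Rightarrow>\<^sub>0 ('x, 'k) polynomial) \<Rightarrow> ('x, 'k) polynomial" where
  "aug_map F v = (\<Sum>q\<in>Poly_Mapping.keys v. Poly_Mapping.lookup v q * aug F q)"

text \<open>
  The first two conjuncts say that all maps are homogeneous of degree 0, the third that
  \<open>F_0 \<rightarrow> S/I\<close> is onto, and the last two are exactness at \<open>F_0\<close> and at \<open>F_{i+1}\<close>.
\<close>
definition graded_free_resolution ::
    "('x, 'k::field) polynomial set \<Rightarrow> ('x, 'k) free_complex \<Rightarrow> bool" where
  "graded_free_resolution I F \<longleftrightarrow>
     (\<forall>q<rank_at F 0. homogeneous (shifts F 0 ! q) (aug F q)) \<and>
     (\<forall>i. \<forall>q<rank_at F (Suc i). differential F i q \<in> free_module (rank_at F i) \<and>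
        (\<forall>p<rank_at F i. homogeneous (shifts F (Suc i) ! q - shifts F i ! p) (Poly_Mapping.lookup (differential F i q) p))) \<and>
     (\<forall>f. \<exists>v\<in>free_module (rank_at F 0). f - aug_map F v \<in> I) \<and>
     {v \<in> free_module (rank_at F 0). aug_map F v \<in> I}
        = Modules.module.span scale_vec (differential F 0 ` {..<rank_at F 1}) \<and>
     (\<forall>i. {v \<in> free_module (rank_at F (Suc i)). lin_map (differential F i) v = 0}
        = Modules.module.span scale_vec (differential F (Suc i) ` {..<rank_at F (Suc (Suc i))}))"

text \<open>
  Since \<open>S(-d) \<otimes> k = k(-d)\<close>, the degree \<open>j\<close> part of \<open>F_i \<otimes>_S k\<close> has the basis vectors of \<open>F_i\<close> of
  degree \<open>j\<close> as a \<open>k\<close>-basis. As \<open>k\<close> is \<open>S\<close> modulo all indeterminates, the differential of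
  \<open>F \<otimes>_S k\<close> is given by the constant terms of the matrix entries.
\<close>
definition tensor_module :: "('x, 'k::field) free_complex \<Rightarrow> nat \<Rightarrow> int \<Rightarrow> (nat \<Rightarrow>\<^sub>0 'k) set" where
  "tensor_module F i j = {v. Poly_Mapping.keys v \<subseteq> {q. q < rank_at F i \<and> shifts F i ! q = j}}"

definition tensor_diff :: "('x, 'k::field) free_complex \<Rightarrow> nat \<Rightarrow> (nat \<Rightarrow>\<^sub>0 'k) \<Rightarrow> (nat \<Rightarrow>\<^sub>0 'k)" where
  "tensor_diff F i = lin_map (\<lambda>q. Poly_Mapping.map (\<lambda>f. Poly_Mapping.lookup f 0) (differential F i q))"

definition tensor_cycles :: "('x, 'k::field) free_complex \<Rightarrow> nat \<Rightarrow> int \<Rightarrow> (nat \<Rightarrow>\<^sub>0 'k) set" where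
  "tensor_cycles F i j =
     {v \<in> tensor_module F i j. case i of 0 \<Rightarrow> True | Suc h \<Rightarrow> tensor_diff F h v = 0}"

definition tensor_boundaries :: "('x, 'k::field) free_complex \<Rightarrow> nat \<Rightarrow> int \<Rightarrow> (nat \<Rightarrow>\<^sub>0 'k) set" where
  "tensor_boundaries F i j = tensor_diff F i ` tensor_module F (Suc i) j"

text \<open>
  The dimension of the homology space \<open>H_i(F \<otimes>_S k)_j\<close>; for a complex, boundaries are cycles and
  all spaces are finite-dimensional, so the natural-number subtraction is exact.
\<close>
definition tensor_homology_dim :: "('x, 'k::field) free_complex \<Rightarrow> nat \<Rightarrow> int \<Rightarrow> nat" where
  "tensor_homology_dim F i j =
     Vector_Spaces.vector_space.dim scale_vec (tensor_cycles F i j)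
       - Vector_Spaces.vector_space.dim scale_vec (tensor_boundaries F i j)"

text \<open>
  \<open>dim_k Tor_i(S/I, k)_j\<close>, computed from some graded free resolution of \<open>S/I\<close>. It is meant for
  homogeneous ideals in finitely many indeterminates, where resolutions of this kind exist.
\<close>
definition graded_betti :: "('x::finite, 'k::field) polynomial set \<Rightarrow> nat \<Rightarrow> int \<Rightarrow> nat" where
  "graded_betti I i j = tensor_homology_dim (SOME F. graded_free_resolution I F) i j"


section \<open>Term orders and initial ideals\<close>

text \<open>For finitely many indeterminates such an order is automatically a well-order.\<close>
definition term_order :: "('x::finite monomial \<Rightarrow> 'x monomial \<Rightarrow> bool) \<Rightarrow> bool" where
  "term_order leq \<longleftrightarrow>
     class.linorder leq (\<lambda>s t. leq s t \<and> \<not> leq t s) \<and>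
     (\<forall>t. leq 0 t) \<and> (\<forall>s t u. leq s t \<longrightarrow> leq (s + u) (t + u))"

definition lead_monomial :: "('x monomial \<Rightarrow> 'x monomial \<Rightarrow> bool) \<Rightarrow> ('x, 'k::zero) polynomial \<Rightarrow> 'x monomial"
  where "lead_monomial leq f = (THE t. t \<in> Poly_Mapping.keys f \<and> (\<forall>s\<in>Poly_Mapping.keys f. leq s t))"

text \<open>The coefficient is kept, so that the leading term of 0 is 0.\<close>
definition lead_term ::
    "('x monomial \<Rightarrow> 'x monomial \<Rightarrow> bool) \<Rightarrow> ('x, 'k::zero) polynomial \<Rightarrow> ('x, 'k) polynomial" where
  "lead_term leq f = Poly_Mapping.single (lead_monomial leq f) (Poly_Mapping.lookup f (lead_monomial leq f))"

definition initial_ideal ::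
    "('x monomial \<Rightarrow> 'x monomial \<Rightarrow> bool) \<Rightarrow> ('x, 'k::field) polynomial set \<Rightarrow> ('x, 'k) polynomial set" where
  "initial_ideal leq I = ideal_generated (lead_term leq ` I)"


section \<open>Minors of the matrix of indeterminates\<close>

text \<open>
  The finite linear orders \<open>'n\<close> and \<open>'m\<close> play the roles of \<open>[n]\<close> and \<open>[m]\<close>, with \<open>n = CARD('n)\<close>
  and \<open>m = CARD('m)\<close>. The list \<open>sorted_list_of_set a\<close> is \<open>a_1 < \<dots> < a_r\<close>, indexed from 0.
\<close>
definition minor ::
    "'n::{finite,linorder} set \<Rightarrow> 'm::{finite,linorder} set \<Rightarrow> ('n \<times> 'm, 'k::field) polynomial" where
  "minor a b = det (mat (card a) (card a)
     (\<lambda>(p, q). var (sorted_list_of_set a ! p, sorted_list_of_set b ! q)))"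

definition diagonal_order ::
    "'k::field itself \<Rightarrow>
     (('n::{finite,linorder} \<times> 'm::{finite,linorder}) monomial \<Rightarrow> ('n \<times> 'm) monomial \<Rightarrow> bool) \<Rightarrow> bool" where
  "diagonal_order _ leq \<longleftrightarrow> term_order leq \<and>
     (\<forall>a b. card a = card b \<longrightarrow>
        lead_term leq (minor a b :: ('n \<times> 'm, 'k) polynomial) =
          (\<Prod>p<card a. var (sorted_list_of_set a ! p, sorted_list_of_set b ! p)))"


section \<open>Simplicial complexes and determinantal facet ideals\<close>

definition simplicial_complex :: "'v set set \<Rightarrow> bool" where
  "simplicial_complex D \<longleftrightarrow> (\<forall>f\<in>D. finite f) \<and> (\<forall>f\<in>D. \<forall>g. g \<subseteq> f \<longrightarrow> g \<in> D)"

definition face_dim :: "'v set \<Rightarrow> int" where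
  "face_dim f = int (card f) - 1"

definition facets :: "'v set set \<Rightarrow> 'v set set" where
  "facets D = {f \<in> D. \<forall>g\<in>D. f \<subseteq> g \<longrightarrow> g = f}"

definition pure_of_dim :: "int \<Rightarrow> 'v set set \<Rightarrow> bool" where
  "pure_of_dim d D \<longleftrightarrow> D \<noteq> {} \<and> (\<forall>f\<in>facets D. face_dim f = d)"

definition skeleton :: "int \<Rightarrow> 'v set set \<Rightarrow> 'v set set" where
  "skeleton i D = {f \<in> D. face_dim f \<le> i}"

definition vertex_set :: "'v set set \<Rightarrow> 'v set" where
  "vertex_set D = \<Union>D"

text \<open>The simplex with vertex set \<open>V\<close> is the complex \<open>Pow V\<close>, of dimension \<open>face_dim V\<close>.\<close>
definition clique_simplices :: "nat \<Rightarrow> 'v set set \<Rightarrow> 'v set set set" where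
  "clique_simplices r D =
     {Pow V | V. face_dim V \<ge> int r - 1 \<and> skeleton (int r - 1) (Pow V) \<subseteq> D}"

definition maximal_cliques :: "nat \<Rightarrow> 'v set set \<Rightarrow> 'v set set set" where
  "maximal_cliques r D =
     {G \<in> clique_simplices r D. \<forall>H\<in>clique_simplices r D. G \<subseteq> H \<longrightarrow> H = G}"

text \<open>The set of the complexes \<open>\<Delta>_1, \<dots>, \<Delta>_c\<close>.\<close>
definition clique_decomposition :: "nat \<Rightarrow> 'v set set \<Rightarrow> 'v set set set" where
  "clique_decomposition r D = skeleton (int r - 1) ` maximal_cliques r D"

definition facet_ideal ::
    "nat \<Rightarrow> 'm set set \<Rightarrow> ('n::{finite,linorder} \<times> 'm::{finite,linorder}, 'k::field) polynomial set" where
  "facet_ideal r D =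
     ideal_generated {minor a b | a b. card a = r \<and> b \<in> D \<and> face_dim b = int r - 1}"

definition unit_interval :: "nat \<Rightarrow> 'm::linorder set set \<Rightarrow> bool" where
  "unit_interval r D \<longleftrightarrow> (\<forall>C\<in>clique_decomposition r D. \<exists>a b. a < b \<and> vertex_set C = {a..b})"

end

theory Submission
  imports Defs
begin

text \<open>
  All maximal cliques have \<open>r\<close> vertices, so \<open>J\<close> is generated by the \<open>r\<close>-minors of the submatrices on
  certain blocks of \<open>r\<close> consecutive columns, one block for each facet. In the diagonal monomial of a
  minor on the rows \<open>a_1 < \<dots> < a_r\<close>, the variable in the \<open>p\<close>-th column of the block lies in one of the
  rows \<open>p, \<dots>, n - r + p\<close>; thus the diagonals of a block live on a band of variables. Two blocks that
  are shifted against each other by \<open>d < r\<close> columns share \<open>r - d\<close> of them, and their bands are disjoint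
  exactly when \<open>d > n - r\<close>. This is what the bound on the intersections says
  (\<open>band_vars_disjoint\<close>).

  Hence the minors form a Groebner basis of \<open>J\<close> (\<open>minors_groebner\<close>): diagonals from different blocks
  are coprime, and within one block every S-pair is a chain of steps that change a single row. Such
  a step comes from the expansion of a determinant with a repeated column.

  So the initial ideal is a sum of ideals in disjoint sets of variables, one for each block. Each of
  them has linear quotients, and iterated mapping cones give a multigraded free resolution
  (\<open>frame_diag_ideal\<close>). A basis vector in homological degree \<open>i\<close> is labelled by a monomial of degree
  \<open>i + (r - 1) |K|\<close>, where \<open>K\<close> is the set of blocks that it involves.

  This resolution lifts to a resolution of \<open>S/J\<close> with the same ranks and degrees
  (\<open>lifted_resolution\<close>): the entries of the lifted matrices have lower terms in addition, but respect
  the grading by columns. In general a lift need not be minimal. Here it is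
  (\<open>clique_labels_separated\<close>). A unit entry would join labels of consecutive homological degrees and
  equal column degree. Comparing total degrees then leaves only \<open>r = 2\<close> with a change of \<open>|K|\<close> by one;
  but for \<open>r = n = 2\<close> a block has just one minor, so that \<open>i = |K|\<close>, and for \<open>r = 2 < n\<close> the blocks have no
  column in common, so that the column degree determines \<open>K\<close>.

  Thus \<open>S/J\<close> and \<open>S/in(J)\<close> have minimal resolutions with the same degrees, and the homology of any graded
  free resolution tensored with \<open>k\<close> can be read off from a minimal one (\<open>minimal_resolution_betti\<close>).
\<close>

section \<open>Monomial resolutions in each multidegree\<close>

abbreviation lookup where "lookup \<equiv> Poly_Mapping.lookup"
abbreviation keys where "keys \<equiv> Poly_Mapping.keys"
abbreviation single where "single \<equiv> Poly_Mapping.single"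

definition mono_dvd :: "'x monomial \<Rightarrow> 'x monomial \<Rightarrow> bool" (infix "\<preceq>" 50) where
  "s \<preceq> t \<longleftrightarrow> (\<exists>u. t = s + u)"

lemma mono_dvd_refl [simp]: "t \<preceq> t"
  unfolding mono_dvd_def by (intro exI[of _ 0]) simp

lemma zero_mono_dvd [simp]: "0 \<preceq> t"
  unfolding mono_dvd_def by simp

lemma mono_dvd_trans [trans]: "s \<preceq> t \<Longrightarrow> t \<preceq> u \<Longrightarrow> s \<preceq> u"
  unfolding mono_dvd_def by (metis add.assoc)

lemma mono_dvd_add [simp]: "s \<preceq> s + u" "s \<preceq> u + s"
  unfolding mono_dvd_def by (auto simp: add.commute)

lemma mono_dvd_add_cancel [simp]: "s + u \<preceq> t + u \<longleftrightarrow> s \<preceq> t"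
  unfolding mono_dvd_def by (metis add.assoc add.commute add_left_cancel)

lemma mono_dvd_plus_diff: "s \<preceq> t \<Longrightarrow> s + (t - s) = t"
  unfolding mono_dvd_def by auto

lemma mono_dvd_diff_plus: "s \<preceq> t \<Longrightarrow> (t - s) + s = t"
  by (metis mono_dvd_plus_diff add.commute)

lemma mono_dvd_iff_lookup:
  "s \<preceq> t \<longleftrightarrow> (\<forall>v. Poly_Mapping.lookup s v \<le> Poly_Mapping.lookup t v)"
proof
  assume "s \<preceq> t" then show "\<forall>v. Poly_Mapping.lookup s v \<le> Poly_Mapping.lookup t v"
    by (auto simp: mono_dvd_def Poly_Mapping.lookup_add)
next
  assume "\<forall>v. Poly_Mapping.lookup s v \<le> Poly_Mapping.lookup t v"
  then have "t = s + (t - s)"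
    by (intro poly_mapping_eqI) (simp add: Poly_Mapping.lookup_add lookup_minus)
  then show "s \<preceq> t" unfolding mono_dvd_def by blast
qed

definition upclosed :: "'x monomial set \<Rightarrow> bool" where
  "upclosed U \<longleftrightarrow> (\<forall>t\<in>U. \<forall>u. t + u \<in> U)"

lemma upclosedD: "upclosed U \<Longrightarrow> s \<in> U \<Longrightarrow> s \<preceq> t \<Longrightarrow> t \<in> U"
  unfolding upclosed_def mono_dvd_def by blast

definition linear_ext :: "nat \<Rightarrow> (nat \<Rightarrow> nat \<Rightarrow> 'k) \<Rightarrow> (nat \<Rightarrow> 'k) \<Rightarrow> nat \<Rightarrow> 'k::field" where
  "linear_ext n f y = (\<lambda>p. \<Sum>q<n. y q * f q p)"

lemma linear_ext_zero [simp]: "linear_ext n f (\<lambda>_. 0) = (\<lambda>_. 0)"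
  by (simp add: linear_ext_def)

lemma linear_ext_compose:
  "linear_ext m g (linear_ext n f y) = linear_ext n (\<lambda>q. linear_ext m g (f q)) y"
  unfolding linear_ext_def
  by (intro ext) (simp add: sum_distrib_left sum_distrib_right mult.assoc, rule sum.swap)

lemma linear_ext_cong:
  "(\<And>q. q < n \<Longrightarrow> f q = g q) \<Longrightarrow> linear_ext n f y = linear_ext n g y"
  by (simp add: linear_ext_def)

lemma linear_ext_add:
  "linear_ext n f (\<lambda>p. x p + y p) = (\<lambda>p. linear_ext n f x p + linear_ext n f y p)"
  by (simp add: linear_ext_def algebra_simps sum.distrib)

lemma linear_ext_uminus:
  "linear_ext n f (\<lambda>p. - x p) = (\<lambda>p. - linear_ext n f x p)"
  by (simp add: linear_ext_def sum_negf)

lemma linear_ext_nonzeroD: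
  assumes "linear_ext n f y p \<noteq> 0"
  shows "\<exists>q<n. y q \<noteq> 0 \<and> f q p \<noteq> 0"
  using assms unfolding linear_ext_def
  by (metis (no_types, lifting) lessThan_iff mult_eq_0_iff sum.neutral)

text \<open>
  A multigraded free resolution of a monomial ideal, reduced to linear algebra over \<open>k\<close>. The basis
  vectors of the \<open>i\<close>-th module are numbered by \<open>q < rnk i\<close> and have the monomials \<open>lbl i q\<close> as degrees.
  Homogeneity forces every matrix entry to be a scalar times the quotient of two labels, and \<open>cff\<close>
  records the scalar: \<open>cff i q p\<close> belongs to the basis vectors \<open>q\<close> of the \<open>(i+1)\<close>-st and \<open>p\<close> of the \<open>i\<close>-th
  module.
\<close>
record ('x, 'k) frame =
  rnk :: "nat \<Rightarrow> nat"
  lbl :: "nat \<Rightarrow> nat \<Rightarrow> 'x monomial"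
  cff :: "nat \<Rightarrow> nat \<Rightarrow> nat \<Rightarrow> 'k"

definition boundary :: "('x, 'k::field) frame \<Rightarrow> nat \<Rightarrow> (nat \<Rightarrow> 'k) \<Rightarrow> nat \<Rightarrow> 'k" where
  "boundary A i = linear_ext (rnk A (Suc i)) (cff A i)"

text \<open>
  The part of multidegree \<open>t\<close> of the \<open>i\<close>-th module: a basis vector contributes one dimension if its
  label divides \<open>t\<close>.
\<close>
definition chain_at :: "('x, 'k::field) frame \<Rightarrow> nat \<Rightarrow> 'x monomial \<Rightarrow> (nat \<Rightarrow> 'k) \<Rightarrow> bool" where
  "chain_at A i t v \<longleftrightarrow> (\<forall>q. v q \<noteq> 0 \<longrightarrow> q < rnk A i \<and> lbl A i q \<preceq> t)"

text \<open>
  The kernel of the map out of the \<open>i\<close>-th module in multidegree \<open>t\<close>. For \<open>i = 0\<close> this is the map onto the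
  quotient by the ideal with the monomials \<open>U\<close>, which vanishes in multidegree \<open>t\<close> if and only if \<open>t \<in> U\<close>.
\<close>
definition cycle_at ::
    "'x monomial set \<Rightarrow> ('x, 'k::field) frame \<Rightarrow> nat \<Rightarrow> 'x monomial \<Rightarrow> (nat \<Rightarrow> 'k) \<Rightarrow> bool" where
  "cycle_at U A i t v \<longleftrightarrow> chain_at A i t v \<and>
     (case i of 0 \<Rightarrow> t \<in> U \<or> v = (\<lambda>_. 0) | Suc h \<Rightarrow> boundary A h v = (\<lambda>_. 0))"

definition frame_of :: "'x monomial set \<Rightarrow> ('x, 'k::field) frame \<Rightarrow> bool" where
  "frame_of U A \<longleftrightarrow> rnk A 0 = 1 \<and> lbl A 0 0 = 0 \<and>
     (\<forall>i q. q < rnk A (Suc i) \<longrightarrow> cycle_at U A i (lbl A (Suc i) q) (cff A i q)) \<and>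
     (\<forall>i t v. cycle_at U A i t v \<longrightarrow> (\<exists>u. chain_at A (Suc i) t u \<and> boundary A i u = v))"

lemma chain_at_mono: "chain_at A i s v \<Longrightarrow> s \<preceq> t \<Longrightarrow> chain_at A i t v"
  unfolding chain_at_def using mono_dvd_trans by blast

lemma chain_at_add: "chain_at A i t v \<Longrightarrow> chain_at A i t w \<Longrightarrow> chain_at A i t (\<lambda>p. v p + w p)"
  unfolding chain_at_def by (metis add.right_neutral)

lemma chain_at_linear_ext:
  assumes "\<And>q. q < n \<Longrightarrow> y q \<noteq> 0 \<Longrightarrow> chain_at A i t (f q)"
  shows "chain_at A i t (linear_ext n f y)"
  using assms linear_ext_nonzeroD unfolding chain_at_def by metis

text \<open>
  A frame requires boundaries to be cycles only for basis vectors; linearity extends this to chains of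
  every multidegree, since a label that divides \<open>t\<close> can be multiplied up to \<open>t\<close>.
\<close>
lemma cycle_at_boundary:
  assumes U: "upclosed U" and A: "frame_of U A" and u: "chain_at A (Suc i) t u"
  shows "cycle_at U A i t (boundary A i u)"
proof -
  have cyc: "cycle_at U A i (lbl A (Suc i) q) (cff A i q)" if "q < rnk A (Suc i)" for i q
    using A that unfolding frame_of_def by blast
  have lq: "lbl A (Suc i) q \<preceq> t" if "u q \<noteq> 0" for q
    using u that unfolding chain_at_def by blast
  have 1: "chain_at A i t (boundary A i u)"
    unfolding boundary_def using cyc lq chain_at_mono unfolding cycle_at_def
    by (blast intro!: chain_at_linear_ext)
  show ?thesis
  proof (cases i)
    case 0
    have "t \<in> U" if nz: "boundary A i u p \<noteq> 0" for p
    proof -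
      obtain q where q: "q < rnk A (Suc i)" "u q \<noteq> 0" "cff A i q p \<noteq> 0"
        using linear_ext_nonzeroD[OF nz[unfolded boundary_def]] by blast
      have "lbl A (Suc i) q \<in> U"
        using cyc[OF q(1)] q(3) 0 unfolding cycle_at_def by auto
      then show ?thesis using upclosedD[OF U] lq[OF q(2)] by blast
    qed
    then show ?thesis using 1 0 unfolding cycle_at_def by auto
  next
    case (Suc h)
    have "boundary A h (boundary A i u)
        = linear_ext (rnk A (Suc i)) (\<lambda>q. boundary A h (cff A i q)) u"
      unfolding boundary_def[of A i] by (simp add: linear_ext_compose boundary_def)
    also have "\<dots> = linear_ext (rnk A (Suc i)) (\<lambda>q. (\<lambda>_. 0)) u"
    proof (rule linear_ext_cong)
      fix q assume "q < rnk A (Suc i)"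
      from cyc[OF this] Suc show "boundary A h (cff A i q) = (\<lambda>_. 0)"
        by (simp add: cycle_at_def)
    qed
    also have "\<dots> = (\<lambda>_. 0)" by (simp add: linear_ext_def)
    finally show ?thesis using 1 Suc unfolding cycle_at_def by auto
  qed
qed

text \<open>
  Multiplication by the monomial \<open>m\<close> embeds the quotient by the colon ideal \<open>U : m\<close> into the quotient by
  \<open>U\<close>. Since a frame is exact in each multidegree, this map lifts to the resolutions, one homological
  degree at a time.
\<close>
lemma frame_comparison:
  fixes A :: "('x, 'k::field) frame"
  assumes U: "upclosed U" and A: "frame_of U A" and B: "frame_of {t. t + m \<in> U} B"
  obtains f :: "nat \<Rightarrow> nat \<Rightarrow> nat \<Rightarrow> 'k" where
    "f 0 0 = (\<lambda>p. if p = 0 then 1 else 0)"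
    "\<And>i q. q < rnk B i \<Longrightarrow> chain_at A i (lbl B i q + m) (f i q)"
    "\<And>i q. q < rnk B (Suc i) \<Longrightarrow> boundary A i (f (Suc i) q) = linear_ext (rnk B i) (f i) (cff B i q)"
proof -
  let ?U' = "{t. t + m \<in> U}"
  let ?ch = "\<lambda>i g. \<forall>q<rnk B i. chain_at A i (lbl B i q + m) (g q)"
  let ?cy = "\<lambda>i g. \<forall>t y. cycle_at ?U' B i t y \<longrightarrow> cycle_at U A i (t + m) (linear_ext (rnk B i) g y)"
  define P where "P i g \<longleftrightarrow> (i = 0 \<longrightarrow> g 0 = (\<lambda>p. if p = 0 then 1 else 0)) \<and> ?ch i g \<and> ?cy i g"
    for i and g :: "nat \<Rightarrow> nat \<Rightarrow> 'k"
  define Q where "Q i g h \<longleftrightarrow> (\<forall>q<rnk B (Suc i). boundary A i (h q) = linear_ext (rnk B i) g (cff B i q))"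
    for i and g h :: "nat \<Rightarrow> nat \<Rightarrow> 'k"
  have B1: "rnk B 0 = 1" "lbl B 0 0 = 0" using B by (auto simp: frame_of_def)
  have A1: "rnk A 0 = 1" "lbl A 0 0 = 0" using A by (auto simp: frame_of_def)
  have chain: "chain_at A i (t + m) (linear_ext (rnk B i) g y)"
    if "?ch i g" "chain_at B i t y" for i g t y
  proof (rule chain_at_linear_ext)
    fix q assume "q < rnk B i" "y q \<noteq> 0"
    then have "lbl B i q + m \<preceq> t + m" "chain_at A i (lbl B i q + m) (g q)"
      using that by (auto simp: chain_at_def[of B])
    then show "chain_at A i (t + m) (g q)" using chain_at_mono by blast
  qed
  have "\<exists>F. \<forall>i. P i (F i) \<and> Q i (F i) (F (Suc i))"
  proof (rule dependent_nat_choice)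
    define g :: "nat \<Rightarrow> nat \<Rightarrow> 'k" where "g = (\<lambda>q p. if p = 0 then 1 else 0)"
    have ch: "?ch 0 g"
      using A1 B1 by (auto simp: chain_at_def g_def)
    have "?cy 0 g"
      using chain[OF ch] by (auto simp: cycle_at_def)
    with ch have "P 0 g" by (auto simp: P_def g_def)
    then show "\<exists>g. P 0 g" by blast
  next
    fix g i assume g: "P i g"
    let ?w = "\<lambda>q. linear_ext (rnk B i) g (cff B i q)"
    have "\<exists>u. chain_at A (Suc i) (lbl B (Suc i) q + m) u \<and> boundary A i u = ?w q"
      if q: "q < rnk B (Suc i)" for q
    proof -
      have "cycle_at ?U' B i (lbl B (Suc i) q) (cff B i q)"
        using B q unfolding frame_of_def by blast
      then have "cycle_at U A i (lbl B (Suc i) q + m) (?w q)"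
        using g unfolding P_def by blast
      then show ?thesis using A unfolding frame_of_def by blast
    qed
    then obtain h where h: "\<And>q. q < rnk B (Suc i) \<Longrightarrow>
        chain_at A (Suc i) (lbl B (Suc i) q + m) (h q) \<and> boundary A i (h q) = ?w q"
      by metis
    then have Q: "Q i g h" unfolding Q_def by blast
    have "?cy (Suc i) h"
    proof (intro allI impI)
      fix t y assume y: "cycle_at ?U' B (Suc i) t y"
      then have 1: "chain_at A (Suc i) (t + m) (linear_ext (rnk B (Suc i)) h y)"
        using chain[of "Suc i" h t y] h unfolding cycle_at_def by blast
      have "boundary A i (linear_ext (rnk B (Suc i)) h y)
          = linear_ext (rnk B (Suc i)) (\<lambda>q. boundary A i (h q)) y"
        unfolding boundary_def by (rule linear_ext_compose)
      also have "\<dots> = linear_ext (rnk B (Suc i)) ?w y"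
        using h by (intro linear_ext_cong) blast
      also have "\<dots> = linear_ext (rnk B i) g (boundary B i y)"
        unfolding boundary_def by (rule linear_ext_compose[symmetric])
      also have "\<dots> = (\<lambda>_. 0)" using y unfolding cycle_at_def by simp
      finally show "cycle_at U A (Suc i) (t + m) (linear_ext (rnk B (Suc i)) h y)"
        using 1 unfolding cycle_at_def by simp
    qed
    then have "P (Suc i) h" using h unfolding P_def by auto
    then show "\<exists>h. P (Suc i) h \<and> Q i g h" using Q by blast
  qed
  then obtain F where F: "\<And>i. P i (F i)" "\<And>i. Q i (F i) (F (Suc i))" by blast
  show thesis
    by (rule that[of F]) (use F in \<open>unfold P_def Q_def, blast+\<close>)
qed


section \<open>Mapping cones of frames\<close>

text \<open>
  Coordinates of a direct sum: the first \<open>a\<close> of them belong to the first summand.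
\<close>
definition join :: "nat \<Rightarrow> (nat \<Rightarrow> 'k) \<Rightarrow> (nat \<Rightarrow> 'k) \<Rightarrow> nat \<Rightarrow> 'k" where
  "join a x y = (\<lambda>p. if p < a then x p else y (p - a))"

text \<open>
  The mapping cone of a lift \<open>f\<close> of the multiplication by \<open>m\<close>. The basis vectors of \<open>B\<close> move up by one
  homological degree, and their labels are multiplied by \<open>m\<close>.
\<close>
definition cone ::
    "'x monomial \<Rightarrow> (nat \<Rightarrow> nat \<Rightarrow> nat \<Rightarrow> 'k::field) \<Rightarrow> ('x, 'k) frame \<Rightarrow> ('x, 'k) frame \<Rightarrow> ('x, 'k) frame"
  where
  "cone m f A B =
    \<lparr> rnk = (\<lambda>i. rnk A i + (case i of 0 \<Rightarrow> 0 | Suc h \<Rightarrow> rnk B h)),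
      lbl = (\<lambda>i q. if q < rnk A i then lbl A i q
                   else (case i of 0 \<Rightarrow> 0 | Suc h \<Rightarrow> lbl B h (q - rnk A i) + m)),
      cff = (\<lambda>i q. if q < rnk A (Suc i) then join (rnk A i) (cff A i q) (\<lambda>_. 0)
                   else join (rnk A i) (f i (q - rnk A (Suc i)))
                     (case i of 0 \<Rightarrow> (\<lambda>_. 0) | Suc h \<Rightarrow> (\<lambda>p. - cff B h (q - rnk A (Suc i)) p))) \<rparr>"

lemma join_split: "v = join a (\<lambda>p. if p < a then v p else 0) (\<lambda>p. v (a + p))"
  by (auto simp: join_def)

lemma sum_lessThan_add: "(\<Sum>q<a + b. g q) = (\<Sum>q<a. g q) + (\<Sum>q<b. g (a + q))"
  for g :: "nat \<Rightarrow> 'a::comm_monoid_add"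
  by (induction b) (simp_all add: add.assoc)

lemma boundary_cone:
  "boundary (cone m f A B) i (join (rnk A (Suc i)) x y) =
     join (rnk A i) (\<lambda>p. boundary A i x p + linear_ext (rnk B i) (f i) y p)
       (case i of 0 \<Rightarrow> (\<lambda>_. 0) | Suc h \<Rightarrow> (\<lambda>p. - boundary B h y p))"
proof (rule ext)
  fix p
  let ?a = "rnk A (Suc i)"
  have "boundary (cone m f A B) i (join ?a x y) p
     = (\<Sum>q<?a. x q * join (rnk A i) (cff A i q) (\<lambda>_. 0) p)
       + (\<Sum>q<rnk B i. y q * join (rnk A i) (f i q)
            (case i of 0 \<Rightarrow> (\<lambda>_. 0) | Suc h \<Rightarrow> (\<lambda>p. - cff B h q p)) p)"
    unfolding boundary_def linear_ext_def
    by (cases i) (simp_all add: cone_def sum_lessThan_add, simp_all add: join_def)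
  also have "\<dots> = join (rnk A i) (\<lambda>p. boundary A i x p + linear_ext (rnk B i) (f i) y p)
       (case i of 0 \<Rightarrow> (\<lambda>_. 0) | Suc h \<Rightarrow> (\<lambda>p. - boundary B h y p)) p"
    unfolding boundary_def linear_ext_def
    by (auto simp: join_def sum_negf split: nat.split)
  finally show "boundary (cone m f A B) i (join ?a x y) p = \<dots>" .
qed

lemma chain_at_cone:
  assumes x: "chain_at A i t x"
    and y: "\<And>q. y q \<noteq> 0 \<Longrightarrow> (case i of 0 \<Rightarrow> False | Suc h \<Rightarrow> q < rnk B h \<and> lbl B h q + m \<preceq> t)"
  shows "chain_at (cone m f A B) i t (join (rnk A i) x y)"
  unfolding chain_at_def
proof (intro allI impI)
  fix q assume q: "join (rnk A i) x y q \<noteq> 0"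
  show "q < rnk (cone m f A B) i \<and> lbl (cone m f A B) i q \<preceq> t"
  proof (cases "q < rnk A i")
    case True
    then show ?thesis using q x by (auto simp: join_def cone_def chain_at_def)
  next
    case False
    then have "y (q - rnk A i) \<noteq> 0" using q by (simp add: join_def)
    from y[OF this] False show ?thesis by (auto simp: cone_def split: nat.splits)
  qed
qed

text \<open>
  The cone resolves the sum of \<open>U\<close> and the principal ideal of \<open>m\<close>, because the quotient by \<open>U : m\<close> is the
  kernel of the map between the quotients by \<open>U\<close> and by this sum, up to the shift by \<open>m\<close>. Exactness in
  multidegree \<open>t\<close> is seen directly. For a cycle with components \<open>x\<close> in \<open>A\<close> and \<open>y \<noteq> 0\<close> in \<open>B\<close>, the monomial \<open>m\<close>
  divides \<open>t\<close> and \<open>y\<close> is a cycle of \<open>B\<close>, hence a boundary; subtracting the boundary of a chain above it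
  leaves a cycle of \<open>A\<close>.
\<close>
lemma frame_of_cone:
  fixes A B :: "('x, 'k::field) frame"
  assumes U: "upclosed U" and A: "frame_of U A" and B: "frame_of {t. t + m \<in> U} B"
    and f0: "f 0 0 = (\<lambda>p. if p = 0 then 1 else 0)"
    and fch: "\<And>i q. q < rnk B i \<Longrightarrow> chain_at A i (lbl B i q + m) (f i q)"
    and fb: "\<And>i q. q < rnk B (Suc i) \<Longrightarrow>
               boundary A i (f (Suc i) q) = linear_ext (rnk B i) (f i) (cff B i q)"
  shows "frame_of (U \<union> {t. m \<preceq> t}) (cone m f A B)"
proof -
  let ?C = "cone m f A B" and ?V = "U \<union> {t. m \<preceq> t}" and ?U' = "{t. t + m \<in> U}"
  have A1: "rnk A 0 = 1" "lbl A 0 0 = 0" using A by (auto simp: frame_of_def)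
  have B1: "rnk B 0 = 1" "lbl B 0 0 = 0" using B by (auto simp: frame_of_def)
  have Acyc: "cycle_at U A i (lbl A (Suc i) q) (cff A i q)" if "q < rnk A (Suc i)" for i q
    using A that unfolding frame_of_def by blast
  have Bcyc: "cycle_at ?U' B i (lbl B (Suc i) q) (cff B i q)" if "q < rnk B (Suc i)" for i q
    using B that unfolding frame_of_def by blast
  have commute: "boundary A h (linear_ext (rnk B (Suc h)) (f (Suc h)) w)
      = linear_ext (rnk B h) (f h) (boundary B h w)" for h w
    unfolding boundary_def linear_ext_compose
    by (rule linear_ext_cong) (use fb in \<open>simp add: boundary_def\<close>)
  have basis: "cycle_at ?V ?C i (lbl ?C (Suc i) q) (cff ?C i q)" if q: "q < rnk ?C (Suc i)" for i q
  proof (cases "q < rnk A (Suc i)")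
    case True
    then have eq: "lbl ?C (Suc i) q = lbl A (Suc i) q"
      "cff ?C i q = join (rnk A i) (cff A i q) (\<lambda>_. 0)"
      by (simp_all add: cone_def)
    have ch: "chain_at ?C i (lbl ?C (Suc i) q) (cff ?C i q)"
      unfolding eq using Acyc[OF True] by (intro chain_at_cone) (auto simp: cycle_at_def)
    show ?thesis
    proof (cases i)
      case 0
      then show ?thesis using ch eq Acyc[OF True] by (auto simp: cycle_at_def join_def)
    next
      case (Suc h)
      have "boundary A h (cff A i q) = (\<lambda>_. 0)" using Acyc[OF True] Suc by (simp add: cycle_at_def)
      then have "boundary ?C h (cff ?C i q) = (\<lambda>_. 0)"
        unfolding eq(2) unfolding Suc boundary_cone
        by (auto simp: join_def boundary_def split: nat.splits)
      then show ?thesis using ch Suc by (simp add: cycle_at_def)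
    qed
  next
    case False
    define q' where "q' = q - rnk A (Suc i)"
    have q': "q' < rnk B i" using q False by (simp add: cone_def q'_def)
    have eq: "lbl ?C (Suc i) q = lbl B i q' + m"
      "cff ?C i q = join (rnk A i) (f i q')
         (case i of 0 \<Rightarrow> (\<lambda>_. 0) | Suc h \<Rightarrow> (\<lambda>p. - cff B h q' p))"
      using False by (simp_all add: cone_def q'_def split: nat.split)
    have ch: "chain_at ?C i (lbl ?C (Suc i) q) (cff ?C i q)"
      unfolding eq
    proof (rule chain_at_cone[OF fch[OF q']])
      fix p assume p: "(case i of 0 \<Rightarrow> \<lambda>_. 0 | Suc h \<Rightarrow> \<lambda>p. - cff B h q' p) p \<noteq> 0"
      then obtain h where h: "i = Suc h" by (cases i) auto
      have "chain_at B h (lbl B i q') (cff B h q')" using Bcyc q' h by (auto simp: cycle_at_def)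
      then show "case i of 0 \<Rightarrow> False | Suc h \<Rightarrow> p < rnk B h \<and> lbl B h p + m \<preceq> lbl B i q' + m"
        using p h by (auto simp: chain_at_def)
    qed
    show ?thesis
    proof (cases i)
      case 0
      then show ?thesis using ch eq by (auto simp: cycle_at_def)
    next
      case (Suc h)
      have 1: "boundary A h (f i q') p + linear_ext (rnk B h) (f h) (\<lambda>p. - cff B h q' p) p = 0" for p
        using fb[of q' h] q' Suc by (simp add: linear_ext_uminus)
      have 2: "boundary B g (\<lambda>p. - cff B h q' p) = (\<lambda>_. 0)" if "h = Suc g" for g
        using Bcyc[of q' h] q' Suc that by (simp add: cycle_at_def boundary_def linear_ext_uminus)
      have "boundary ?C h (cff ?C i q) = (\<lambda>_. 0)"
        unfolding eq(2) unfolding Suc nat.case boundary_cone using 1 2 Suc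
        by (auto simp: join_def split: nat.splits)
      then show ?thesis using ch Suc by (simp add: cycle_at_def)
    qed
  qed
  have exact: "\<exists>u. chain_at ?C (Suc i) t u \<and> boundary ?C i u = v" if v: "cycle_at ?V ?C i t v" for i t v
  proof -
    define x where "x = (\<lambda>p. if p < rnk A i then v p else 0)"
    define y where "y = (\<lambda>p. v (rnk A i + p))"
    have vxy: "v = join (rnk A i) x y" unfolding x_def y_def by (rule join_split)
    have vch: "chain_at ?C i t v" using v by (simp add: cycle_at_def)
    have x: "chain_at A i t x"
      using vch unfolding chain_at_def x_def by (auto simp: cone_def)
    have y: "case i of 0 \<Rightarrow> False | Suc h \<Rightarrow> q < rnk B h \<and> lbl B h q + m \<preceq> t" if "y q \<noteq> 0" for q
      using vch that unfolding chain_at_def y_def by (auto simp: cone_def split: nat.splits)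
    have "\<exists>z w. chain_at A (Suc i) t z \<and> (\<forall>q. w q \<noteq> 0 \<longrightarrow> q < rnk B i \<and> lbl B i q + m \<preceq> t) \<and>
        (\<forall>p. boundary A i z p + linear_ext (rnk B i) (f i) w p = x p) \<and>
        (case i of 0 \<Rightarrow> True | Suc h \<Rightarrow> (\<forall>p. - boundary B h w p = y p))"
    proof (cases i)
      case 0
      have x0: "x p = (if p = 0 then x 0 else 0)" for p using x A1 0 by (auto simp: chain_at_def)
      consider "t \<in> U \<or> x = (\<lambda>_. 0)" | "m \<preceq> t" "t \<notin> U"
        using v 0 by (auto simp: x_def cycle_at_def)
      then show ?thesis
      proof cases
        case 1
        then have "cycle_at U A 0 t x" using x 0 by (simp add: cycle_at_def)
        then obtain z where "chain_at A (Suc 0) t z" "boundary A 0 z = x"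
          using A unfolding frame_of_def by blast
        then show ?thesis using 0 by (intro exI[of _ z] exI[of _ "\<lambda>_. 0"]) auto
      next
        case 2
        have "linear_ext 1 (f 0) (\<lambda>p. if p = 0 then x 0 else 0) p = x p" for p
          using f0 x0[of p] by (simp add: linear_ext_def)
        then show ?thesis using 0 2 B1
          by (intro exI[of _ "\<lambda>_. 0"] exI[of _ "\<lambda>p. if p = 0 then x 0 else 0"])
             (auto simp: chain_at_def boundary_def)
      qed
    next
      case (Suc h)
      have bd: "boundary ?C h (join (rnk A (Suc h)) x y) = (\<lambda>_. 0)"
        using v Suc unfolding cycle_at_def vxy by simp
      have Ax: "chain_at A h t (boundary A h x)"
        using cycle_at_boundary[OF U A, of h t x] x Suc by (simp add: cycle_at_def)
      show ?thesis
      proof (cases "y = (\<lambda>_. 0)")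
        case True
        have "boundary A h x p = 0" for p
          using fun_cong[OF bd[unfolded boundary_cone], of p] True Ax
          by (cases "p < rnk A h") (auto simp: join_def chain_at_def)
        then have "cycle_at U A i t x" using x Suc by (auto simp: cycle_at_def)
        then obtain z where "chain_at A (Suc i) t z" "boundary A i z = x"
          using A unfolding frame_of_def by blast
        then show ?thesis using Suc True
          by (intro exI[of _ z] exI[of _ "\<lambda>_. 0"]) (auto simp: boundary_def)
      next
        case False
        then obtain q0 where q0: "y q0 \<noteq> 0" by blast
        have "m \<preceq> lbl B h q0 + m" "lbl B h q0 + m \<preceq> t" using y[OF q0] Suc by auto
        then have "m \<preceq> t" using mono_dvd_trans by blast
        then obtain s where s: "t = s + m" unfolding mono_dvd_def by (metis add.commute)
        have ych: "chain_at B h s y" using y Suc s unfolding chain_at_def by auto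
        have fy: "chain_at A h t (linear_ext (rnk B h) (f h) y)"
        proof (rule chain_at_linear_ext)
          fix q assume "q < rnk B h" "y q \<noteq> 0"
          then have "lbl B h q + m \<preceq> t" "chain_at A h (lbl B h q + m) (f h q)"
            using fch y[of q] Suc by auto
          then show "chain_at A h t (f h q)" using chain_at_mono by blast
        qed
        have bx: "boundary A h x p + linear_ext (rnk B h) (f h) y p = 0" for p
        proof (cases "p < rnk A h")
          case True
          then show ?thesis using fun_cong[OF bd[unfolded boundary_cone], of p] by (simp add: join_def)
        next
          case False
          then have "boundary A h x p = 0" "linear_ext (rnk B h) (f h) y p = 0"
            using Ax fy unfolding chain_at_def by blast+
          then show ?thesis by simp
        qed
        \<comment> \<open>For \<open>h = 0\<close>, a nonzero multiple of the basis vector is a boundary of \<open>A\<close>, which forces \<open>t \<in> U\<close>.\<close>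
        have "cycle_at ?U' B h s y"
        proof (cases h)
          case 0
          have q00: "q0 = 0" using ych q0 B1 0 by (auto simp: chain_at_def)
          have "linear_ext (rnk B h) (f h) y 0 = y 0" using 0 B1 f0 by (simp add: linear_ext_def)
          then have "boundary A h x 0 \<noteq> 0" using bx[of 0] q0 q00 by auto
          then have "t \<in> U" using cycle_at_boundary[OF U A, of h t x] x Suc 0
            by (auto simp: cycle_at_def)
          then show ?thesis using ych 0 s by (simp add: cycle_at_def)
        next
          case (Suc g)
          have "boundary B g y p = 0" for p
            using fun_cong[OF bd[unfolded boundary_cone], of "rnk A h + p"] Suc
            by (simp add: join_def)
          then show ?thesis using ych Suc by (auto simp: cycle_at_def)
        qed
        then obtain w where w: "chain_at B (Suc h) s w" "boundary B h w = y"
          using B unfolding frame_of_def by blast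
        let ?fw = "linear_ext (rnk B i) (f i) w"
        have fw: "chain_at A i t ?fw"
        proof (rule chain_at_linear_ext)
          fix q assume q: "q < rnk B i" "w q \<noteq> 0"
          then have "lbl B i q + m \<preceq> t" using w(1) Suc s by (auto simp: chain_at_def)
          then show "chain_at A i t (f i q)" using fch[OF q(1)] chain_at_mono by blast
        qed
        have "boundary A h (\<lambda>p. x p + ?fw p) p = 0" for p
          using bx[of p] commute[of h w] Suc w(2) by (simp add: boundary_def linear_ext_add)
        then have "cycle_at U A i t (\<lambda>p. x p + ?fw p)"
          using chain_at_add[OF x fw] Suc by (auto simp: cycle_at_def)
        then obtain z where z: "chain_at A (Suc i) t z" "boundary A i z = (\<lambda>p. x p + ?fw p)"
          using A unfolding frame_of_def by blast
        have "\<forall>q. - w q \<noteq> 0 \<longrightarrow> q < rnk B i \<and> lbl B i q + m \<preceq> t"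
          using w(1) Suc s by (auto simp: chain_at_def)
        then show ?thesis using z w(2) Suc
          by (intro exI[of _ z] exI[of _ "\<lambda>p. - w p"])
             (auto simp: linear_ext_uminus boundary_def)
      qed
    qed
    then obtain z w where z: "chain_at A (Suc i) t z"
      and w: "\<And>q. w q \<noteq> 0 \<Longrightarrow> q < rnk B i \<and> lbl B i q + m \<preceq> t"
      and zw: "\<And>p. boundary A i z p + linear_ext (rnk B i) (f i) w p = x p"
        "case i of 0 \<Rightarrow> True | Suc h \<Rightarrow> (\<forall>p. - boundary B h w p = y p)" by blast
    have y0: "y = (\<lambda>_. 0)" if "i = 0" using y that by auto
    have "boundary ?C i (join (rnk A (Suc i)) z w) = v"
      unfolding boundary_cone vxy using zw y0 by (auto simp: join_def split: nat.splits)
    moreover have "chain_at ?C (Suc i) t (join (rnk A (Suc i)) z w)"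
      using w by (intro chain_at_cone[OF z]) auto
    ultimately show ?thesis by blast
  qed
  have "rnk ?C 0 = 1" "lbl ?C 0 0 = 0" using A1 by (simp_all add: cone_def)
  then show ?thesis using basis exact unfolding frame_of_def by blast
qed

definition frame_with :: "'k::field itself \<Rightarrow> (nat \<Rightarrow> 'x monomial \<Rightarrow> bool) \<Rightarrow> 'x monomial set \<Rightarrow> bool" where
  "frame_with _ P U \<longleftrightarrow>
     (\<exists>A :: ('x, 'k) frame. frame_of U A \<and> (\<forall>i. \<forall>q<rnk A i. P i (lbl A i q)))"

lemma frame_with_mono:
  "frame_with k P U \<Longrightarrow> (\<And>i t. P i t \<Longrightarrow> Q i t) \<Longrightarrow> frame_with k Q U"
  unfolding frame_with_def by blast

lemma frame_with_cone:
  fixes k :: "'k::field itself"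
  assumes U: "upclosed U" and A: "frame_with k P U" and B: "frame_with k Q {t. t + m \<in> U}"
  shows "frame_with k (\<lambda>i t. P i t \<or> (\<exists>h s. i = Suc h \<and> t = s + m \<and> Q h s)) (U \<union> {t. m \<preceq> t})"
proof -
  obtain A :: "('a, 'k) frame" where A: "frame_of U A" "\<And>i q. q < rnk A i \<Longrightarrow> P i (lbl A i q)"
    using A unfolding frame_with_def by blast
  obtain B :: "('a, 'k) frame" where B: "frame_of {t. t + m \<in> U} B" "\<And>i q. q < rnk B i \<Longrightarrow> Q i (lbl B i q)"
    using B unfolding frame_with_def by blast
  obtain f where "frame_of (U \<union> {t. m \<preceq> t}) (cone m f A B)"
  proof (rule frame_comparison[OF U A(1) B(1)])
    fix f :: "nat \<Rightarrow> nat \<Rightarrow> nat \<Rightarrow> 'k"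
    assume f: "f 0 0 = (\<lambda>p. if p = 0 then 1 else 0)"
      "\<And>i q. q < rnk B i \<Longrightarrow> chain_at A i (lbl B i q + m) (f i q)"
      "\<And>i q. q < rnk B (Suc i) \<Longrightarrow> boundary A i (f (Suc i) q) = linear_ext (rnk B i) (f i) (cff B i q)"
    show thesis by (rule that[OF frame_of_cone[OF U A(1) B(1) f]])
  qed
  moreover have "P i (lbl (cone m f A B) i q) \<or>
      (\<exists>h s. i = Suc h \<and> lbl (cone m f A B) i q = s + m \<and> Q h s)"
    if "q < rnk (cone m f A B) i" for i q
    using A(2)[of q i] B(2)[of "q - rnk A i"] that by (cases i) (auto simp: cone_def)
  ultimately show ?thesis unfolding frame_with_def by blast
qed

lemma frame_with_empty: "frame_with k (\<lambda>i t. i = 0 \<and> t = 0) {}"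
proof -
  let ?A = "\<lparr> rnk = (\<lambda>i. if i = 0 then 1 else 0), lbl = (\<lambda>_ _. 0), cff = (\<lambda>_ _ _. 0) \<rparr>"
  have "\<exists>u. chain_at ?A (Suc i) t u \<and> boundary ?A i u = v" if "cycle_at {} ?A i t v" for i t v
  proof -
    have "v = (\<lambda>_. 0)" using that by (cases i) (auto simp: cycle_at_def chain_at_def)
    then show ?thesis
      by (intro exI[of _ "\<lambda>_. 0"]) (auto simp: chain_at_def boundary_def linear_ext_def)
  qed
  then have "frame_of {} ?A" unfolding frame_of_def by auto
  then show ?thesis unfolding frame_with_def by (intro exI[of _ ?A]) auto
qed


section \<open>Maps between free modules\<close>

interpretation sv: Modules.module "scale_vec :: 'a::comm_ring_1 \<Rightarrow> _"
  by (rule module_scale_vec)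

interpretation kv: Vector_Spaces.vector_space "scale_vec :: 'k::field \<Rightarrow> _"
  by (rule vector_space_scale_vec)


lemma lookup_lin_map:
  assumes "finite K" "keys v \<subseteq> K"
  shows "lookup (lin_map g v) p = (\<Sum>q\<in>K. lookup v q * lookup (g q) p)"
proof -
  have "lookup (lin_map g v) p = (\<Sum>q\<in>keys v. lookup v q * lookup (g q) p)"
    by (simp add: lin_map_def lookup_sum lookup_scale_vec)
  also have "\<dots> = (\<Sum>q\<in>K. lookup v q * lookup (g q) p)"
    using assms by (intro sum.mono_neutral_left) (auto simp: in_keys_iff)
  finally show ?thesis .
qed

lemma lookup_lin_map_free:
  "v \<in> free_module n \<Longrightarrow> lookup (lin_map g v) p = (\<Sum>q<n. lookup v q * lookup (g q) p)"
  by (rule lookup_lin_map) (auto simp: free_module_def)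

lemma lin_map_0 [simp]: "lin_map g 0 = 0"
  by (simp add: lin_map_def)

lemma lin_map_add: "lin_map g (v + w) = lin_map g v + lin_map g w"
proof (rule poly_mapping_eqI)
  fix p
  let ?K = "keys v \<union> keys w"
  have "keys (v + w) \<subseteq> ?K" by (rule Poly_Mapping.keys_add)
  then show "lookup (lin_map g (v + w)) p = lookup (lin_map g v + lin_map g w) p"
    by (simp add: lookup_lin_map[of ?K] Poly_Mapping.lookup_add algebra_simps sum.distrib)
qed

lemma lin_map_scale: "lin_map g (scale_vec c v) = scale_vec c (lin_map g v)"
proof (rule poly_mapping_eqI)
  fix p
  have "keys (scale_vec c v) \<subseteq> keys v"
    by (auto simp: in_keys_iff lookup_scale_vec)
  then show "lookup (lin_map g (scale_vec c v)) p = lookup (scale_vec c (lin_map g v)) p"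
    by (simp add: lookup_lin_map[of "keys v"] lookup_scale_vec sum_distrib_left mult.assoc)
qed

lemma lin_map_uminus: "lin_map g (- v) = - lin_map g v"
  using lin_map_add[of g v "- v"] by (simp add: add_eq_0_iff)

lemma lin_map_diff: "lin_map g (v - w) = lin_map g v - lin_map g w"
  using lin_map_add[of g v "- w"] by (simp add: lin_map_uminus)

lemma lin_map_single [simp]: "lin_map g (single q c) = scale_vec c (g q)"
  by (rule poly_mapping_eqI)
     (simp add: lookup_lin_map[of "{q}"] lookup_scale_vec)

lemma scale_vec_one [simp]: "scale_vec 1 v = v"
  by (rule poly_mapping_eqI) (simp add: lookup_scale_vec)

lemma lin_map_sum: "lin_map g (\<Sum>x\<in>X. f x) = (\<Sum>x\<in>X. lin_map g (f x))"
  by (induction X rule: infinite_finite_induct) (simp_all add: lin_map_add)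

lemma lin_map_compose: "lin_map g (lin_map h v) = lin_map (\<lambda>q. lin_map g (h q)) v"
  by (simp add: lin_map_def[of h] lin_map_sum lin_map_scale) (simp add: lin_map_def)

lemma lin_map_cong:
  "v \<in> free_module n \<Longrightarrow> (\<And>q. q < n \<Longrightarrow> g q = h q) \<Longrightarrow> lin_map g v = lin_map h v"
  unfolding lin_map_def free_module_def by (intro sum.cong) auto

lemma lin_map_diff_maps: "lin_map (\<lambda>q. g q - h q) v = lin_map g v - lin_map h v"
  by (rule poly_mapping_eqI)
     (simp add: lookup_lin_map[OF finite_keys order_refl] lookup_minus algebra_simps sum_subtractf)

lemma lin_map_id: "lin_map (\<lambda>q. single q 1) v = v"
proof (rule poly_mapping_eqI)
  fix p
  show "lookup (lin_map (\<lambda>q. single q 1) v) p = lookup v p"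
    by (subst lookup_lin_map[of "insert p (keys v)"])
       (auto simp: lookup_single when_def if_distrib[of "\<lambda>x. _ * x"] sum.delta in_keys_iff cong: if_cong)
qed

lemma free_module_iff: "v \<in> free_module n \<longleftrightarrow> (\<forall>p. lookup v p \<noteq> 0 \<longrightarrow> p < n)"
  by (auto simp: free_module_def in_keys_iff)

lemma free_module_eq: "free_module n = {v. \<forall>p. lookup v p \<noteq> 0 \<longrightarrow> p < n}"
  using free_module_iff by blast

lemma subspace_free_module: "sv.subspace (free_module n :: (nat \<Rightarrow>\<^sub>0 'a::comm_ring_1) set)"
  unfolding sv.subspace_def free_module_eq
proof (intro conjI ballI allI)
  fix x y :: "nat \<Rightarrow>\<^sub>0 'a"
  assume "x \<in> {v. \<forall>p. lookup v p \<noteq> 0 \<longrightarrow> p < n}" "y \<in> {v. \<forall>p. lookup v p \<noteq> 0 \<longrightarrow> p < n}"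
  then show "x + y \<in> {v. \<forall>p. lookup v p \<noteq> 0 \<longrightarrow> p < n}"
    by (auto simp: Poly_Mapping.lookup_add) (metis add.right_neutral)
qed (auto simp: lookup_scale_vec, metis mult_zero_right)

lemma lin_map_in_free_module:
  assumes "v \<in> free_module n" "\<And>q. q < n \<Longrightarrow> g q \<in> free_module m"
  shows "lin_map g v \<in> free_module m"
  unfolding lin_map_def
  by (rule sv.subspace_sum[OF subspace_free_module], rule sv.subspace_scale[OF subspace_free_module])
     (use assms in \<open>auto simp: free_module_def\<close>)

lemma single_in_free_module: "q < n \<Longrightarrow> single q c \<in> free_module n"
  by (auto simp: free_module_iff lookup_single when_def)

lemma span_lin_map: "sv.span (g ` {..<n}) = lin_map g ` free_module n"
proof
  have "sv.subspace (lin_map g ` free_module n)"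
    unfolding sv.subspace_def
  proof (intro conjI ballI allI)
    show "0 \<in> lin_map g ` free_module n"
      by (rule image_eqI[of _ _ 0]) (simp_all add: free_module_def)
  next
    fix x y assume "x \<in> lin_map g ` free_module n" "y \<in> lin_map g ` free_module n"
    then obtain v w where "v \<in> free_module n" "x = lin_map g v" "w \<in> free_module n" "y = lin_map g w"
      by blast
    then show "x + y \<in> lin_map g ` free_module n"
      by (intro image_eqI[of _ _ "v + w"])
         (simp_all add: lin_map_add sv.subspace_add[OF subspace_free_module])
  next
    fix c x assume "x \<in> lin_map g ` free_module n"
    then obtain v where "v \<in> free_module n" "x = lin_map g v" by blast
    then show "scale_vec c x \<in> lin_map g ` free_module n"
      by (intro image_eqI[of _ _ "scale_vec c v"])
         (simp_all add: lin_map_scale sv.subspace_scale[OF subspace_free_module])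
  qed
  moreover have "g ` {..<n} \<subseteq> lin_map g ` free_module n"
  proof
    fix x assume "x \<in> g ` {..<n}"
    then obtain q where "q < n" "x = g q" by auto
    then show "x \<in> lin_map g ` free_module n"
      by (intro image_eqI[of _ _ "single q 1"]) (simp_all add: single_in_free_module)
  qed
  ultimately show "sv.span (g ` {..<n}) \<subseteq> lin_map g ` free_module n"
    using sv.span_minimal by blast
  show "lin_map g ` free_module n \<subseteq> sv.span (g ` {..<n})"
    unfolding lin_map_def free_module_def
    by (intro image_subsetI sv.span_sum sv.span_scale sv.span_base) auto
qed

lemma monomial_degree_sum:
  assumes "finite K" "keys t \<subseteq> K"
  shows "monomial_degree t = (\<Sum>v\<in>K. lookup t v)"
  unfolding monomial_degree_def using assms
  by (intro sum.mono_neutral_left) (auto simp: in_keys_iff)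

lemma monomial_degree_add: "monomial_degree (s + t) = monomial_degree s + monomial_degree t"
proof -
  let ?K = "keys s \<union> keys t"
  have "keys (s + t) \<subseteq> ?K" by (rule Poly_Mapping.keys_add)
  then show ?thesis
    by (simp add: monomial_degree_sum[of ?K] Poly_Mapping.lookup_add sum.distrib)
qed

lemma monomial_degree_0 [simp]: "monomial_degree 0 = 0"
  by (simp add: monomial_degree_def)

definition hom_part :: "int \<Rightarrow> ('x, 'k::zero) polynomial \<Rightarrow> ('x, 'k) polynomial" where
  "hom_part d f = Poly_Mapping.mapp (\<lambda>t c. if int (monomial_degree t) = d then c else 0) f"

lemma lookup_hom_part: "lookup (hom_part d f) t = (if int (monomial_degree t) = d then lookup f t else 0)"
  by (simp add: hom_part_def lookup_mapp when_def in_keys_iff)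

lemma hom_part_homogeneous: "homogeneous d (hom_part d f)"
  by (auto simp: homogeneous_def in_keys_iff lookup_hom_part split: if_splits)

lemma hom_part_id: "homogeneous d f \<Longrightarrow> hom_part d f = f"
  by (rule poly_mapping_eqI) (auto simp: homogeneous_def in_keys_iff lookup_hom_part)

lemma hom_part_add: "hom_part d (f + g) = hom_part d f + hom_part d g"
  by (rule poly_mapping_eqI) (auto simp: lookup_hom_part Poly_Mapping.lookup_add)

lemma hom_part_diff:
  fixes f g :: "('x, 'k::ab_group_add) polynomial"
  shows "hom_part d (f - g) = hom_part d f - hom_part d g"
  by (rule poly_mapping_eqI) (auto simp: lookup_hom_part lookup_minus)

lemma hom_part_0 [simp]: "hom_part d 0 = 0"
  by (rule poly_mapping_eqI) (auto simp: lookup_hom_part)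

lemma hom_part_sum: "hom_part d (\<Sum>x\<in>X. f x) = (\<Sum>x\<in>X. hom_part d (f x))"
  by (induction X rule: infinite_finite_induct) (simp_all add: hom_part_add)

lemma homogeneous_mult:
  fixes f g :: "('x, 'k::comm_ring_1) polynomial"
  assumes "homogeneous d f" "homogeneous e g"
  shows "homogeneous (d + e) (f * g)"
  using assms keys_mult[of f g] unfolding homogeneous_def
  by (force simp: monomial_degree_add)

lemma hom_part_mult:
  fixes f g :: "('x, 'k::comm_ring_1) polynomial"
  assumes g: "homogeneous e g"
  shows "hom_part d (f * g) = hom_part (d - e) f * g"
proof -
  let ?h = "f - hom_part (d - e) f"
  have "hom_part d (?h * g) = 0"
  proof (rule poly_mapping_eqI)
    fix t
    have "int (monomial_degree t) \<noteq> d" if t: "t \<in> keys (?h * g)"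
    proof -
      obtain a b where ab: "t = a + b" "a \<in> keys ?h" "b \<in> keys g"
        using keys_mult[of ?h g] t by blast
      have "int (monomial_degree a) \<noteq> d - e"
        using ab(2) by (auto simp: in_keys_iff lookup_minus lookup_hom_part)
      moreover have "int (monomial_degree b) = e" using ab(3) g by (simp add: homogeneous_def)
      ultimately show ?thesis using ab(1) by (auto simp: monomial_degree_add)
    qed
    then show "lookup (hom_part d (?h * g)) t = lookup 0 t" by (auto simp: lookup_hom_part in_keys_iff)
  qed
  moreover have "hom_part d (hom_part (d - e) f * g) = hom_part (d - e) f * g"
    using homogeneous_mult[OF hom_part_homogeneous[of "d - e" f] g] by (simp add: hom_part_id)
  moreover have "f * g = hom_part (d - e) f * g + ?h * g" by (simp add: algebra_simps)
  ultimately show ?thesis by (metis add.right_neutral hom_part_add)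
qed

lemma homogeneous_zero [simp]: "homogeneous d 0"
  by (simp add: homogeneous_def)

lemma homogeneous_add:
  "homogeneous d f \<Longrightarrow> homogeneous d g \<Longrightarrow> homogeneous d (f + g)"
  using Poly_Mapping.keys_add[of f g] unfolding homogeneous_def by blast

lemma homogeneous_diff:
  fixes f g :: "('x, 'k::ab_group_add) polynomial"
  shows "homogeneous d f \<Longrightarrow> homogeneous d g \<Longrightarrow> homogeneous d (f - g)"
  unfolding homogeneous_def by (auto simp: in_keys_iff lookup_minus)

lemma homogeneous_sum:
  "(\<And>x. x \<in> X \<Longrightarrow> homogeneous d (f x)) \<Longrightarrow> homogeneous d (\<Sum>x\<in>X. f x)"
  by (induction X rule: infinite_finite_induct) (simp_all add: homogeneous_add)

text \<open>
  If a monomial splits in only one way into monomials of the factors, then its coefficient in the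
  product is the product of two coefficients.
\<close>
lemma lookup_mult_unique:
  fixes f g :: "('x, 'k::comm_ring_1) polynomial"
  assumes uniq: "\<And>s t. s \<in> keys f \<Longrightarrow> t \<in> keys g \<Longrightarrow> s + t = a + b \<Longrightarrow> s = a \<and> t = b"
  shows "lookup (f * g) (a + b) = lookup f a * lookup g b"
proof -
  define f' where "f' = f - single a (lookup f a)"
  define g' where "g' = g - single b (lookup g b)"
  let ?S = "single a (lookup f a) :: ('x, 'k) polynomial"
  let ?T = "single b (lookup g b) :: ('x, 'k) polynomial"
  have f'k: "keys f' \<subseteq> keys f - {a}"
    by (auto simp: f'_def in_keys_iff lookup_minus lookup_single when_def split: if_splits)
  have g'k: "keys g' \<subseteq> keys g - {b}"
    by (auto simp: g'_def in_keys_iff lookup_minus lookup_single when_def split: if_splits)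
  have Sk: "keys ?S \<subseteq> keys f \<inter> {a}" by (auto simp: in_keys_iff)
  have z: "lookup (p * q) (a + b) = 0"
    if "\<And>s t. s \<in> keys p \<Longrightarrow> t \<in> keys q \<Longrightarrow> s + t \<noteq> a + b"
    for p q :: "('x, 'k) polynomial"
  proof -
    have "a + b \<notin> keys (p * q)"
    proof
      assume "a + b \<in> keys (p * q)"
      then obtain s t where "a + b = s + t" "s \<in> keys p" "t \<in> keys q"
        using keys_mult[of p q] by blast
      then show False using that[of s t] by simp
    qed
    then show ?thesis by (simp add: in_keys_iff)
  qed
  have fg: "f = ?S + f'" "g = ?T + g'" by (simp_all add: f'_def g'_def)
  have "f * g = ?S * g + f' * g" by (subst fg(1)) (rule distrib_right)
  also have "?S * g = ?S * ?T + ?S * g'" by (subst fg(2)) (rule distrib_left)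
  finally have "f * g = ?S * ?T + ?S * g' + f' * g" .
  then have "lookup (f * g) (a + b) = lookup (?S * ?T) (a + b) + lookup (?S * g') (a + b) + lookup (f' * g) (a + b)"
    by (simp only: Poly_Mapping.lookup_add)
  moreover have "lookup (?S * g') (a + b) = 0"
  proof (rule z)
    fix s t assume st: "s \<in> keys ?S" "t \<in> keys g'"
    then show "s + t \<noteq> a + b" using uniq[of s t] Sk g'k by blast
  qed
  moreover have "lookup (f' * g) (a + b) = 0"
  proof (rule z)
    fix s t assume st: "s \<in> keys f'" "t \<in> keys g"
    then show "s + t \<noteq> a + b" using uniq[of s t] f'k by blast
  qed
  moreover have "lookup (?S * ?T) (a + b) = lookup f a * lookup g b" by (simp add: mult_single)
  ultimately show ?thesis by simp
qed

lemma monomial_add_eq_0: "s + t = 0 \<longleftrightarrow> s = 0 \<and> t = 0" for s t :: "'x monomial"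
proof
  assume st: "s + t = 0"
  then have "lookup s v + lookup t v = 0" for v by (metis Poly_Mapping.lookup_add lookup_zero)
  then show "s = 0 \<and> t = 0" by (auto intro: poly_mapping_eqI)
qed simp

text \<open>
  Taking constant terms is multiplicative since \<open>0\<close> is the only divisor of the monomial \<open>0\<close>.
\<close>
lemma constant_term_mult:
  fixes f g :: "('x, 'k::comm_ring_1) polynomial"
  shows "lookup (f * g) 0 = lookup f 0 * lookup g 0"
  using lookup_mult_unique[of f g 0 0] by (simp add: monomial_add_eq_0)

text \<open>
  The image of a vector under \<open>F_i \<rightarrow> F_i \<otimes> k\<close>.
\<close>
definition constants :: "(nat \<Rightarrow>\<^sub>0 ('x, 'k::field) polynomial) \<Rightarrow> (nat \<Rightarrow>\<^sub>0 'k)" where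
  "constants v = Poly_Mapping.map (\<lambda>f. lookup f 0) v"

lemma lookup_constants [simp]: "lookup (constants v) q = lookup (lookup v q) 0"
  by (simp add: constants_def Poly_Mapping.map.rep_eq when_def)

lemma constants_lin_map: "constants (lin_map g v) = lin_map (\<lambda>q. constants (g q)) (constants v)"
proof (rule poly_mapping_eqI)
  fix p
  have "keys (constants v) \<subseteq> keys v"
    by (auto simp: in_keys_iff)
  then show "lookup (constants (lin_map g v)) p = lookup (lin_map (\<lambda>q. constants (g q)) (constants v)) p"
    by (simp add: lookup_lin_map[of "keys v"] lookup_sum constant_term_mult)
qed

lemma constants_diff: "constants (v - w) = constants v - constants w"
  by (rule poly_mapping_eqI) (simp add: lookup_minus)

lemma constants_single_one: "constants (single q 1) = single q 1"
  by (rule poly_mapping_eqI) (auto simp: lookup_single when_def)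

lemma constants_zero [simp]: "constants 0 = 0"
  by (rule poly_mapping_eqI) simp

lemma tensor_diff_constants: "tensor_diff F i = lin_map (\<lambda>q. constants (differential F i q))"
  by (simp add: tensor_diff_def constants_def)


section \<open>Chain maps and homotopies\<close>

definition poly_ideal :: "('x, 'k::field) polynomial set \<Rightarrow> bool" where
  "poly_ideal I \<longleftrightarrow> 0 \<in> I \<and> (\<forall>f\<in>I. \<forall>g\<in>I. f + g \<in> I) \<and> (\<forall>c. \<forall>f\<in>I. c * f \<in> I)"

lemma poly_ideal_sum:
  "poly_ideal I \<Longrightarrow> (\<And>x. x \<in> X \<Longrightarrow> f x \<in> I) \<Longrightarrow> (\<Sum>x\<in>X. f x) \<in> I"
  by (induction X rule: infinite_finite_induct) (simp_all add: poly_ideal_def)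

lemma poly_ideal_uminus: "poly_ideal I \<Longrightarrow> f \<in> I \<Longrightarrow> - f \<in> I"
  unfolding poly_ideal_def by (metis mult_minus1)

lemma poly_ideal_diff: "poly_ideal I \<Longrightarrow> f \<in> I \<Longrightarrow> g \<in> I \<Longrightarrow> f - g \<in> I"
  using poly_ideal_uminus[of I g] unfolding poly_ideal_def by (metis diff_conv_add_uminus)

definition graded_ideal :: "('x, 'k::field) polynomial set \<Rightarrow> bool" where
  "graded_ideal I \<longleftrightarrow> poly_ideal I \<and> (\<forall>f\<in>I. \<forall>d. hom_part d f \<in> I)"

lemma aug_map_eq:
  assumes "finite K" "keys v \<subseteq> K"
  shows "aug_map F v = (\<Sum>q\<in>K. lookup v q * aug F q)"
  unfolding aug_map_def using assms by (intro sum.mono_neutral_left) (auto simp: in_keys_iff)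

lemma aug_map_add: "aug_map F (v + w) = aug_map F v + aug_map F w"
proof -
  let ?K = "keys v \<union> keys w"
  have "keys (v + w) \<subseteq> ?K" by (rule Poly_Mapping.keys_add)
  then show ?thesis
    by (simp add: aug_map_eq[of ?K] Poly_Mapping.lookup_add algebra_simps sum.distrib)
qed

lemma aug_map_scale: "aug_map F (scale_vec c v) = c * aug_map F v"
proof -
  have "keys (scale_vec c v) \<subseteq> keys v"
    by (auto simp: in_keys_iff lookup_scale_vec)
  then show ?thesis
    by (simp add: aug_map_eq[of "keys v"] lookup_scale_vec sum_distrib_left mult.assoc)
qed

lemma aug_map_diff: "aug_map F (v - w) = aug_map F v - aug_map F w"
  using aug_map_add[of F "v - w" w] by simp

lemma aug_map_single [simp]: "aug_map F (single q c) = c * aug F q"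
  by (simp add: aug_map_eq[of "{q}"])

lemma aug_map_0 [simp]: "aug_map F 0 = 0"
  by (simp add: aug_map_def)

lemma aug_map_sum: "aug_map F (\<Sum>x\<in>X. f x) = (\<Sum>x\<in>X. aug_map F (f x))"
  by (induction X rule: infinite_finite_induct) (simp_all add: aug_map_add)

lemma aug_map_lin_map: "aug_map F (lin_map g v) = (\<Sum>q\<in>keys v. lookup v q * aug_map F (g q))"
  by (simp add: lin_map_def aug_map_sum aug_map_scale)

text \<open>
  The kernel of the map out of \<open>F_i\<close>, which is the map to \<open>S/I\<close> for \<open>i = 0\<close>.
\<close>
definition cycles ::
    "('x, 'k::field) polynomial set \<Rightarrow> ('x, 'k) free_complex \<Rightarrow> nat \<Rightarrow> (nat \<Rightarrow>\<^sub>0 ('x, 'k) polynomial) set"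
  where
  "cycles I F i = {v \<in> free_module (rank_at F i).
     case i of 0 \<Rightarrow> aug_map F v \<in> I | Suc h \<Rightarrow> lin_map (differential F h) v = 0}"

definition hom_vec ::
    "('x, 'k::field) free_complex \<Rightarrow> nat \<Rightarrow> int \<Rightarrow> (nat \<Rightarrow>\<^sub>0 ('x, 'k) polynomial) \<Rightarrow> bool" where
  "hom_vec F i d v \<longleftrightarrow> v \<in> free_module (rank_at F i) \<and>
     (\<forall>p<rank_at F i. homogeneous (d - shifts F i ! p) (lookup v p))"

lemma cycles_eq_boundaries:
  assumes "graded_free_resolution I F"
  shows "cycles I F i = lin_map (differential F i) ` free_module (rank_at F (Suc i))"
  using assms by (cases i) (auto simp: cycles_def graded_free_resolution_def span_lin_map)

lemma differential_hom_vec: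
  assumes "graded_free_resolution I F" "q < rank_at F (Suc i)"
  shows "hom_vec F i (shifts F (Suc i) ! q) (differential F i q)"
  using assms by (simp add: graded_free_resolution_def hom_vec_def)

lemma differential_cycle:
  assumes "graded_free_resolution I F" "q < rank_at F (Suc i)"
  shows "differential F i q \<in> cycles I F i"
  unfolding cycles_eq_boundaries[OF assms(1)]
  by (rule image_eqI[of _ _ "single q 1"]) (simp_all add: assms single_in_free_module)

lemma hom_vec_diff: "hom_vec F i d v \<Longrightarrow> hom_vec F i d w \<Longrightarrow> hom_vec F i d (v - w)"
  unfolding hom_vec_def
  by (simp add: lookup_minus homogeneous_diff sv.subspace_diff[OF subspace_free_module])

lemma hom_vec_single: "q < rank_at F i \<Longrightarrow> hom_vec F i (shifts F i ! q) (single q 1)"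
  unfolding hom_vec_def
  by (auto simp: single_in_free_module lookup_single when_def homogeneous_def simp flip: single_one)

lemma hom_vec_lin_map:
  assumes v: "hom_vec F i d v" and g: "\<And>q. q < rank_at F i \<Longrightarrow> hom_vec G j (shifts F i ! q) (g q)"
  shows "hom_vec G j d (lin_map g v)"
  unfolding hom_vec_def
proof (intro conjI allI impI)
  have vf: "v \<in> free_module (rank_at F i)" using v by (simp add: hom_vec_def)
  show "lin_map g v \<in> free_module (rank_at G j)"
    using g by (intro lin_map_in_free_module[OF vf]) (simp add: hom_vec_def)
  fix p assume p: "p < rank_at G j"
  show "homogeneous (d - shifts G j ! p) (lookup (lin_map g v) p)"
    unfolding lookup_lin_map_free[OF vf]
  proof (rule homogeneous_sum)
    fix q assume "q \<in> {..<rank_at F i}"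
    then have "homogeneous (d - shifts F i ! q) (lookup v q)"
      "homogeneous (shifts F i ! q - shifts G j ! p) (lookup (g q) p)"
      using v g p by (auto simp: hom_vec_def)
    from homogeneous_mult[OF this]
    show "homogeneous (d - shifts G j ! p) (lookup v q * lookup (g q) p)" by simp
  qed
qed

definition vec_part ::
    "('x, 'k::field) free_complex \<Rightarrow> nat \<Rightarrow> int \<Rightarrow> (nat \<Rightarrow>\<^sub>0 ('x, 'k) polynomial) \<Rightarrow> (nat \<Rightarrow>\<^sub>0 ('x, 'k) polynomial)"
  where "vec_part F i d v = Poly_Mapping.mapp (\<lambda>q. hom_part (d - shifts F i ! q)) v"

lemma lookup_vec_part: "lookup (vec_part F i d v) q = hom_part (d - shifts F i ! q) (lookup v q)"
  by (auto simp: vec_part_def lookup_mapp when_def in_keys_iff)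

lemma hom_vec_part: "v \<in> free_module (rank_at F i) \<Longrightarrow> hom_vec F i d (vec_part F i d v)"
  by (auto simp: hom_vec_def lookup_vec_part hom_part_homogeneous free_module_iff) (metis hom_part_0)

text \<open>
  Exactness provides a preimage. As the differential preserves degrees, its part of degree \<open>d\<close> is a
  preimage, too.
\<close>
lemma homogeneous_lift:
  assumes F: "graded_free_resolution I F" and v: "v \<in> cycles I F i" "hom_vec F i d v"
  shows "\<exists>u. hom_vec F (Suc i) d u \<and> lin_map (differential F i) u = v"
proof -
  obtain u where u: "u \<in> free_module (rank_at F (Suc i))" "lin_map (differential F i) u = v"
    using v(1) cycles_eq_boundaries[OF F] by auto
  let ?u = "vec_part F (Suc i) d u"
  have hu: "hom_vec F (Suc i) d ?u" by (rule hom_vec_part[OF u(1)])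
  have "lookup (lin_map (differential F i) ?u) p = lookup v p" for p
  proof (cases "p < rank_at F i")
    case True
    have "lookup v p = hom_part (d - shifts F i ! p) (lookup v p)"
      using v(2) True by (simp add: hom_vec_def hom_part_id)
    also have "\<dots> = hom_part (d - shifts F i ! p)
        (\<Sum>q<rank_at F (Suc i). lookup u q * lookup (differential F i q) p)"
      by (simp only: u(2)[symmetric] lookup_lin_map_free[OF u(1)])
    also have "\<dots> = (\<Sum>q<rank_at F (Suc i). lookup ?u q * lookup (differential F i q) p)"
      unfolding hom_part_sum
    proof (rule sum.cong[OF refl])
      fix q assume "q \<in> {..<rank_at F (Suc i)}"
      then have "homogeneous (shifts F (Suc i) ! q - shifts F i ! p) (lookup (differential F i q) p)"
        using differential_hom_vec[OF F] True by (auto simp: hom_vec_def)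
      from hom_part_mult[OF this, of "d - shifts F i ! p" "lookup u q"]
      show "hom_part (d - shifts F i ! p) (lookup u q * lookup (differential F i q) p)
          = lookup ?u q * lookup (differential F i q) p" by (simp add: lookup_vec_part)
    qed
    also have "\<dots> = lookup (lin_map (differential F i) ?u) p"
      using lookup_lin_map_free[of ?u "rank_at F (Suc i)"] hu by (simp add: hom_vec_def)
    finally show ?thesis by simp
  next
    case False
    have "hom_vec F i d (lin_map (differential F i) ?u)"
      by (rule hom_vec_lin_map[OF hu]) (rule differential_hom_vec[OF F])
    then have "lookup (lin_map (differential F i) ?u) p = 0" "lookup v p = 0"
      using False v(2) unfolding hom_vec_def free_module_iff by blast+
    then show ?thesis by simp
  qed
  then show ?thesis using hu by (blast intro: poly_mapping_eqI)
qed

lemma homogeneous_lift_aug: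
  assumes I: "graded_ideal I" and F: "graded_free_resolution I F" and f: "homogeneous d f"
  shows "\<exists>v. hom_vec F 0 d v \<and> f - aug_map F v \<in> I"
proof -
  obtain v where v: "v \<in> free_module (rank_at F 0)" "f - aug_map F v \<in> I"
    using F unfolding graded_free_resolution_def by blast
  let ?v = "vec_part F 0 d v"
  have hv: "hom_vec F 0 d ?v" by (rule hom_vec_part[OF v(1)])
  have aug: "aug_map F w = (\<Sum>q<rank_at F 0. lookup w q * aug F q)" if "w \<in> free_module (rank_at F 0)" for w
    using that by (intro aug_map_eq) (auto simp: free_module_def)
  have "hom_part d (aug_map F v) = (\<Sum>q<rank_at F 0. lookup ?v q * aug F q)"
    unfolding aug[OF v(1)] hom_part_sum
  proof (rule sum.cong[OF refl])
    fix q assume "q \<in> {..<rank_at F 0}"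
    then have "homogeneous (shifts F 0 ! q) (aug F q)"
      using F by (auto simp: graded_free_resolution_def)
    from hom_part_mult[OF this]
    show "hom_part d (lookup v q * aug F q) = lookup ?v q * aug F q" by (simp add: lookup_vec_part)
  qed
  also have "\<dots> = aug_map F ?v" using hv by (simp add: aug hom_vec_def)
  finally have "hom_part d (f - aug_map F v) = f - aug_map F ?v"
    using f by (simp add: hom_part_diff hom_part_id)
  then have "f - aug_map F ?v \<in> I" using I v(2) unfolding graded_ideal_def by metis
  then show ?thesis using hv by blast
qed

definition graded_map ::
    "('x, 'k::field) free_complex \<Rightarrow> ('x, 'k) free_complex \<Rightarrow> nat \<Rightarrow> nat \<Rightarrow>
     (nat \<Rightarrow> (nat \<Rightarrow>\<^sub>0 ('x, 'k) polynomial)) \<Rightarrow> bool" where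
  "graded_map F G i j g \<longleftrightarrow> (\<forall>q<rank_at F i. hom_vec G j (shifts F i ! q) (g q))"

definition chain_map ::
    "('x, 'k::field) free_complex \<Rightarrow> ('x, 'k) free_complex \<Rightarrow>
     (nat \<Rightarrow> nat \<Rightarrow> (nat \<Rightarrow>\<^sub>0 ('x, 'k) polynomial)) \<Rightarrow> bool" where
  "chain_map F G f \<longleftrightarrow> (\<forall>i. graded_map F G i i (f i)) \<and>
     (\<forall>i. \<forall>v\<in>free_module (rank_at F (Suc i)).
        lin_map (differential G i) (lin_map (f (Suc i)) v) = lin_map (f i) (lin_map (differential F i) v))"

lemma lin_map_eqI:
  "v \<in> free_module n \<Longrightarrow> (\<And>q. q < n \<Longrightarrow> lin_map g (f q) = lin_map g' (f' q)) \<Longrightarrow>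
     lin_map g (lin_map f v) = lin_map g' (lin_map f' v)"
  unfolding lin_map_compose by (rule lin_map_cong)

text \<open>
  The identity of \<open>S/I\<close> lifts to graded resolutions because the source is free and the target exact.
  The invariant of the recursion is that cycles go to cycles, which is what the next step needs.
\<close>
lemma chain_map_exists:
  fixes F G :: "('x, 'k::field) free_complex"
  assumes I: "graded_ideal I" and F: "graded_free_resolution I F" and G: "graded_free_resolution I G"
  shows "\<exists>f. chain_map F G f \<and>
           (\<forall>v\<in>free_module (rank_at F 0). aug_map F v - aug_map G (lin_map (f 0) v) \<in> I)"
proof -
  have Ii: "poly_ideal I" using I by (simp add: graded_ideal_def)
  let ?aug = "\<lambda>g. \<forall>v\<in>free_module (rank_at F 0). aug_map F v - aug_map G (lin_map g v) \<in> I"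
  let ?cyc = "\<lambda>i g. \<forall>v\<in>cycles I F i. lin_map g v \<in> cycles I G i"
  define P where "P i g \<longleftrightarrow> graded_map F G i i g \<and> (i = 0 \<longrightarrow> ?aug g) \<and> ?cyc i g"
    for i and g :: "nat \<Rightarrow> (nat \<Rightarrow>\<^sub>0 ('x, 'k) polynomial)"
  define Q where "Q i g h \<longleftrightarrow> (\<forall>v\<in>free_module (rank_at F (Suc i)).
        lin_map (differential G i) (lin_map h v) = lin_map g (lin_map (differential F i) v))"
    for i and g h :: "nat \<Rightarrow> (nat \<Rightarrow>\<^sub>0 ('x, 'k) polynomial)"
  have free: "lin_map g v \<in> free_module (rank_at G i)"
    if "graded_map F G i i g" "v \<in> free_module (rank_at F i)" for i g v
    using that by (intro lin_map_in_free_module) (auto simp: graded_map_def hom_vec_def)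
  have "\<exists>f. \<forall>i. P i (f i) \<and> Q i (f i) (f (Suc i))"
  proof (rule dependent_nat_choice)
    have "\<exists>w. hom_vec G 0 (shifts F 0 ! q) w \<and> aug F q - aug_map G w \<in> I"
      if "q < rank_at F 0" for q
      using homogeneous_lift_aug[OF I G] F that unfolding graded_free_resolution_def by blast
    then obtain g where g: "\<And>q. q < rank_at F 0 \<Longrightarrow> hom_vec G 0 (shifts F 0 ! q) (g q)"
      "\<And>q. q < rank_at F 0 \<Longrightarrow> aug F q - aug_map G (g q) \<in> I" by metis
    then have gm: "graded_map F G 0 0 g" by (simp add: graded_map_def)
    have aug: "?aug g"
    proof
      fix v :: "nat \<Rightarrow>\<^sub>0 ('x, 'k) polynomial" assume v: "v \<in> free_module (rank_at F 0)"
      have "aug_map F v - aug_map G (lin_map g v)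
          = (\<Sum>q\<in>keys v. lookup v q * (aug F q - aug_map G (g q)))"
        by (simp add: aug_map_lin_map right_diff_distrib sum_subtractf) (simp add: aug_map_def)
      also have "\<dots> \<in> I"
        using g(2) v Ii by (intro poly_ideal_sum[OF Ii]) (auto simp: poly_ideal_def free_module_def)
      finally show "aug_map F v - aug_map G (lin_map g v) \<in> I" .
    qed
    have "?cyc 0 g"
    proof
      fix v assume v: "v \<in> cycles I F 0"
      then have "aug_map F v \<in> I" "aug_map F v - aug_map G (lin_map g v) \<in> I"
        using aug by (auto simp: cycles_def)
      from poly_ideal_diff[OF Ii this] have "aug_map G (lin_map g v) \<in> I" by simp
      then show "lin_map g v \<in> cycles I G 0" using free[OF gm] v by (simp add: cycles_def)
    qed
    then show "\<exists>g. P 0 g" using gm aug unfolding P_def by blast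
  next
    fix g i assume g: "P i g"
    have "\<exists>u. hom_vec G (Suc i) (shifts F (Suc i) ! q) u \<and>
        lin_map (differential G i) u = lin_map g (differential F i q)" if q: "q < rank_at F (Suc i)" for q
    proof (rule homogeneous_lift[OF G])
      show "lin_map g (differential F i q) \<in> cycles I G i"
        using g differential_cycle[OF F q] unfolding P_def by blast
      show "hom_vec G i (shifts F (Suc i) ! q) (lin_map g (differential F i q))"
        using g by (intro hom_vec_lin_map[OF differential_hom_vec[OF F q]]) (simp add: P_def graded_map_def)
    qed
    then obtain h where h: "\<And>q. q < rank_at F (Suc i) \<Longrightarrow> hom_vec G (Suc i) (shifts F (Suc i) ! q) (h q)"
      "\<And>q. q < rank_at F (Suc i) \<Longrightarrow> lin_map (differential G i) (h q) = lin_map g (differential F i q)"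
      by metis
    have gm: "graded_map F G (Suc i) (Suc i) h" using h by (simp add: graded_map_def)
    have Q: "Q i g h" unfolding Q_def using h(2) by (blast intro: lin_map_eqI)
    have "?cyc (Suc i) h"
      using Q free[OF gm] by (auto simp: cycles_def Q_def)
    then show "\<exists>h. P (Suc i) h \<and> Q i g h" using gm Q unfolding P_def by blast
  qed
  then obtain f where f: "\<And>i. P i (f i)" "\<And>i. Q i (f i) (f (Suc i))" by blast
  have "chain_map F G f" using f unfolding chain_map_def P_def Q_def by blast
  moreover have "?aug (f 0)" using f(1)[of 0] unfolding P_def by blast
  ultimately show ?thesis by blast
qed

text \<open>
  A chain map that induces zero on \<open>S/I\<close> is homotopic to zero by a homotopy of degree zero. The invariant
  of the recursion is that, on cycles, the differential of the part of the homotopy found last is \<open>f\<close>.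
\<close>
lemma null_homotopy_exists:
  fixes F G :: "('x, 'k::field) free_complex"
  assumes F: "graded_free_resolution I F" and G: "graded_free_resolution I G"
    and f: "chain_map F G f" and f0: "\<And>v. v \<in> free_module (rank_at F 0) \<Longrightarrow> aug_map G (lin_map (f 0) v) \<in> I"
  shows "\<exists>h. (\<forall>i. graded_map F G i (Suc i) (h i)) \<and>
     (\<forall>q<rank_at F 0. f 0 q = lin_map (differential G 0) (h 0 q)) \<and>
     (\<forall>i. \<forall>q<rank_at F (Suc i).
        f (Suc i) q = lin_map (differential G (Suc i)) (h (Suc i) q) + lin_map (h i) (differential F i q))"
proof -
  have fm: "hom_vec G i (shifts F i ! q) (f i q)" if "q < rank_at F i" for i q
    using f that by (simp add: chain_map_def graded_map_def)
  define P where "P i g \<longleftrightarrow> graded_map F G i (Suc i) g \<and>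
      (i = 0 \<longrightarrow> (\<forall>q<rank_at F 0. f 0 q = lin_map (differential G 0) (g q))) \<and>
      (\<forall>v\<in>cycles I F i. lin_map (differential G i) (lin_map g v) = lin_map (f i) v)"
    for i and g :: "nat \<Rightarrow> (nat \<Rightarrow>\<^sub>0 ('x, 'k) polynomial)"
  define Q where "Q i g h \<longleftrightarrow> (\<forall>q<rank_at F (Suc i).
      f (Suc i) q = lin_map (differential G (Suc i)) (h q) + lin_map g (differential F i q))"
    for i and g h :: "nat \<Rightarrow> (nat \<Rightarrow>\<^sub>0 ('x, 'k) polynomial)"
  have "\<exists>h. \<forall>i. P i (h i) \<and> Q i (h i) (h (Suc i))"
  proof (rule dependent_nat_choice)
    have "\<exists>u. hom_vec G (Suc 0) (shifts F 0 ! q) u \<and> lin_map (differential G 0) u = f 0 q"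
      if q: "q < rank_at F 0" for q
    proof (rule homogeneous_lift[OF G _ fm[OF q]])
      have "aug_map G (lin_map (f 0) (single q 1)) \<in> I"
        using q by (intro f0) (simp add: single_in_free_module)
      then show "f 0 q \<in> cycles I G 0" using fm[OF q] by (simp add: cycles_def hom_vec_def)
    qed
    then obtain g where g: "\<And>q. q < rank_at F 0 \<Longrightarrow> hom_vec G (Suc 0) (shifts F 0 ! q) (g q)"
      "\<And>q. q < rank_at F 0 \<Longrightarrow> lin_map (differential G 0) (g q) = f 0 q" by metis
    have "lin_map (differential G 0) (lin_map g v) = lin_map (f 0) v" if "v \<in> cycles I F 0" for v
      using that g(2) unfolding lin_map_compose
      by (intro lin_map_cong[of v "rank_at F 0"]) (simp_all add: cycles_def)
    then show "\<exists>g. P 0 g" using g unfolding P_def graded_map_def by (intro exI[of _ g]) auto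
  next
    fix g i assume g: "P i g"
    let ?r = "\<lambda>q. f (Suc i) q - lin_map g (differential F i q)"
    have "\<exists>u. hom_vec G (Suc (Suc i)) (shifts F (Suc i) ! q) u \<and> lin_map (differential G (Suc i)) u = ?r q"
      if q: "q < rank_at F (Suc i)" for q
    proof (rule homogeneous_lift[OF G])
      have "hom_vec G (Suc i) (shifts F (Suc i) ! q) (lin_map g (differential F i q))"
        using g by (intro hom_vec_lin_map[OF differential_hom_vec[OF F q]]) (simp add: P_def graded_map_def)
      then show hv: "hom_vec G (Suc i) (shifts F (Suc i) ! q) (?r q)"
        using fm[OF q] by (rule hom_vec_diff[rotated])
      have "lin_map (differential G i) (lin_map (f (Suc i)) (single q 1))
          = lin_map (f i) (lin_map (differential F i) (single q 1))"
        using f q single_in_free_module[OF q] unfolding chain_map_def by blast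
      moreover have "lin_map (differential G i) (lin_map g (differential F i q)) = lin_map (f i) (differential F i q)"
        using g differential_cycle[OF F q] unfolding P_def by blast
      ultimately have "lin_map (differential G i) (?r q) = 0" by (simp add: lin_map_diff)
      then show "?r q \<in> cycles I G (Suc i)" using hv by (simp add: cycles_def hom_vec_def)
    qed
    then obtain h where h: "\<And>q. q < rank_at F (Suc i) \<Longrightarrow> hom_vec G (Suc (Suc i)) (shifts F (Suc i) ! q) (h q)"
      "\<And>q. q < rank_at F (Suc i) \<Longrightarrow> lin_map (differential G (Suc i)) (h q) = ?r q" by metis
    have Q: "Q i g h" using h(2) unfolding Q_def by simp
    have "lin_map (differential G (Suc i)) (lin_map h v) = lin_map (f (Suc i)) v"
      if v: "v \<in> cycles I F (Suc i)" for v
    proof -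
      have vf: "v \<in> free_module (rank_at F (Suc i))" using v by (simp add: cycles_def)
      have "lin_map (differential G (Suc i)) (lin_map h v) = lin_map ?r v"
        unfolding lin_map_compose by (rule lin_map_cong[OF vf h(2)])
      also have "\<dots> = lin_map (f (Suc i)) v - lin_map g (lin_map (differential F i) v)"
        by (simp add: lin_map_diff_maps lin_map_compose)
      also have "\<dots> = lin_map (f (Suc i)) v" using v by (simp add: cycles_def)
      finally show ?thesis .
    qed
    then have "P (Suc i) h" using h(1) unfolding P_def graded_map_def by blast
    then show "\<exists>h. P (Suc i) h \<and> Q i g h" using Q by blast
  qed
  then obtain h where h: "\<And>i. P i (h i)" "\<And>i. Q i (h i) (h (Suc i))" by blast
  then show ?thesis unfolding P_def Q_def by blast
qed


section \<open>Betti numbers from a minimal resolution\<close>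

lemma chain_map_id_minus:
  assumes f: "chain_map F G f" and g: "chain_map G F g"
  shows "chain_map F F (\<lambda>i q. single q 1 - lin_map (g i) (f i q))"
proof -
  have eq: "lin_map (\<lambda>q. single q 1 - lin_map (g i) (f i q)) v = v - lin_map (g i) (lin_map (f i) v)"
    for i v by (simp add: lin_map_diff_maps lin_map_id lin_map_compose)
  have fm: "hom_vec G i (shifts F i ! q) (f i q)" if "q < rank_at F i" for i q
    using f that by (simp add: chain_map_def graded_map_def)
  have gm: "hom_vec F i (shifts G i ! q) (g i q)" if "q < rank_at G i" for i q
    using g that by (simp add: chain_map_def graded_map_def)
  have "graded_map F F i i (\<lambda>q. single q 1 - lin_map (g i) (f i q))" for i
    unfolding graded_map_def
    by (intro allI impI hom_vec_diff hom_vec_single hom_vec_lin_map[OF fm] gm)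
  moreover have "lin_map (differential F i) (v - lin_map (g (Suc i)) (lin_map (f (Suc i)) v))
      = lin_map (differential F i) v - lin_map (g i) (lin_map (f i) (lin_map (differential F i) v))"
    if v: "v \<in> free_module (rank_at F (Suc i))" for i v
  proof -
    have "lin_map (f (Suc i)) v \<in> free_module (rank_at G (Suc i))"
      using fm by (intro lin_map_in_free_module[OF v]) (simp add: hom_vec_def)
    then show ?thesis using f g v by (simp add: chain_map_def lin_map_diff)
  qed
  ultimately show ?thesis unfolding chain_map_def eq by blast
qed

lemma tensor_module_iff:
  "v \<in> tensor_module F i j \<longleftrightarrow> (\<forall>q. lookup v q \<noteq> 0 \<longrightarrow> q < rank_at F i \<and> shifts F i ! q = j)"
  by (auto simp: tensor_module_def in_keys_iff)

lemma tensor_module_free: "v \<in> tensor_module F i j \<Longrightarrow> v \<in> free_module (rank_at F i)"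
  by (simp add: tensor_module_iff free_module_iff)

lemma constants_hom_vec: "hom_vec F i j v \<Longrightarrow> constants v \<in> tensor_module F i j"
  unfolding tensor_module_iff lookup_constants
proof (intro allI impI)
  fix q assume v: "hom_vec F i j v" and q: "lookup (lookup v q) 0 \<noteq> 0"
  then have "lookup v q \<noteq> 0" by auto
  then have qr: "q < rank_at F i" using v by (auto simp: hom_vec_def free_module_iff)
  then have "homogeneous (j - shifts F i ! q) (lookup v q)" using v by (simp add: hom_vec_def)
  then have "int (monomial_degree (0 :: 'a monomial)) = j - shifts F i ! q"
    using q unfolding homogeneous_def by (simp add: in_keys_iff del: monomial_degree_0)
  then show "q < rank_at F i \<and> shifts F i ! q = j" using qr by simp
qed

lemma subspace_tensor_module: "sv.subspace (tensor_module F i j)"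
  unfolding sv.subspace_def
proof (intro conjI ballI allI)
  fix x y assume "x \<in> tensor_module F i j" "y \<in> tensor_module F i j"
  then show "x + y \<in> tensor_module F i j"
    by (auto simp: tensor_module_iff Poly_Mapping.lookup_add) (metis add.right_neutral)+
qed (auto simp: tensor_module_iff lookup_scale_vec)

lemma tensored_graded_map:
  assumes "graded_map F G i i' g" "v \<in> tensor_module F i j"
  shows "lin_map (\<lambda>q. constants (g q)) v \<in> tensor_module G i' j"
  unfolding lin_map_def
proof (intro sv.subspace_sum sv.subspace_scale subspace_tensor_module)
  fix q assume "q \<in> keys v"
  then have "q < rank_at F i" "shifts F i ! q = j" using assms(2) by (auto simp: tensor_module_def)
  then show "constants (g q) \<in> tensor_module G i' j"
    using assms(1) constants_hom_vec[of G i' j "g q"] by (auto simp: graded_map_def)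
qed

lemma tensor_module_eq_span:
  fixes F :: "('x, 'k::field) free_complex"
  shows "tensor_module F i j =
    sv.span ((\<lambda>q. single q 1) ` {q. q < rank_at F i \<and> shifts F i ! q = j})"
proof
  let ?Q = "{q. q < rank_at F i \<and> shifts F i ! q = j}"
  show "tensor_module F i j \<subseteq> sv.span ((\<lambda>q. single q 1) ` ?Q)"
  proof
    fix v assume v: "v \<in> tensor_module F i j"
    have "lin_map (\<lambda>q. single q 1) v \<in> sv.span ((\<lambda>q. single q 1) ` ?Q)"
      unfolding lin_map_def using v
      by (intro sv.span_sum sv.span_scale sv.span_base) (auto simp: tensor_module_def)
    then show "v \<in> sv.span ((\<lambda>q. single q 1) ` ?Q)" by (simp add: lin_map_id)
  qed
  show "sv.span ((\<lambda>q. single q 1) ` ?Q) \<subseteq> tensor_module F i j"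
    by (rule sv.span_minimal[OF _ subspace_tensor_module])
       (auto simp: tensor_module_iff lookup_single when_def)
qed

lemma tensor_diff_square:
  assumes G: "graded_free_resolution I G" and v: "v \<in> tensor_module G (Suc (Suc i)) j"
  shows "tensor_diff G i (tensor_diff G (Suc i) v) = 0"
proof -
  have "tensor_diff G i (tensor_diff G (Suc i) v)
      = lin_map (\<lambda>q. constants (lin_map (differential G i) (differential G (Suc i) q))) v"
    by (simp add: tensor_diff_constants lin_map_compose constants_lin_map)
  also have "\<dots> = lin_map (\<lambda>q. 0) v"
  proof (rule lin_map_cong[OF tensor_module_free[OF v]])
    fix q assume "q < rank_at G (Suc (Suc i))"
    then have "lin_map (differential G i) (differential G (Suc i) q) = 0"
      using differential_cycle[OF G, of q "Suc i"] by (simp add: cycles_def)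
    then show "constants (lin_map (differential G i) (differential G (Suc i) q)) = 0" by simp
  qed
  also have "\<dots> = 0" by (rule poly_mapping_eqI) (simp add: lin_map_def lookup_sum lookup_scale_vec)
  finally show ?thesis .
qed

lemma tensored_chain_map:
  assumes f: "chain_map F G f" and v: "v \<in> tensor_module F (Suc i) j"
  shows "tensor_diff G i (lin_map (\<lambda>q. constants (f (Suc i) q)) v)
       = lin_map (\<lambda>q. constants (f i q)) (tensor_diff F i v)"
  unfolding tensor_diff_constants
proof (rule lin_map_eqI[OF tensor_module_free[OF v]])
  fix q assume q: "q < rank_at F (Suc i)"
  have "lin_map (differential G i) (lin_map (f (Suc i)) (single q 1))
      = lin_map (f i) (lin_map (differential F i) (single q 1))"
    using f single_in_free_module[OF q] unfolding chain_map_def by blast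
  then have "lin_map (differential G i) (f (Suc i) q) = lin_map (f i) (differential F i q)" by simp
  then show "lin_map (\<lambda>q. constants (differential G i q)) (constants (f (Suc i) q))
      = lin_map (\<lambda>q. constants (f i q)) (constants (differential F i q))"
    by (metis constants_lin_map)
qed

text \<open>
  The composition of \<open>f\<close> and \<open>g\<close> and the identity lift the same map, so their difference is homotopic to
  zero. Only the image of this relation in \<open>F \<otimes> k\<close> matters below, in a fixed degree \<open>j\<close>.
\<close>
lemma tensored_homotopy:
  fixes F :: "('x, 'k::field) free_complex"
  assumes F: "graded_free_resolution I F" and G: "graded_free_resolution I G"
    and f: "chain_map F G f" and g: "chain_map G F g"
    and fI: "\<forall>v\<in>free_module (rank_at F 0). aug_map F v - aug_map G (lin_map (f 0) v) \<in> I"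
    and gI: "\<forall>v\<in>free_module (rank_at G 0). aug_map G v - aug_map F (lin_map (g 0) v) \<in> I"
    and I: "poly_ideal I" and v: "v \<in> tensor_module F i j"
  defines "r \<equiv> v - lin_map (\<lambda>q. constants (g i q)) (lin_map (\<lambda>q. constants (f i q)) v)"
  shows "\<exists>w h. w \<in> tensor_module F (Suc i) j \<and>
           r = tensor_diff F i w + (case i of 0 \<Rightarrow> 0 | Suc l \<Rightarrow> lin_map h (tensor_diff F l v))"
proof -
  let ?f = "\<lambda>i q. single q 1 - lin_map (g i) (f i q)"
  have eq: "lin_map (?f i) v = v - lin_map (g i) (lin_map (f i) v)" for i v
    by (simp add: lin_map_diff_maps lin_map_id lin_map_compose)
  have "aug_map F (lin_map (?f 0) v) \<in> I" if v: "v \<in> free_module (rank_at F 0)" for v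
  proof -
    have "lin_map (f 0) v \<in> free_module (rank_at G 0)"
      using f by (intro lin_map_in_free_module[OF v]) (simp add: chain_map_def graded_map_def hom_vec_def)
    with gI fI v have 1: "aug_map F v - aug_map G (lin_map (f 0) v) \<in> I"
      "aug_map G (lin_map (f 0) v) - aug_map F (lin_map (g 0) (lin_map (f 0) v)) \<in> I" by blast+
    have "(aug_map F v - aug_map G (lin_map (f 0) v))
        + (aug_map G (lin_map (f 0) v) - aug_map F (lin_map (g 0) (lin_map (f 0) v))) \<in> I"
      using I 1 unfolding poly_ideal_def by blast
    then show ?thesis by (simp add: lin_map_diff_maps lin_map_id lin_map_compose aug_map_diff)
  qed
  then have "\<exists>h. (\<forall>i. graded_map F F i (Suc i) (h i)) \<and>
     (\<forall>q<rank_at F 0. ?f 0 q = lin_map (differential F 0) (h 0 q)) \<and>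
     (\<forall>i. \<forall>q<rank_at F (Suc i).
        ?f (Suc i) q = lin_map (differential F (Suc i)) (h (Suc i) q) + lin_map (h i) (differential F i q))"
    by (rule null_homotopy_exists[OF F F chain_map_id_minus[OF f g]])
  then obtain h where h: "\<And>i. graded_map F F i (Suc i) (h i)"
    "\<And>q. q < rank_at F 0 \<Longrightarrow> ?f 0 q = lin_map (differential F 0) (h 0 q)"
    "\<And>i q. q < rank_at F (Suc i) \<Longrightarrow>
        ?f (Suc i) q = lin_map (differential F (Suc i)) (h (Suc i) q) + lin_map (h i) (differential F i q)"
    by blast
  let ?h = "\<lambda>i q. constants (h i q)"
  have vf: "v \<in> free_module (rank_at F i)" by (rule tensor_module_free[OF v])
  have r: "r = lin_map (\<lambda>q. constants (?f i q)) v"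
    by (simp add: r_def constants_diff constants_single_one lin_map_diff_maps lin_map_id
        constants_lin_map lin_map_compose)
  have add: "constants (x + y) = constants x + constants y" for x y :: "nat \<Rightarrow>\<^sub>0 ('x, 'k) polynomial"
    by (rule poly_mapping_eqI) (simp add: Poly_Mapping.lookup_add)
  have addm: "lin_map (\<lambda>q. x q + y q) v = lin_map x v + lin_map y v" for x y :: "nat \<Rightarrow> nat \<Rightarrow>\<^sub>0 'k"
    using lin_map_diff_maps[of "\<lambda>q. x q + y q" y v] by simp
  have "r = tensor_diff F i (lin_map (?h i) v) + (case i of 0 \<Rightarrow> 0 | Suc l \<Rightarrow> lin_map (?h (i - 1)) (tensor_diff F l v))"
  proof (cases i)
    case 0
    have "r = lin_map (\<lambda>q. lin_map (\<lambda>q. constants (differential F 0 q)) (?h 0 q)) v"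
      unfolding r using 0 h(2) by (intro lin_map_cong[OF vf]) (simp add: constants_lin_map)
    then show ?thesis using 0 by (simp add: tensor_diff_constants lin_map_compose)
  next
    case (Suc l)
    have "r = lin_map (\<lambda>q. lin_map (\<lambda>q. constants (differential F i q)) (?h i q)
        + lin_map (?h l) (constants (differential F l q))) v"
      unfolding r using Suc h(3) by (intro lin_map_cong[OF vf]) (simp add: constants_lin_map add)
    then show ?thesis using Suc by (simp add: tensor_diff_constants lin_map_compose addm)
  qed
  moreover have "lin_map (?h i) v \<in> tensor_module F (Suc i) j"
    by (rule tensored_graded_map[OF h(1) v])
  ultimately show ?thesis
    by (intro exI[of _ "lin_map (?h i) v"] exI[of _ "?h (i - 1)"] conjI)
qed

text \<open>
  The differentials of \<open>F \<otimes> k\<close> vanish. Therefore the lifts \<open>f\<close> and \<open>g\<close> of the identity in both directions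
  satisfy: after tensoring, \<open>g\<close> is a left inverse of \<open>f\<close> and kills all boundaries of \<open>G \<otimes> k\<close>, while
  each cycle \<open>z\<close> differs from \<open>f (g z)\<close> by a boundary. So the cycles of \<open>G \<otimes> k\<close> are the direct sum of the
  boundaries and an isomorphic image of \<open>F \<otimes> k\<close>.
\<close>
theorem minimal_resolution_betti:
  fixes F G :: "('x, 'k::field) free_complex"
  assumes I: "graded_ideal I" and F: "graded_free_resolution I F" and G: "graded_free_resolution I G"
    and min: "\<And>i q. q < rank_at F (Suc i) \<Longrightarrow> constants (differential F i q) = 0"
  shows "tensor_homology_dim G i j = card {q. q < rank_at F i \<and> shifts F i ! q = j}"
proof -
  have Ii: "poly_ideal I" using I by (simp add: graded_ideal_def)
  let ?Q = "{q. q < rank_at F i \<and> shifts F i ! q = j}"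
  obtain f where f: "chain_map F G f"
    and fI: "\<forall>v\<in>free_module (rank_at F 0). aug_map F v - aug_map G (lin_map (f 0) v) \<in> I"
    using chain_map_exists[OF I F G] by blast
  obtain g where g: "chain_map G F g"
    and gI: "\<forall>v\<in>free_module (rank_at G 0). aug_map G v - aug_map F (lin_map (g 0) v) \<in> I"
    using chain_map_exists[OF I G F] by blast
  define f' where "f' i = lin_map (\<lambda>q. constants (f i q))" for i
  define g' where "g' i = lin_map (\<lambda>q. constants (g i q))" for i
  let ?Z = "tensor_cycles G i j" and ?B = "tensor_boundaries G i j"
  have f'M: "f' i v \<in> tensor_module G i j" if "v \<in> tensor_module F i j" for i v
    unfolding f'_def using f that tensored_graded_map[of F G i i "f i" v j] by (simp add: chain_map_def)
  have g'M: "g' i v \<in> tensor_module F i j" if "v \<in> tensor_module G i j" for i v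
    unfolding g'_def using g that tensored_graded_map[of G F i i "g i" v j] by (simp add: chain_map_def)
  have F0: "tensor_diff F h v = 0" if "v \<in> tensor_module F (Suc h) j" for h v
  proof -
    have "tensor_diff F h v = lin_map (\<lambda>q. 0) v"
      unfolding tensor_diff_constants using min by (intro lin_map_cong[OF tensor_module_free[OF that]])
    also have "\<dots> = 0" by (rule poly_mapping_eqI) (simp add: lin_map_def lookup_sum lookup_scale_vec)
    finally show ?thesis .
  qed
  have gf: "g' i (f' i v) = v" if v: "v \<in> tensor_module F i j" for v
  proof -
    obtain w h where wh: "w \<in> tensor_module F (Suc i) j"
      "v - g' i (f' i v) = tensor_diff F i w + (case i of 0 \<Rightarrow> 0 | Suc l \<Rightarrow> lin_map h (tensor_diff F l v))"
      using tensored_homotopy[OF F G f g fI gI Ii v, folded f'_def g'_def] by (elim exE conjE) (rule that)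
    then have "v - g' i (f' i v) = 0" using F0 v by (cases i) auto
    then show ?thesis by simp
  qed
  have fg: "v - f' i (g' i v) \<in> ?B" if v: "v \<in> ?Z" for v
  proof -
    have vM: "v \<in> tensor_module G i j" using v by (simp add: tensor_cycles_def)
    obtain w h where wh: "w \<in> tensor_module G (Suc i) j"
      "v - f' i (g' i v) = tensor_diff G i w + (case i of 0 \<Rightarrow> 0 | Suc l \<Rightarrow> lin_map h (tensor_diff G l v))"
      using tensored_homotopy[OF G F g f gI fI Ii vM, folded f'_def g'_def] by (elim exE conjE) (rule that)
    then have "v - f' i (g' i v) = tensor_diff G i w"
      using v by (cases i) (auto simp: tensor_cycles_def)
    then show ?thesis using wh(1) unfolding tensor_boundaries_def by blast
  qed
  have gB: "g' i b = 0" if b: "b \<in> ?B" for b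
  proof -
    obtain w where w: "w \<in> tensor_module G (Suc i) j" "b = tensor_diff G i w"
      using b by (auto simp: tensor_boundaries_def)
    then have "g' i b = tensor_diff F i (g' (Suc i) w)"
      using tensored_chain_map[OF g w(1)] by (simp add: g'_def)
    then show ?thesis using F0 g'M w(1) by simp
  qed
  have fZ: "f' i v \<in> ?Z" if v: "v \<in> tensor_module F i j" for v
  proof (cases i)
    case 0 then show ?thesis using f'M[OF v] by (simp add: tensor_cycles_def)
  next
    case (Suc h)
    then have "tensor_diff G h (f' i v) = f' h (tensor_diff F h v)"
      using tensored_chain_map[OF f] v by (simp add: f'_def)
    then show ?thesis using f'M[OF v] F0 v Suc by (simp add: tensor_cycles_def f'_def)
  qed
  have BZ: "?B \<subseteq> ?Z"
  proof
    fix b assume "b \<in> ?B"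
    then obtain w where w: "w \<in> tensor_module G (Suc i) j" "b = tensor_diff G i w"
      by (auto simp: tensor_boundaries_def)
    have "graded_map G G (Suc i) i (differential G i)"
      using differential_hom_vec[OF G] by (simp add: graded_map_def)
    from tensored_graded_map[OF this w(1)] have "b \<in> tensor_module G i j"
      using w(2) by (simp add: tensor_diff_constants)
    then show "b \<in> ?Z" using tensor_diff_square[OF G] w by (cases i) (auto simp: tensor_cycles_def)
  qed
  obtain C where C: "C \<subseteq> ?B" "sv.independent C" "?B \<subseteq> sv.span C"
    using kv.maximal_independent_subset by blast
  have CS: "C \<subseteq> sv.span ((\<lambda>q. single q 1) ` {q. q < rank_at G i \<and> shifts G i ! q = j})"
    unfolding tensor_module_eq_span[symmetric] using C(1) BZ by (auto simp: tensor_cycles_def)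
  have finC: "finite C" using kv.independent_span_bound[OF _ C(2) CS] by simp
  let ?e = "\<lambda>q. f' i (single q 1)"
  have eM: "single q 1 \<in> tensor_module F i j" if "q \<in> ?Q" for q
    using that by (auto simp: tensor_module_iff lookup_single when_def)
  have gfe: "g' i (?e q) = single q 1" if "q \<in> ?Q" for q
    by (rule gf[OF eM[OF that]])
  \<comment> \<open>The left inverse \<open>g'\<close> kills the boundaries and separates the images of the basis vectors.\<close>
  have ind: "sv.independent (C \<union> ?e ` A) \<and> card (C \<union> ?e ` A) = card C + card A"
    if "finite A" "A \<subseteq> ?Q" for A
    using that
  proof (induction A rule: finite_induct)
    case empty then show ?case using C by simp
  next
    case (insert q A)
    have keys: "keys (g' i x) \<subseteq> A" if "x \<in> sv.span (C \<union> ?e ` A)" for x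
      using that
    proof (induction rule: sv.span_induct_alt)
      case base then show ?case by (simp add: g'_def)
    next
      case (step c x y)
      have "keys (g' i x) \<subseteq> A"
      proof (cases "x \<in> C")
        case True
        then have "x \<in> ?B" using C(1) by blast
        then show ?thesis using gB[of x] by simp
      next
        case False
        then obtain p where "p \<in> A" "x = ?e p" using step(1) by blast
        moreover from this have "p \<in> ?Q" using insert.prems by blast
        ultimately show ?thesis using gfe[of p] by simp
      qed
      then have x0: "lookup (g' i x) p = 0" if "p \<notin> A" for p using that by (auto simp: in_keys_iff)
      have y0: "lookup (g' i y) p = 0" if "p \<notin> A" for p using that step(2) by (auto simp: in_keys_iff)
      have "lookup (g' i (scale_vec c x + y)) p = c * lookup (g' i x) p + lookup (g' i y) p" for p
        by (simp add: g'_def lin_map_add lin_map_scale Poly_Mapping.lookup_add lookup_scale_vec)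
      then have "lookup (g' i (scale_vec c x + y)) p = 0" if "p \<notin> A" for p
        using x0[OF that] y0[OF that] by simp
      then show ?case by (auto simp: in_keys_iff)
    qed
    have nin: "?e q \<notin> sv.span (C \<union> ?e ` A)"
    proof
      assume "?e q \<in> sv.span (C \<union> ?e ` A)"
      from keys[OF this] have "keys (single q (1::'k)) \<subseteq> A"
        using gfe[of q] insert.prems by simp
      then show False using insert.hyps by simp
    qed
    then have nin': "?e q \<notin> C \<union> ?e ` A" using sv.span_base[of "?e q" "C \<union> ?e ` A"] by blast
    have IH: "sv.independent (C \<union> ?e ` A)" "card (C \<union> ?e ` A) = card C + card A"
      using insert.IH insert.prems by auto
    have eq: "C \<union> ?e ` insert q A = insert (?e q) (C \<union> ?e ` A)" by simp
    have "card (insert (?e q) (C \<union> ?e ` A)) = Suc (card C + card A)"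
      using nin' finC insert.hyps(1) IH(2) by (subst card_insert_disjoint) auto
    then show ?case
      unfolding eq using kv.independent_insertI[OF nin IH(1)] insert.hyps by simp
  qed
  have ind': "sv.independent (C \<union> ?e ` ?Q)" "card (C \<union> ?e ` ?Q) = card C + card ?Q"
    using ind[of ?Q] by auto
  have "?Z \<subseteq> sv.span (C \<union> ?e ` ?Q)"
  proof
    fix v assume v: "v \<in> ?Z"
    have "g' i v \<in> tensor_module F i j" using v g'M by (simp add: tensor_cycles_def)
    then have "f' i (lin_map (\<lambda>q. single q 1) (g' i v)) \<in> sv.span (?e ` ?Q)"
      unfolding lin_map_def[of "\<lambda>q. single q 1"] f'_def lin_map_sum lin_map_scale
      by (intro sv.span_sum sv.span_scale sv.span_base) (auto simp: tensor_module_def)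
    then have "f' i (g' i v) \<in> sv.span (C \<union> ?e ` ?Q)"
      using sv.span_mono[of "?e ` ?Q" "C \<union> ?e ` ?Q"] by (auto simp: lin_map_id)
    moreover have "v - f' i (g' i v) \<in> sv.span (C \<union> ?e ` ?Q)"
      using fg[OF v] C(3) sv.span_mono[of C "C \<union> ?e ` ?Q"] by blast
    ultimately have "f' i (g' i v) + (v - f' i (g' i v)) \<in> sv.span (C \<union> ?e ` ?Q)"
      by (rule sv.span_add)
    then show "v \<in> sv.span (C \<union> ?e ` ?Q)" by simp
  qed
  moreover have "C \<union> ?e ` ?Q \<subseteq> ?Z" using C(1) BZ fZ eM by auto
  ultimately have "kv.dim ?Z = card C + card ?Q"
    using kv.basis_card_eq_dim[of "C \<union> ?e ` ?Q" ?Z] ind' by simp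
  moreover have "kv.dim ?B = card C" using kv.basis_card_eq_dim[OF C(1,3,2)] by simp
  ultimately show ?thesis by (simp add: tensor_homology_dim_def)
qed


section \<open>Deformations of a frame\<close>

lemma finite_monomials_of_degree: "finite {t :: 'x::finite monomial. monomial_degree t = d}"
proof (rule finite_imageD)
  let ?M = "{t :: 'x monomial. monomial_degree t = d}"
  have le: "lookup t x \<le> monomial_degree t" for t :: "'x monomial" and x
    using member_le_sum[of x UNIV "lookup t"] monomial_degree_sum[of UNIV t] by simp
  have "lookup ` ?M \<subseteq> (\<Pi>\<^sub>E x\<in>UNIV. {..d})"
  proof (rule image_subsetI)
    fix t :: "'x monomial" assume "t \<in> ?M"
    then have "lookup t x \<le> d" for x using le[of t x] by simp
    then show "lookup t \<in> (\<Pi>\<^sub>E x\<in>UNIV. {..d})" by (simp add: PiE_iff)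
  qed
  moreover have "finite (\<Pi>\<^sub>E x\<in>(UNIV :: 'x set). {..d})"
    by (rule finite_PiE) simp_all
  ultimately show "finite (lookup ` ?M)" by (rule finite_subset)
  show "inj_on lookup ?M" by (rule inj_onI) simp
qed

text \<open>
  A term order together with a grading \<open>\<kappa>\<close> that refines the total degree. Comparisons will take place
  within the classes of \<open>\<kappa>\<close>. This keeps track of homogeneity for \<open>\<kappa>\<close>, and since these classes are
  finite, descending arguments are inductions on finite sets of monomials.
\<close>
locale graded_term_order =
  fixes leq :: "'x::finite monomial \<Rightarrow> 'x monomial \<Rightarrow> bool"
    and \<kappa> :: "'x monomial \<Rightarrow> 'g"
  assumes order: "term_order leq"
    and fine_add: "\<kappa> s = \<kappa> t \<Longrightarrow> \<kappa> (s + u) = \<kappa> (t + u)"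
    and fine_degree: "\<kappa> s = \<kappa> t \<Longrightarrow> monomial_degree s = monomial_degree t"
begin

lemma linorder_leq: "class.linorder leq (\<lambda>s t. leq s t \<and> \<not> leq t s)"
  using order by (simp add: term_order_def)

lemma leq_refl [simp]: "leq t t"
proof -
  interpret lo: linorder leq "\<lambda>s t. leq s t \<and> \<not> leq t s" by (rule linorder_leq)
  show ?thesis by (rule lo.order_refl)
qed

lemma leq_trans: "leq s t \<Longrightarrow> leq t u \<Longrightarrow> leq s u"
proof -
  interpret lo: linorder leq "\<lambda>s t. leq s t \<and> \<not> leq t s" by (rule linorder_leq)
  show "leq s t \<Longrightarrow> leq t u \<Longrightarrow> leq s u" by (rule lo.order_trans)
qed

lemma leq_antisym: "leq s t \<Longrightarrow> leq t s \<Longrightarrow> s = t"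
proof -
  interpret lo: linorder leq "\<lambda>s t. leq s t \<and> \<not> leq t s" by (rule linorder_leq)
  show "leq s t \<Longrightarrow> leq t s \<Longrightarrow> s = t" by (rule lo.order_antisym)
qed

lemma leq_total: "leq s t \<or> leq t s"
proof -
  interpret lo: linorder leq "\<lambda>s t. leq s t \<and> \<not> leq t s" by (rule linorder_leq)
  show ?thesis by (rule lo.linear)
qed

lemma leq_add: "leq s t \<Longrightarrow> leq (s + u) (t + u)"
  using order by (simp add: term_order_def)

lemma leq_add_left: "leq s t \<Longrightarrow> leq (u + s) (u + t)"
  using leq_add[of s t u] by (simp only: add.commute[of u])

definition below :: "'x monomial \<Rightarrow> 'x monomial \<Rightarrow> bool" where
  "below s t \<longleftrightarrow> leq s t \<and> \<kappa> s = \<kappa> t"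

lemma below_refl [simp]: "below t t" by (simp add: below_def)

lemma below_trans: "below s t \<Longrightarrow> below t u \<Longrightarrow> below s u"
  unfolding below_def by (blast intro: leq_trans trans)

lemma below_add: "below s t \<Longrightarrow> below (s + u) (t + u)"
  unfolding below_def by (blast intro: leq_add fine_add)

lemma below_add_left: "below s t \<Longrightarrow> below (u + s) (u + t)"
  using below_add[of s t u] by (simp only: add.commute[of u])

lemma below_antisym: "below s t \<Longrightarrow> below t s \<Longrightarrow> s = t"
  unfolding below_def by (blast intro: leq_antisym)

definition down :: "'x monomial set \<Rightarrow> 'x monomial set" where
  "down W = {s. \<exists>t\<in>W. below s t}"

lemma finite_down: assumes "finite W" shows "finite (down W)"
proof -
  have "down W \<subseteq> (\<Union>t\<in>W. {s. monomial_degree s = monomial_degree t})"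
    unfolding down_def below_def using fine_degree by blast
  then show ?thesis
    by (rule finite_subset) (use assms finite_monomials_of_degree in auto)
qed

lemma down_mono: "V \<subseteq> down W \<Longrightarrow> down V \<subseteq> down W"
  unfolding down_def using below_trans by blast

lemma subset_down: "W \<subseteq> down W"
  unfolding down_def using below_refl by blast

lemma exists_max: assumes "finite W" "W \<noteq> {}" shows "\<exists>t\<in>W. \<forall>s\<in>W. leq s t"
  using assms
proof (induction W rule: finite_ne_induct)
  case (singleton x) then show ?case by simp
next
  case (insert x W)
  then obtain t where t: "t \<in> W" "\<forall>s\<in>W. leq s t" by blast
  show ?case
  proof (cases "leq x t")
    case True
    then show ?thesis using t by blast
  next
    case False
    then have "leq t x" using leq_total[of x t] by blast
    then have "\<forall>s\<in>W. leq s x" using t(2) leq_trans by blast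
    then show ?thesis by simp
  qed
qed

text \<open>
  The multidegrees of the terms of a vector when each basis vector has its label as degree.
\<close>
definition weights :: "('x, 'k::field) frame \<Rightarrow> nat \<Rightarrow> (nat \<Rightarrow>\<^sub>0 ('x, 'k) polynomial) \<Rightarrow> 'x monomial set" where
  "weights A i v = (\<Union>p\<in>keys v. (\<lambda>u. u + lbl A i p) ` keys (lookup v p))"

lemma weights_iff: "t \<in> weights A i v \<longleftrightarrow> (\<exists>p u. lookup (lookup v p) u \<noteq> 0 \<and> t = u + lbl A i p)"
proof
  assume "t \<in> weights A i v"
  then show "\<exists>p u. lookup (lookup v p) u \<noteq> 0 \<and> t = u + lbl A i p"
    unfolding weights_def by (auto simp: in_keys_iff)
next
  assume "\<exists>p u. lookup (lookup v p) u \<noteq> 0 \<and> t = u + lbl A i p"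
  then obtain p u where pu: "lookup (lookup v p) u \<noteq> 0" "t = u + lbl A i p" by blast
  then have "p \<in> keys v" "u \<in> keys (lookup v p)" by (auto simp: in_keys_iff)
  then show "t \<in> weights A i v" unfolding weights_def using pu(2) by blast
qed

lemma finite_weights: "finite (weights A i v)"
  by (simp add: weights_def)

lemma weights_empty: "weights A i v = {} \<Longrightarrow> v = 0"
proof (intro poly_mapping_eqI)
  fix p u assume e: "weights A i v = {}"
  have "u + lbl A i p \<notin> weights A i v" using e by simp
  then show "lookup (lookup v p) u = lookup (lookup 0 p) u" unfolding weights_iff by auto
qed

lemma weights_add: "weights A i (v + w) \<subseteq> weights A i v \<union> weights A i w"
proof
  fix s assume "s \<in> weights A i (v + w)"
  then obtain p u where "lookup (lookup (v + w) p) u \<noteq> 0" and s: "s = u + lbl A i p" unfolding weights_iff by blast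
  then have "lookup (lookup v p) u \<noteq> 0 \<or> lookup (lookup w p) u \<noteq> 0" by (auto simp: Poly_Mapping.lookup_add)
  then show "s \<in> weights A i v \<union> weights A i w" using s unfolding weights_iff Un_iff by blast
qed

lemma weights_diff: "weights A i (v - w) \<subseteq> weights A i v \<union> weights A i w"
proof
  fix s assume "s \<in> weights A i (v - w)"
  then obtain p u where "lookup (lookup (v - w) p) u \<noteq> 0" and s: "s = u + lbl A i p" unfolding weights_iff by blast
  then have "lookup (lookup v p) u \<noteq> 0 \<or> lookup (lookup w p) u \<noteq> 0" by (auto simp: lookup_minus)
  then show "s \<in> weights A i v \<union> weights A i w" using s unfolding weights_iff Un_iff by blast
qed

definition weight_part ::
    "('x, 'k::field) frame \<Rightarrow> nat \<Rightarrow> 'x monomial \<Rightarrow> (nat \<Rightarrow>\<^sub>0 ('x, 'k) polynomial) \<Rightarrow> nat \<Rightarrow> 'k" where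
  "weight_part A i t v = (\<lambda>p. if lbl A i p \<preceq> t then lookup (lookup v p) (t - lbl A i p) else 0)"

lemma weight_part_nonzero: "weight_part A i t v p \<noteq> 0 \<Longrightarrow> t \<in> weights A i v"
proof -
  assume "weight_part A i t v p \<noteq> 0"
  then have 1: "lbl A i p \<preceq> t" "lookup (lookup v p) (t - lbl A i p) \<noteq> 0"
    by (simp_all add: weight_part_def split: if_splits)
  from mono_dvd_diff_plus[OF 1(1)] have "t = (t - lbl A i p) + lbl A i p" by (rule sym)
  then show ?thesis using 1(2) unfolding weights_iff by blast
qed

lemma weight_part_add: "weight_part A i (u + lbl A i p) v p = lookup (lookup v p) u"
  by (simp add: weight_part_def)

lemma weight_part_eq_0: "weight_part A i t v = (\<lambda>_. 0) \<Longrightarrow> t \<notin> weights A i v"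
proof
  assume z: "weight_part A i t v = (\<lambda>_. 0)" and "t \<in> weights A i v"
  then obtain p u where "lookup (lookup v p) u \<noteq> 0" "t = u + lbl A i p" unfolding weights_iff by blast
  then show False using weight_part_add[of A i u p v] z by simp
qed

lemma weight_part_diff: "weight_part A i t (v - w) = (\<lambda>p. weight_part A i t v p - weight_part A i t w p)"
  by (auto simp: weight_part_def lookup_minus)

lemma chain_at_weight_part: "v \<in> free_module (rnk A i) \<Longrightarrow> chain_at A i t (weight_part A i t v)"
  unfolding chain_at_def
proof (intro allI impI)
  fix q assume v: "v \<in> free_module (rnk A i)" and "weight_part A i t v q \<noteq> 0"
  then have 1: "lbl A i q \<preceq> t" "lookup (lookup v q) (t - lbl A i q) \<noteq> 0"
    by (simp_all add: weight_part_def split: if_splits)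
  then have "lookup v q \<noteq> 0" by (intro notI) simp
  then show "q < rnk A i \<and> lbl A i q \<preceq> t" using v 1(1) unfolding free_module_iff by blast
qed

text \<open>
  The chain \<open>x\<close> of multidegree \<open>t\<close>, as a vector of polynomials.
\<close>
definition single_weight ::
    "('x, 'k::field) frame \<Rightarrow> nat \<Rightarrow> 'x monomial \<Rightarrow> (nat \<Rightarrow> 'k) \<Rightarrow> (nat \<Rightarrow>\<^sub>0 ('x, 'k) polynomial)" where
  "single_weight A i t x = (\<Sum>p<rnk A i. single p (single (t - lbl A i p) (x p)))"

lemma lookup_single_weight:
  "lookup (single_weight A i t x) p = (if p < rnk A i then single (t - lbl A i p) (x p) else 0)"
proof -
  have "lookup (single_weight A i t x) p
      = (\<Sum>q<rnk A i. if q = p then single (t - lbl A i p) (x p) else 0)"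
    unfolding single_weight_def lookup_sum by (rule sum.cong) (auto simp: lookup_single when_def)
  then show ?thesis by simp
qed

lemma single_weight_free: "single_weight A i t x \<in> free_module (rnk A i)"
  by (auto simp: free_module_iff lookup_single_weight split: if_splits)

lemma weights_single_weight: assumes "chain_at A i t x" shows "weights A i (single_weight A i t x) \<subseteq> {t}"
proof
  fix s assume "s \<in> weights A i (single_weight A i t x)"
  then obtain p u where pu: "lookup (lookup (single_weight A i t x) p) u \<noteq> 0" "s = u + lbl A i p"
    unfolding weights_iff by blast
  then have "x p \<noteq> 0" "u = t - lbl A i p"
    by (auto simp: lookup_single_weight lookup_single when_def split: if_splits)
  then show "s \<in> {t}" using assms pu(2) by (simp add: chain_at_def mono_dvd_diff_plus)
qed

lemma weight_part_single_weight:
  assumes "chain_at A i t x" shows "weight_part A i t (single_weight A i t x) = x"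
proof
  fix p
  show "weight_part A i t (single_weight A i t x) p = x p"
    using assms by (auto simp: weight_part_def lookup_single_weight chain_at_def)
qed

text \<open>
  The map \<open>D\<close> agrees with the differential of the frame in the top weight, which is the multidegree of
  the basis vector; all its other terms have smaller weight and the same \<open>\<kappa>\<close>-degree.
\<close>
definition deforms :: "('x, 'k::field) frame \<Rightarrow> nat \<Rightarrow> (nat \<Rightarrow> (nat \<Rightarrow>\<^sub>0 ('x, 'k) polynomial)) \<Rightarrow> bool" where
  "deforms A i D \<longleftrightarrow> (\<forall>q<rnk A (Suc i). D q \<in> free_module (rnk A i) \<and>
      weight_part A i (lbl A (Suc i) q) (D q) = cff A i q \<and>
      (\<forall>s\<in>weights A i (D q). below s (lbl A (Suc i) q)))"

lemma deforms_weights: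
  assumes D: "deforms A i D" and v: "v \<in> free_module (rnk A (Suc i))"
  shows "weights A i (lin_map D v) \<subseteq> down (weights A (Suc i) v)"
proof
  fix s assume "s \<in> weights A i (lin_map D v)"
  then obtain p a where pa: "lookup (lookup (lin_map D v) p) a \<noteq> 0" "s = a + lbl A i p"
    unfolding weights_iff by blast
  from pa(1) have "(\<Sum>q<rnk A (Suc i). lookup (lookup v q * lookup (D q) p) a) \<noteq> 0"
    by (simp add: lookup_lin_map_free[OF v] lookup_sum)
  then obtain q where q: "q < rnk A (Suc i)" "lookup (lookup v q * lookup (D q) p) a \<noteq> 0"
    by (rule sum.not_neutral_contains_not_neutral) simp
  then have "a \<in> keys (lookup v q * lookup (D q) p)" by (simp add: in_keys_iff)
  then obtain b c where bc: "a = b + c" "b \<in> keys (lookup v q)" "c \<in> keys (lookup (D q) p)"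
    using keys_mult by blast
  have "c + lbl A i p \<in> weights A i (D q)" using bc(3) unfolding weights_iff by (auto simp: in_keys_iff)
  then have "below (c + lbl A i p) (lbl A (Suc i) q)" using D q(1) unfolding deforms_def by blast
  then have "below (b + (c + lbl A i p)) (b + lbl A (Suc i) q)" by (rule below_add_left)
  moreover have "b + lbl A (Suc i) q \<in> weights A (Suc i) v"
    using bc(2) unfolding weights_iff by (auto simp: in_keys_iff)
  ultimately show "s \<in> down (weights A (Suc i) v)"
    unfolding down_def pa(2) bc(1) add.assoc by blast
qed

text \<open>
  A term of weight \<open>w\<close> in the image comes from a term of weight at least \<open>w\<close> in \<open>v\<close>. If \<open>w\<close> is
  an upper bound of the weights of \<open>v\<close>, equality holds throughout, and only the undeformed part of \<open>D\<close>
  contributes.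
\<close>
lemma deforms_top_part:
  assumes D: "deforms A i D" and v: "v \<in> free_module (rnk A (Suc i))"
    and top: "\<And>t. t \<in> weights A (Suc i) v \<Longrightarrow> leq t w"
  shows "weight_part A i w (lin_map D v) = boundary A i (weight_part A (Suc i) w v)"
proof
  fix p
  have cff: "cff A i q p = (if lbl A i p \<preceq> lbl A (Suc i) q
      then lookup (lookup (D q) p) (lbl A (Suc i) q - lbl A i p) else 0)" if "q < rnk A (Suc i)" for q
    using D that unfolding deforms_def by (auto simp: weight_part_def fun_eq_iff)
  show "weight_part A i w (lin_map D v) p = boundary A i (weight_part A (Suc i) w v) p"
  proof (cases "lbl A i p \<preceq> w")
    case False
    have "weight_part A (Suc i) w v q * cff A i q p = 0" if "q < rnk A (Suc i)" for q
      using False cff[OF that] mono_dvd_trans[of "lbl A i p" "lbl A (Suc i) q" w]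
      by (auto simp: weight_part_def)
    then show ?thesis using False
      by (auto simp: weight_part_def[of A i] boundary_def linear_ext_def intro!: sum.neutral)
  next
    case True
    let ?a = "w - lbl A i p"
    have a: "?a + lbl A i p = w" using True by (rule mono_dvd_diff_plus)
    have "lookup (lookup v q * lookup (D q) p) ?a = weight_part A (Suc i) w v q * cff A i q p"
      if q: "q < rnk A (Suc i)" for q
    proof -
      have pair: "lbl A i p \<preceq> lbl A (Suc i) q \<and> lbl A (Suc i) q \<preceq> w \<and>
          b = w - lbl A (Suc i) q \<and> c = lbl A (Suc i) q - lbl A i p"
        if bc: "b \<in> keys (lookup v q)" "c \<in> keys (lookup (D q) p)" "b + c = ?a" for b c
      proof -
        have "b + lbl A (Suc i) q \<in> weights A (Suc i) v" "c + lbl A i p \<in> weights A i (D q)"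
          using bc unfolding weights_iff by (auto simp: in_keys_iff)
        then have le: "leq (b + lbl A (Suc i) q) w" "leq (c + lbl A i p) (lbl A (Suc i) q)"
          using top D q unfolding deforms_def below_def by blast+
        have eq: "b + (c + lbl A i p) = w" using bc(3) a by (simp only: add.assoc[symmetric])
        have "leq w (b + lbl A (Suc i) q)" using leq_add_left[OF le(2), of b] eq by simp
        then have 1: "b + lbl A (Suc i) q = w" using le(1) leq_antisym by blast
        then have "c + lbl A i p = lbl A (Suc i) q" using eq by (metis add_left_cancel)
        with 1 have "lbl A (Suc i) q = c + lbl A i p" "w = b + lbl A (Suc i) q" by simp_all
        then show ?thesis by simp
      qed
      show ?thesis
      proof (cases "lbl A i p \<preceq> lbl A (Suc i) q \<and> lbl A (Suc i) q \<preceq> w")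
        case T: True
        let ?b = "w - lbl A (Suc i) q" and ?c = "lbl A (Suc i) q - lbl A i p"
        have "?b + ?c + lbl A i p = ?b + (?c + lbl A i p)" by (simp only: add.assoc)
        also have "\<dots> = w" using T by (simp only: mono_dvd_diff_plus)
        finally have "?b + ?c + lbl A i p = w" .
        then have bc: "?b + ?c = ?a" using add_diff_cancel_right'[of "?b + ?c" "lbl A i p"] by simp
        have "lookup (lookup v q * lookup (D q) p) (?b + ?c) = lookup (lookup v q) ?b * lookup (lookup (D q) p) ?c"
        proof (rule lookup_mult_unique)
          fix b c assume "b \<in> keys (lookup v q)" "c \<in> keys (lookup (D q) p)" "b + c = ?b + ?c"
          then show "b = ?b \<and> c = ?c" using pair[of b c] unfolding bc by blast
        qed
        then show ?thesis using T cff[OF q] by (simp add: bc weight_part_def)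
      next
        case F: False
        have "?a \<notin> keys (lookup v q * lookup (D q) p)"
        proof
          assume "?a \<in> keys (lookup v q * lookup (D q) p)"
          then obtain b c where "?a = b + c" "b \<in> keys (lookup v q)" "c \<in> keys (lookup (D q) p)"
            using keys_mult by blast
          then show False using pair[of b c] F by simp
        qed
        then show ?thesis using F cff[OF q] by (auto simp: in_keys_iff weight_part_def)
      qed
    qed
    then show ?thesis using True
      by (simp add: weight_part_def[of A i] boundary_def linear_ext_def lookup_lin_map_free[OF v] lookup_sum)
  qed
qed

text \<open>
  Exactness survives the deformation. The part of top weight of a vector in \<open>Z\<close> is a cycle of the frame,
  so it is the boundary of a chain of the same multidegree. Subtracting the image of that chain under
  \<open>D\<close> removes the top weight and only adds smaller ones. No weight grows on the way, so the weights of the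
  preimage stay below those of \<open>v\<close>.
\<close>
lemma deformed_exactness:
  fixes A :: "('x, 'k::field) frame"
  assumes A: "frame_of U A" and D: "deforms A i D" and Z: "sv.subspace Z" "Z \<subseteq> free_module (rnk A i)"
    and DZ: "\<And>q. q < rnk A (Suc i) \<Longrightarrow> D q \<in> Z"
    and top: "\<And>v w. v \<in> Z \<Longrightarrow> w \<in> weights A i v \<Longrightarrow> (\<And>t. t \<in> weights A i v \<Longrightarrow> leq t w) \<Longrightarrow>
                cycle_at U A i w (weight_part A i w v)"
    and v: "v \<in> Z"
  shows "\<exists>u\<in>free_module (rnk A (Suc i)). lin_map D u = v \<and> weights A (Suc i) u \<subseteq> down (weights A i v)"
  using v
proof (induction "card (down (weights A i v))" arbitrary: v rule: less_induct)
  case less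
  show ?case
  proof (cases "v = 0")
    case True
    then show ?thesis
      by (intro bexI[of _ 0]) (auto simp: weights_def free_module_def)
  next
    case False
    then have "weights A i v \<noteq> {}" using weights_empty by blast
    then obtain w where w: "w \<in> weights A i v" "\<And>t. t \<in> weights A i v \<Longrightarrow> leq t w"
      using exists_max[OF finite_weights] by blast
    from top[OF less.prems w] A obtain x where x: "chain_at A (Suc i) w x" "boundary A i x = weight_part A i w v"
      unfolding frame_of_def by blast
    \<comment> \<open>Subtracting the image of \<open>?u\<close> cancels the part of top weight \<open>w\<close>.\<close>
    let ?u = "single_weight A (Suc i) w x"
    let ?v = "v - lin_map D ?u"
    have uf: "?u \<in> free_module (rnk A (Suc i))" by (rule single_weight_free)
    have uw: "weights A (Suc i) ?u \<subseteq> {w}" by (rule weights_single_weight[OF x(1)])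
    have "lin_map D ?u \<in> Z" unfolding lin_map_def using uf DZ
      by (intro sv.subspace_sum[OF Z(1)] sv.subspace_scale[OF Z(1)]) (auto simp: free_module_def)
    then have vZ: "?v \<in> Z" using less.prems by (intro sv.subspace_diff[OF Z(1)])
    have "leq t w" if "t \<in> weights A (Suc i) ?u" for t using uw that by auto
    then have "weight_part A i w (lin_map D ?u) = boundary A i (weight_part A (Suc i) w ?u)"
      by (rule deforms_top_part[OF D uf])
    also have "\<dots> = weight_part A i w v"
      by (simp only: weight_part_single_weight[OF x(1)] x(2))
    finally have "weight_part A i w (lin_map D ?u) = weight_part A i w v" .
    then have wn: "w \<notin> weights A i ?v"
      by (intro weight_part_eq_0) (simp add: weight_part_diff)
    have "weights A i (lin_map D ?u) \<subseteq> down {w}"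
      using deforms_weights[OF D uf] uw unfolding down_def by blast
    then have wv: "weights A i ?v \<subseteq> weights A i v \<union> down {w}" using weights_diff by blast
    then have sub: "weights A i ?v \<subseteq> down (weights A i v)"
      using w(1) subset_down unfolding down_def by blast
    have "w \<notin> down (weights A i ?v)"
    proof
      assume "w \<in> down (weights A i ?v)"
      then obtain t where t: "t \<in> weights A i ?v" "leq w t" by (auto simp: down_def below_def)
      then have "leq t w" using wv w(2) by (auto simp: down_def below_def)
      then show False using t wn leq_antisym by blast
    qed
    moreover have "w \<in> down (weights A i v)" using w(1) subset_down by blast
    ultimately have "down (weights A i ?v) \<subset> down (weights A i v)" using down_mono[OF sub] by blast
    then have "card (down (weights A i ?v)) < card (down (weights A i v))"
      by (intro psubset_card_mono finite_down finite_weights)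
    from less.hyps[OF this vZ] obtain u where u: "u \<in> free_module (rnk A (Suc i))" "lin_map D u = ?v"
      "weights A (Suc i) u \<subseteq> down (weights A i ?v)" by blast
    have "weights A (Suc i) (?u + u) \<subseteq> down (weights A i v)"
      using weights_add[of A "Suc i" ?u u] uw u(3) down_mono[OF sub] w(1) subset_down by blast
    moreover have "?u + u \<in> free_module (rnk A (Suc i))"
      using uf u(1) by (rule sv.subspace_add[OF subspace_free_module])
    moreover have "lin_map D (?u + u) = v" using u(2) by (simp add: lin_map_add)
    ultimately show ?thesis by blast
  qed
qed

end


section \<open>Lifting a frame to a resolution\<close>

context graded_term_order
begin

text \<open>
  Used for vectors whose part of weight \<open>t\<close> has cancelled.
\<close>
lemma strictly_smaller_without_top_part:
  assumes "weights A i v \<subseteq> down {t}" "weight_part A i t v = (\<lambda>_. 0)"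
    and "s \<in> weights A i v"
  shows "below s t \<and> \<not> below t s"
proof -
  have "below s t" using assms(1,3) by (auto simp: down_def)
  moreover have "t \<notin> weights A i v" by (rule weight_part_eq_0[OF assms(2)])
  ultimately show ?thesis using assms(3) below_antisym by blast
qed

text \<open>
  The state of the lifting at homological degree \<open>i\<close>: \<open>Z\<close> is the kernel of the lifted map out of the \<open>i\<close>-th
  module, the parts of top weight of its members are cycles of the frame, and \<open>D\<close> is a lifted
  differential with values in \<open>Z\<close>.
\<close>
definition stage ::
    "'x monomial set \<Rightarrow> ('x, 'k::field) frame \<Rightarrow> nat \<Rightarrow> (nat \<Rightarrow>\<^sub>0 ('x, 'k) polynomial) set \<Rightarrow>
      (nat \<Rightarrow> (nat \<Rightarrow>\<^sub>0 ('x, 'k) polynomial)) \<Rightarrow> bool" where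
  "stage U A i Z D \<longleftrightarrow> sv.subspace Z \<and> Z \<subseteq> free_module (rnk A i) \<and>
     (\<forall>v\<in>Z. \<forall>w\<in>weights A i v. (\<forall>t\<in>weights A i v. leq t w) \<longrightarrow> cycle_at U A i w (weight_part A i w v)) \<and>
     deforms A i D \<and> (\<forall>q<rnk A (Suc i). D q \<in> Z)"

lemma stage_exact:
  assumes "frame_of U A" "stage U A i Z D" "v \<in> Z"
  shows "\<exists>u\<in>free_module (rnk A (Suc i)). lin_map D u = v \<and> weights A (Suc i) u \<subseteq> down (weights A i v)"
  using assms unfolding stage_def by (intro deformed_exactness[of U A i D Z v]) auto

lemma stage_image:
  assumes A: "frame_of U A" and s: "stage U A i Z D"
  shows "lin_map D ` free_module (rnk A (Suc i)) = Z"
proof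
  have Z: "sv.subspace Z" using s by (simp add: stage_def)
  show "lin_map D ` free_module (rnk A (Suc i)) \<subseteq> Z"
    unfolding lin_map_def using s
    by (intro image_subsetI sv.subspace_sum[OF Z] sv.subspace_scale[OF Z])
       (auto simp: stage_def free_module_def)
  show "Z \<subseteq> lin_map D ` free_module (rnk A (Suc i))"
    using stage_exact[OF A s] by blast
qed

text \<open>
  A column of the next matrix starts from the column \<open>w\<close> of the frame. Its image under \<open>D\<close> need not vanish,
  but has lost its top part, as the frame is a complex. By \<open>stage_exact\<close> it is also the
  image of a vector \<open>u\<close> of smaller weights, and \<open>w - u\<close> is the corrected column.
\<close>
lemma stage_Suc:
  fixes A :: "('x, 'k::field) frame"
  assumes A: "frame_of U A" and s: "stage U A i Z D"
  defines "Z' \<equiv> {v \<in> free_module (rnk A (Suc i)). lin_map D v = 0}"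
  shows "\<exists>D'. stage U A (Suc i) Z' D'"
proof -
  let ?l = "lbl A (Suc (Suc i))"
  have D: "deforms A i D" using s by (simp add: stage_def)
  have sub: "sv.subspace Z'"
    unfolding Z'_def sv.subspace_def
    by (simp add: lin_map_add lin_map_scale sv.subspace_0[OF subspace_free_module]
        sv.subspace_add[OF subspace_free_module] sv.subspace_scale[OF subspace_free_module])
  have top: "cycle_at U A (Suc i) w (weight_part A (Suc i) w v)"
    if v: "v \<in> Z'" and w: "\<And>t. t \<in> weights A (Suc i) v \<Longrightarrow> leq t w" for v w
  proof -
    have vf: "v \<in> free_module (rnk A (Suc i))" and v0: "lin_map D v = 0" using v by (simp_all add: Z'_def)
    have "boundary A i (weight_part A (Suc i) w v) = weight_part A i w 0"
      using deforms_top_part[OF D vf w] v0 by simp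
    also have "\<dots> = (\<lambda>_. 0)" by (auto simp: weight_part_def)
    finally show ?thesis using chain_at_weight_part[OF vf] by (simp add: cycle_at_def)
  qed
  have "\<exists>y. y \<in> Z' \<and> weight_part A (Suc i) (?l q) y = cff A (Suc i) q \<and>
      (\<forall>s\<in>weights A (Suc i) y. below s (?l q))" if q: "q < rnk A (Suc (Suc i))" for q
  proof -
    let ?c = "cff A (Suc i) q"
    have cyc: "cycle_at U A (Suc i) (?l q) ?c" using A q unfolding frame_of_def by blast
    then have ch: "chain_at A (Suc i) (?l q) ?c" and c0: "boundary A i ?c = (\<lambda>_. 0)"
      by (simp_all add: cycle_at_def)
    let ?w = "single_weight A (Suc i) (?l q) ?c"
    have wf: "?w \<in> free_module (rnk A (Suc i))" by (rule single_weight_free)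
    have ww: "weights A (Suc i) ?w \<subseteq> {?l q}" by (rule weights_single_weight[OF ch])
    have wp: "weight_part A (Suc i) (?l q) ?w = ?c" by (rule weight_part_single_weight[OF ch])
    let ?z = "lin_map D ?w"
    have zZ: "?z \<in> Z" using stage_image[OF A s] wf by blast
    have "leq t (?l q)" if "t \<in> weights A (Suc i) ?w" for t using ww that by auto
    then have "weight_part A i (?l q) ?z = boundary A i (weight_part A (Suc i) (?l q) ?w)"
      by (rule deforms_top_part[OF D wf])
    then have z0: "weight_part A i (?l q) ?z = (\<lambda>_. 0)" by (simp only: wp c0)
    have zd: "weights A i ?z \<subseteq> down {?l q}"
      using deforms_weights[OF D wf] ww unfolding down_def by blast
    obtain u where u: "u \<in> free_module (rnk A (Suc i))" "lin_map D u = ?z"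
      "weights A (Suc i) u \<subseteq> down (weights A i ?z)"
      using stage_exact[OF A s zZ] by blast
    have ub: "below t (?l q) \<and> \<not> below (?l q) t" if t: "t \<in> weights A (Suc i) u" for t
    proof -
      obtain s where st: "s \<in> weights A i ?z" "below t s" using u(3) t by (auto simp: down_def)
      have "below s (?l q) \<and> \<not> below (?l q) s" by (rule strictly_smaller_without_top_part[OF zd z0 st(1)])
      then show ?thesis using st(2) below_trans by blast
    qed
    then have "?l q \<notin> weights A (Suc i) u" using below_refl by blast
    then have u0: "weight_part A (Suc i) (?l q) u p = 0" for p
      using weight_part_nonzero by blast
    let ?y = "?w - u"
    have "?y \<in> Z'" unfolding Z'_def
      using u(2) sv.subspace_diff[OF subspace_free_module wf u(1)] by (simp add: lin_map_diff)
    moreover have "weight_part A (Suc i) (?l q) ?y = ?c"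
      by (simp add: weight_part_diff wp u0)
    moreover have "below t (?l q)" if t: "t \<in> weights A (Suc i) ?y" for t
      using weights_diff[of A "Suc i" ?w u] t ww ub below_refl by blast
    ultimately show ?thesis by blast
  qed
  then obtain D' where D': "\<And>q. q < rnk A (Suc (Suc i)) \<Longrightarrow> D' q \<in> Z' \<and>
      weight_part A (Suc i) (?l q) (D' q) = cff A (Suc i) q \<and>
      (\<forall>s\<in>weights A (Suc i) (D' q). below s (?l q))" by metis
  have "deforms A (Suc i) D'" unfolding deforms_def using D' unfolding Z'_def by blast
  moreover have "Z' \<subseteq> free_module (rnk A (Suc i))" unfolding Z'_def by blast
  ultimately have "stage U A (Suc i) Z' D'"
    unfolding stage_def using sub top D' by blast
  then show ?thesis by blast
qed

text \<open>
  If the monomials in \<open>U\<close> are exactly the leading monomials of \<open>I\<close>, realised by members of \<open>I\<close> that are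
  homogeneous for \<open>\<kappa>\<close>, then a frame for \<open>U\<close> deforms to a graded free resolution of \<open>I\<close> with the same
  ranks and degrees. The constant terms of its matrices join basis vectors with labels of equal
  \<open>\<kappa>\<close>-degree, so \<open>sep\<close> makes the resolution minimal.
\<close>
theorem lifted_resolution:
  fixes A :: "('x, 'k::field) frame" and I :: "('x, 'k) polynomial set"
  assumes A: "frame_of U A" and I: "poly_ideal I"
    and lead: "\<And>f t. f \<in> I \<Longrightarrow> t \<in> keys f \<Longrightarrow> (\<And>s. s \<in> keys f \<Longrightarrow> leq s t) \<Longrightarrow> t \<in> U"
    and gens: "\<And>t. t \<in> U \<Longrightarrow> \<exists>g\<in>I. lookup g t = 1 \<and> (\<forall>s\<in>keys g. below s t)"
    and sep: "\<And>i p q. p < rnk A i \<Longrightarrow> q < rnk A (Suc i) \<Longrightarrow> \<kappa> (lbl A i p) \<noteq> \<kappa> (lbl A (Suc i) q)"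
  shows "\<exists>F. graded_free_resolution I F \<and>
     (\<forall>i. shifts F i = map (\<lambda>q. int (monomial_degree (lbl A i q))) [0..<rnk A i]) \<and>
     (\<forall>i. \<forall>q<rank_at F (Suc i). constants (differential F i q) = 0)"
proof -
  have A1: "rnk A 0 = 1" "lbl A 0 0 = 0" using A by (simp_all add: frame_of_def)
  define Z0 where "Z0 = {v \<in> free_module 1. lookup v 0 \<in> I}"
  have stage0: "\<exists>D. stage U A 0 Z0 D"
  proof -
    have sub: "sv.subspace Z0"
      unfolding sv.subspace_def
    proof (intro conjI ballI allI)
      show "0 \<in> Z0" using I by (simp add: Z0_def free_module_def poly_ideal_def)
    next
      fix x y assume "x \<in> Z0" "y \<in> Z0"
      then show "x + y \<in> Z0" using I sv.subspace_add[OF subspace_free_module, of x 1 y]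
        by (simp add: Z0_def poly_ideal_def Poly_Mapping.lookup_add)
    next
      fix c x assume "x \<in> Z0"
      then show "scale_vec c x \<in> Z0" using I sv.subspace_scale[OF subspace_free_module, of x 1 c]
        by (simp add: Z0_def poly_ideal_def lookup_scale_vec)
    qed
    have wt: "weights A 0 v = keys (lookup v 0)" if "v \<in> free_module 1" for v :: "nat \<Rightarrow>\<^sub>0 ('x, 'k) polynomial"
    proof -
      have "lookup v p = 0" if "p \<noteq> 0" for p using \<open>v \<in> free_module 1\<close> that by (auto simp: free_module_iff)
      then have "(lookup (lookup v p) u \<noteq> 0 \<and> t = u + lbl A 0 p) \<longleftrightarrow> (p = 0 \<and> t = u \<and> lookup (lookup v 0) u \<noteq> 0)" for p u t
        using A1 by (cases "p = 0") auto
      then show ?thesis by (auto simp: weights_iff in_keys_iff)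
    qed
    have top: "cycle_at U A 0 w (weight_part A 0 w v)"
      if "v \<in> Z0" "w \<in> weights A 0 v" "\<forall>t\<in>weights A 0 v. leq t w" for v w
    proof -
      have v: "v \<in> free_module 1" "lookup v 0 \<in> I" using that(1) by (simp_all add: Z0_def)
      have "w \<in> U" using lead[OF v(2), of w] that wt[OF v(1)] by auto
      then show ?thesis using chain_at_weight_part[of v A 0 w] v(1) A1 by (simp add: cycle_at_def)
    qed
    have "\<exists>y. y \<in> Z0 \<and> weight_part A 0 (lbl A 1 q) y = cff A 0 q \<and> (\<forall>s\<in>weights A 0 y. below s (lbl A 1 q))"
      if q: "q < rnk A 1" for q
    proof (cases "cff A 0 q = (\<lambda>_. 0)")
      case True
      have "0 \<in> Z0" using sub sv.subspace_0 by blast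
      moreover have "weight_part A 0 (lbl A 1 q) (0 :: nat \<Rightarrow>\<^sub>0 ('x, 'k) polynomial) = (\<lambda>_. 0)"
        by (auto simp: weight_part_def)
      moreover have "weights A 0 (0 :: nat \<Rightarrow>\<^sub>0 ('x, 'k) polynomial) = {}" by (simp add: weights_def)
      ultimately show ?thesis using True by (intro exI[of _ 0]) simp
    next
      case False
      have cyc: "cycle_at U A 0 (lbl A 1 q) (cff A 0 q)"
        using A q unfolding frame_of_def One_nat_def by blast
      then have "lbl A 1 q \<in> U" using False by (simp add: cycle_at_def)
      from gens[OF this] obtain g where g: "g \<in> I" "lookup g (lbl A 1 q) = 1"
        "\<And>s. s \<in> keys g \<Longrightarrow> below s (lbl A 1 q)" by blast
      let ?f = "single 0 (cff A 0 q 0) * g :: ('x, 'k) polynomial"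
      let ?y = "single 0 ?f :: nat \<Rightarrow>\<^sub>0 ('x, 'k) polynomial"
      have lf: "lookup ?f t = cff A 0 q 0 * lookup g t" for t
        by (simp add: Poly_Mapping.map.rep_eq when_def flip: mult_map_scale_conv_mult)
      have yf: "?y \<in> free_module 1" by (rule single_in_free_module) simp
      then have "?y \<in> Z0" using g(1) I by (simp add: Z0_def poly_ideal_def)
      moreover have "weight_part A 0 (lbl A 1 q) ?y p = cff A 0 q p" for p
      proof (cases "p = 0")
        case True
        then show ?thesis using A1 lf g(2) by (simp add: weight_part_def)
      next
        case False
        then have "cff A 0 q p = 0" using cyc A1 by (auto simp: cycle_at_def chain_at_def)
        then show ?thesis using False by (simp add: weight_part_def lookup_single when_def)
      qed
      moreover have "below s (lbl A 1 q)" if "s \<in> weights A 0 ?y" for s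
      proof (rule g(3))
        show "s \<in> keys g" using that lf unfolding wt[OF yf] by (auto simp: in_keys_iff)
      qed
      ultimately show ?thesis by blast
    qed
    then obtain D where D: "\<And>q. q < rnk A 1 \<Longrightarrow> D q \<in> Z0 \<and> weight_part A 0 (lbl A 1 q) (D q) = cff A 0 q \<and>
        (\<forall>s\<in>weights A 0 (D q). below s (lbl A 1 q))" by metis
    have "Z0 \<subseteq> free_module (rnk A 0)" using A1 by (auto simp: Z0_def)
    moreover from this have "deforms A 0 D" unfolding deforms_def using D by auto
    ultimately have "stage U A 0 Z0 D" unfolding stage_def using sub top D by auto
    then show ?thesis by blast
  qed
  have "\<exists>S. \<forall>i. (case S i of (Z, D) \<Rightarrow> stage U A i Z D \<and> (i = 0 \<longrightarrow> Z = Z0)) \<and>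
      fst (S (Suc i)) = {v \<in> free_module (rnk A (Suc i)). lin_map (snd (S i)) v = 0}"
  proof (rule dependent_nat_choice)
    show "\<exists>S. case S of (Z, D) \<Rightarrow> stage U A 0 Z D \<and> (0 = (0::nat) \<longrightarrow> Z = Z0)"
      using stage0 by auto
  next
    fix S i assume "case S of (Z, D) \<Rightarrow> stage U A i Z D \<and> (i = 0 \<longrightarrow> Z = Z0)"
    then have "stage U A i (fst S) (snd S)" by (simp add: case_prod_beta)
    from stage_Suc[OF A this]
    show "\<exists>S'. (case S' of (Z, D) \<Rightarrow> stage U A (Suc i) Z D \<and> (Suc i = 0 \<longrightarrow> Z = Z0)) \<and>
        fst S' = {v \<in> free_module (rnk A (Suc i)). lin_map (snd S) v = 0}" by auto
  qed
  then obtain S where S': "\<forall>i. (case S i of (Z, D) \<Rightarrow> stage U A i Z D \<and> (i = 0 \<longrightarrow> Z = Z0)) \<and>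
      fst (S (Suc i)) = {v \<in> free_module (rnk A (Suc i)). lin_map (snd (S i)) v = 0}" ..
  have S: "stage U A i (fst (S i)) (snd (S i))" "fst (S 0) = Z0"
    "fst (S (Suc i)) = {v \<in> free_module (rnk A (Suc i)). lin_map (snd (S i)) v = 0}" for i
    using spec[OF S', of i] spec[OF S', of 0] by (simp_all add: case_prod_beta)
  define D where "D i = snd (S i)" for i
  have im: "lin_map (D i) ` free_module (rnk A (Suc i)) = fst (S i)" for i
    unfolding D_def by (rule stage_image[OF A S(1)])
  have def: "deforms A i (D i)" for i using S(1)[of i] by (simp add: stage_def D_def)
  define F where "F = \<lparr> shifts = (\<lambda>i. map (\<lambda>q. int (monomial_degree (lbl A i q))) [0..<rnk A i]),
     differential = D, aug = (\<lambda>_. 1 :: ('x, 'k) polynomial) \<rparr>"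
  have rank: "rank_at F i = rnk A i" for i by (simp add: rank_at_def F_def)
  have entry: "u \<in> keys (lookup (D i q) p) \<Longrightarrow> q < rnk A (Suc i) \<Longrightarrow>
      \<kappa> (u + lbl A i p) = \<kappa> (lbl A (Suc i) q)" for i p q u
  proof -
    assume u: "u \<in> keys (lookup (D i q) p)" and q: "q < rnk A (Suc i)"
    have "u + lbl A i p \<in> weights A i (D i q)" using u unfolding weights_iff by (auto simp: in_keys_iff)
    then show ?thesis using def[of i] q unfolding deforms_def below_def by blast
  qed
  have free: "D i q \<in> free_module (rnk A i)" if "q < rnk A (Suc i)" for i q
    using def[of i] that by (simp add: deforms_def)
  have aug: "aug_map F v = lookup v 0" if "v \<in> free_module 1" for v
  proof -
    have "aug_map F v = (\<Sum>q<1. lookup v q * aug F q)"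
      using that by (intro aug_map_eq) (auto simp: free_module_def)
    then show ?thesis by (simp add: F_def)
  qed
  have "graded_free_resolution I F"
    unfolding graded_free_resolution_def rank
  proof (intro conjI allI impI)
    fix q assume "q < rnk A 0"
    then show "homogeneous (shifts F 0 ! q) (aug F q)"
      using A1 by (simp add: F_def homogeneous_def)
  next
    fix i q assume q: "q < rnk A (Suc i)"
    then show "differential F i q \<in> free_module (rnk A i)" using free by (simp add: F_def)
    fix p assume p: "p < rnk A i"
    have "int (monomial_degree u) = int (monomial_degree (lbl A (Suc i) q)) - int (monomial_degree (lbl A i p))"
      if "u \<in> keys (lookup (D i q) p)" for u
      using fine_degree[OF entry[OF that q]] by (simp add: monomial_degree_add)
    then show "homogeneous (shifts F (Suc i) ! q - shifts F i ! p) (lookup (differential F i q) p)"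
      using p q by (simp add: F_def homogeneous_def)
  next
    fix f :: "('x, 'k) polynomial"
    have "single 0 f \<in> free_module (rnk A 0)" using A1 by (intro single_in_free_module) simp
    moreover have "f - aug_map F (single 0 f) \<in> I"
      using I by (simp add: F_def poly_ideal_def)
    ultimately show "\<exists>v\<in>free_module (rnk A 0). f - aug_map F v \<in> I" by blast
  next
    have "{v \<in> free_module (rnk A 0). aug_map F v \<in> I} = Z0"
      using aug by (auto simp: A1 Z0_def)
    then show "{v \<in> free_module (rnk A 0). aug_map F v \<in> I} = sv.span (differential F 0 ` {..<rnk A 1})"
      using im[of 0] S(2) by (simp add: span_lin_map F_def)
  next
    fix i
    show "{v \<in> free_module (rnk A (Suc i)). lin_map (differential F i) v = 0}
        = sv.span (differential F (Suc i) ` {..<rnk A (Suc (Suc i))})"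
      using im[of "Suc i"] S(3)[of i] by (simp add: span_lin_map F_def D_def)
  qed
  moreover have "constants (differential F i q) = 0" if q: "q < rank_at F (Suc i)" for i q
  proof (rule poly_mapping_eqI)
    fix p
    have "lookup (lookup (D i q) p) 0 = 0"
    proof (rule ccontr)
      assume nz: "lookup (lookup (D i q) p) 0 \<noteq> 0"
      then have "lookup (D i q) p \<noteq> 0" by (intro notI) simp
      then have "p < rnk A i" using free[of q i] q by (simp add: rank free_module_iff)
      moreover have "\<kappa> (0 + lbl A i p) = \<kappa> (lbl A (Suc i) q)"
        using nz q by (intro entry) (simp_all add: in_keys_iff rank)
      ultimately show False using sep[of p i q] q by (simp add: rank)
    qed
    then show "lookup (constants (differential F i q)) p = lookup 0 p" by (simp add: F_def)
  qed
  moreover have "shifts F i = map (\<lambda>q. int (monomial_degree (lbl A i q))) [0..<rnk A i]" for i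
    by (simp add: F_def)
  ultimately show ?thesis by blast
qed

corollary lifted_betti:
  fixes I :: "('x, 'k::field) polynomial set"
  assumes A: "frame_of U (A :: ('x, 'k) frame)" and I: "graded_ideal I"
    and lead: "\<And>f t. f \<in> I \<Longrightarrow> t \<in> keys f \<Longrightarrow> (\<And>s. s \<in> keys f \<Longrightarrow> leq s t) \<Longrightarrow> t \<in> U"
    and gens: "\<And>t. t \<in> U \<Longrightarrow> \<exists>g\<in>I. lookup g t = 1 \<and> (\<forall>s\<in>keys g. below s t)"
    and sep: "\<And>i p q. p < rnk A i \<Longrightarrow> q < rnk A (Suc i) \<Longrightarrow> \<kappa> (lbl A i p) \<noteq> \<kappa> (lbl A (Suc i) q)"
  shows "graded_betti I i j = card {q. q < rnk A i \<and> int (monomial_degree (lbl A i q)) = j}"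
proof -
  have Ii: "poly_ideal I" using I by (simp add: graded_ideal_def)
  have "\<exists>F. graded_free_resolution I F \<and>
     (\<forall>i. shifts F i = map (\<lambda>q. int (monomial_degree (lbl A i q))) [0..<rnk A i]) \<and>
     (\<forall>i. \<forall>q<rank_at F (Suc i). constants (differential F i q) = 0)"
    by (rule lifted_resolution[OF A Ii lead gens sep])
  then obtain F where F: "graded_free_resolution I F"
    "\<And>i. shifts F i = map (\<lambda>q. int (monomial_degree (lbl A i q))) [0..<rnk A i]"
    "\<And>i q. q < rank_at F (Suc i) \<Longrightarrow> constants (differential F i q) = 0" by blast
  have "graded_free_resolution I (SOME F. graded_free_resolution I F)"
    using F(1) by (rule someI)
  from minimal_resolution_betti[OF I F(1) this F(3)]
  have "graded_betti I i j = card {q. q < rank_at F i \<and> shifts F i ! q = j}"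
    by (simp add: graded_betti_def)
  also have "{q. q < rank_at F i \<and> shifts F i ! q = j}
      = {q. q < rnk A i \<and> int (monomial_degree (lbl A i q)) = j}"
    by (auto simp: rank_at_def F(2))
  finally show ?thesis .
qed

end


section \<open>Buchberger's criterion\<close>

lemma sum_single_lookup: "(\<Sum>u\<in>keys h. single u (lookup h u)) = h"
proof (rule poly_mapping_eqI)
  fix t
  have "lookup (\<Sum>u\<in>keys h. single u (lookup h u)) t
      = (\<Sum>u\<in>keys h. if u = t then lookup h t else 0)"
    unfolding lookup_sum by (rule sum.cong) (auto simp: lookup_single when_def)
  then show "lookup (\<Sum>u\<in>keys h. single u (lookup h u)) t = lookup h t"
    by (simp add: in_keys_iff)
qed

lemma lookup_single_mult:
  fixes f :: "('x, 'k::comm_ring_1) polynomial"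
  shows "lookup (single u c * f) (u + t) = c * lookup f t"
  by (subst lookup_mult_unique) (auto split: if_splits)

lemma keys_single_mult:
  fixes f :: "('x, 'k::comm_ring_1) polynomial"
  shows "keys (single u c * f) \<subseteq> (\<lambda>t. u + t) ` keys f"
  using keys_mult[of "single u c" f] by (auto split: if_splits)

text \<open>
  The relation \<open>below\<close> expresses at once that \<open>m q\<close> is the leading monomial of \<open>g q\<close> and that \<open>g q\<close> is
  homogeneous for \<open>\<kappa>\<close>.
\<close>
locale marked_family = graded_term_order leq \<kappa>
  for leq :: "'x::finite monomial \<Rightarrow> 'x monomial \<Rightarrow> bool" and \<kappa> :: "'x monomial \<Rightarrow> 'g" +
  fixes Q :: "'i set" and g :: "'i \<Rightarrow> ('x, 'k::field) polynomial" and m :: "'i \<Rightarrow> 'x monomial"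
  assumes monic: "q \<in> Q \<Longrightarrow> lookup (g q) (m q) = 1"
    and marked: "q \<in> Q \<Longrightarrow> s \<in> keys (g q) \<Longrightarrow> below s (m q)"
begin

text \<open>
  The combinations of multiples of the \<open>g q\<close> by terms, where the leading monomials of the multiples
  belong to \<open>W\<close>.
\<close>
inductive_set gspan :: "'x monomial set \<Rightarrow> ('x, 'k) polynomial set" for W where
  gspan_0: "0 \<in> gspan W"
| gspan_step: "q \<in> Q \<Longrightarrow> u + m q \<in> W \<Longrightarrow> f \<in> gspan W \<Longrightarrow> single u c * g q + f \<in> gspan W"

lemma gspan_mono: "f \<in> gspan V \<Longrightarrow> V \<subseteq> W \<Longrightarrow> f \<in> gspan W"
  by (induction rule: gspan.induct) (auto intro: gspan_0 gspan_step)

lemma gspan_gen: "q \<in> Q \<Longrightarrow> u + m q \<in> W \<Longrightarrow> single u c * g q \<in> gspan W"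
  using gspan_step[OF _ _ gspan_0, of q u W c] by simp

lemma gspan_add: "f \<in> gspan W \<Longrightarrow> h \<in> gspan W \<Longrightarrow> f + h \<in> gspan W"
  by (induction rule: gspan.induct) (auto simp: add.assoc intro: gspan_step)

lemma gspan_sum: "(\<And>x. x \<in> X \<Longrightarrow> f x \<in> gspan W) \<Longrightarrow> (\<Sum>x\<in>X. f x) \<in> gspan W"
  by (induction X rule: infinite_finite_induct) (auto intro: gspan_0 gspan_add)

lemma gspan_shift:
  assumes "f \<in> gspan W" and "\<And>t. t \<in> W \<Longrightarrow> v + t \<in> V"
  shows "single v d * f \<in> gspan V"
  using assms(1)
proof (induction rule: gspan.induct)
  case gspan_0 then show ?case by (simp add: gspan.gspan_0)
next
  case (gspan_step q u f c)
  have "single v d * (single u c * g q + f)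
      = single (v + u) (d * c) * g q + single v d * f"
    by (simp add: distrib_left mult_single flip: mult.assoc)
  moreover have "(v + u) + m q \<in> V" using assms(2)[OF gspan_step.hyps(2)] by (simp add: add.assoc)
  ultimately show ?case using gspan.gspan_step[OF gspan_step.hyps(1) _ gspan_step.IH] by simp
qed

lemma gspan_uminus: "f \<in> gspan W \<Longrightarrow> - f \<in> gspan W"
  using gspan_shift[of f W 0 W "-1"] by (simp add: single_uminus)

lemma gspan_diff: "f \<in> gspan W \<Longrightarrow> h \<in> gspan W \<Longrightarrow> f - h \<in> gspan W"
  using gspan_add[of f W "- h"] gspan_uminus[of h W] by simp

lemma gspan_mult:
  assumes "q \<in> Q" "\<And>u. u \<in> keys h \<Longrightarrow> u + m q \<in> W"
  shows "h * g q \<in> gspan W"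
proof -
  have "(\<Sum>u\<in>keys h. single u (lookup h u)) * g q \<in> gspan W"
    unfolding sum_distrib_right using assms by (intro gspan_sum gspan_gen) auto
  then show ?thesis by (simp only: sum_single_lookup)
qed

lemma gspan_keys: "f \<in> gspan W \<Longrightarrow> keys f \<subseteq> down W"
proof (induction rule: gspan.induct)
  case gspan_0 then show ?case by simp
next
  case (gspan_step q u f c)
  have "keys (single u c * g q) \<subseteq> down W"
  proof
    fix t assume "t \<in> keys (single u c * g q)"
    then obtain s where s: "t = u + s" "s \<in> keys (g q)" using keys_single_mult by blast
    then have "below t (u + m q)" using marked[OF gspan_step.hyps(1)] below_add_left by blast
    then show "t \<in> down W" using gspan_step.hyps(2) unfolding down_def by blast
  qed
  then show ?case using gspan_step.IH Poly_Mapping.keys_add[of "single u c * g q" f] by blast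
qed

text \<open>
  Only finitely many leading monomials occur in a given combination; this finiteness is what
  \<open>buchberger\<close> recurses on.
\<close>
lemma ideal_gspan: assumes "f \<in> ideal_generated (g ` Q)" shows "\<exists>W. finite W \<and> f \<in> gspan W"
  using assms unfolding ideal_generated_def
proof (induction rule: Modules.module.span_induct_alt[OF module_ring_itself, consumes 1, case_names base step])
  case base
  then show ?case using gspan_0 by (intro exI[of _ "{}"]) simp
next
  case (step c x y)
  then obtain W where W: "finite W" "y \<in> gspan W" by blast
  obtain q where q: "q \<in> Q" "x = g q" using step.hyps by blast
  let ?V = "W \<union> (\<lambda>u. u + m q) ` keys c"
  have "c * x \<in> gspan ?V" unfolding q(2) by (rule gspan_mult[OF q(1)]) auto
  moreover have "y \<in> gspan ?V" using W(2) by (rule gspan_mono) auto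
  ultimately have "c * x + y \<in> gspan ?V" by (rule gspan_add)
  then show ?case using W(1) by (intro exI[of _ ?V]) auto
qed

definition strictly_below :: "'x monomial \<Rightarrow> 'x monomial set" where
  "strictly_below t = {s. below s t \<and> s \<noteq> t}"

lemma strictly_below_add: "s \<in> strictly_below t \<Longrightarrow> u + s \<in> strictly_below (u + t)"
  unfolding strictly_below_def using below_add_left by auto

text \<open>
  The S-polynomial of \<open>p\<close> and \<open>q\<close>, multiplied up to the monomial \<open>t\<close>, is a combination of multiples with
  leading monomials below \<open>t\<close>. For fixed \<open>t\<close> this is an equivalence relation, so that it suffices to
  connect \<open>p\<close> with \<open>q\<close> by a chain.
\<close>
definition spair :: "'x monomial \<Rightarrow> 'i \<Rightarrow> 'i \<Rightarrow> bool" where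
  "spair t p q \<longleftrightarrow> single (t - m p) 1 * g p - single (t - m q) 1 * g q
     \<in> gspan (strictly_below t)"

lemma spair_refl: "spair t p p"
  by (simp add: spair_def gspan_0)

lemma spair_sym: "spair t p q \<Longrightarrow> spair t q p"
  unfolding spair_def using gspan_uminus by fastforce

lemma spair_trans: "spair t p q \<Longrightarrow> spair t q r \<Longrightarrow> spair t p r"
  unfolding spair_def using gspan_add by fastforce

lemma spair_shift:
  assumes "spair t p q" "m p \<preceq> t" "m q \<preceq> t" "t \<preceq> s"
  shows "spair s p q"
proof -
  let ?v = "s - t"
  have s: "s = ?v + t" using mono_dvd_diff_plus[OF assms(4)] by simp
  have d: "s - m x = ?v + (t - m x)" if "m x \<preceq> t" for x
  proof -
    have "s = (?v + (t - m x)) + m x"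
      by (subst s) (simp only: add.assoc mono_dvd_diff_plus[OF that])
    then show ?thesis by (metis add_diff_cancel_right')
  qed
  have "single ?v 1 * (single (t - m p) 1 * g p - single (t - m q) 1 * g q)
      \<in> gspan (strictly_below s)"
  proof (rule gspan_shift[OF assms(1)[unfolded spair_def]])
    fix u assume "u \<in> strictly_below t"
    then show "?v + u \<in> strictly_below s" using strictly_below_add[of u t ?v] s by simp
  qed
  then show ?thesis unfolding spair_def d[OF assms(2)] d[OF assms(3)]
    by (simp add: right_diff_distrib mult_single flip: mult.assoc)
qed

lemma tail_strictly_below:
  assumes "q \<in> Q" "u \<in> keys (g q - single (m q) 1)"
  shows "u \<in> strictly_below (m q)"
proof -
  have nz: "lookup (g q) u - (if m q = u then 1 else 0) \<noteq> 0"
    using assms(2) by (simp add: in_keys_iff lookup_minus lookup_single when_def)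
  then have "u \<noteq> m q" using monic[OF assms(1)] by auto
  moreover have "u \<in> keys (g q)" using nz \<open>u \<noteq> m q\<close> by (simp add: in_keys_iff)
  ultimately show ?thesis using marked[OF assms(1)] by (simp add: strictly_below_def)
qed

text \<open>
  Write \<open>h p\<close> for the tail of \<open>g p\<close> without its leading term. The S-polynomial of two members with
  coprime leading monomials equals \<open>h p * g q - h q * g p\<close>.
\<close>
lemma spair_coprime:
  assumes pq: "p \<in> Q" "q \<in> Q" and dvd: "m p \<preceq> t" "m q \<preceq> t"
    and coprime: "keys (m p) \<inter> keys (m q) = {}"
  shows "spair t p q"
proof -
  let ?s = "m p + m q"
  let ?h = "\<lambda>x. g x - single (m x) 1"
  have "lookup (m p) v + lookup (m q) v \<le> lookup t v" for v
  proof (cases "v \<in> keys (m p)")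
    case True
    then have "lookup (m q) v = 0" using coprime by (auto simp: in_keys_iff)
    then show ?thesis using dvd(1) by (simp add: mono_dvd_iff_lookup)
  next
    case False
    then show ?thesis using dvd(2) by (simp add: mono_dvd_iff_lookup in_keys_iff)
  qed
  then have st: "?s \<preceq> t" by (simp add: mono_dvd_iff_lookup Poly_Mapping.lookup_add)
  have 1: "?h p * g q \<in> gspan (strictly_below ?s)"
  proof (rule gspan_mult[OF pq(2)])
    fix u assume "u \<in> keys (?h p)"
    from strictly_below_add[OF tail_strictly_below[OF pq(1) this], of "m q"]
    show "u + m q \<in> strictly_below ?s" by (simp add: add.commute)
  qed
  have 2: "?h q * g p \<in> gspan (strictly_below ?s)"
  proof (rule gspan_mult[OF pq(1)])
    fix u assume "u \<in> keys (?h q)"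
    from strictly_below_add[OF tail_strictly_below[OF pq(2) this], of "m p"]
    show "u + m p \<in> strictly_below ?s" by (simp add: add.commute)
  qed
  have "single (m q) 1 * g p - single (m p) 1 * g q = ?h p * g q - ?h q * g p"
    by (simp add: left_diff_distrib right_diff_distrib mult.commute)
  then have "spair ?s p q"
    unfolding spair_def using gspan_diff[OF 1 2] by simp
  then show ?thesis by (rule spair_shift) (use st in auto)
qed

text \<open>
  Let \<open>w\<close> be the largest monomial of \<open>W\<close>. The S-pair condition lets all multiples with leading monomial
  \<open>w\<close> be collected in a single one. Either its coefficient vanishes, and \<open>W\<close> can be shrunk, or \<open>w\<close> is the
  leading monomial of \<open>f\<close>.
\<close>
theorem buchberger:
  assumes spairs: "\<And>p q t. p \<in> Q \<Longrightarrow> q \<in> Q \<Longrightarrow> m p \<preceq> t \<Longrightarrow> m q \<preceq> t \<Longrightarrow> spair t p q"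
    and f: "f \<in> ideal_generated (g ` Q)"
    and t: "t \<in> keys f" "\<And>s. s \<in> keys f \<Longrightarrow> leq s t"
  shows "\<exists>q\<in>Q. m q \<preceq> t"
proof -
  have main: "\<exists>q\<in>Q. m q \<preceq> t"
    if "finite W" "down W = W" "f \<in> gspan W" "t \<in> keys f"
      "\<And>s. s \<in> keys f \<Longrightarrow> leq s t" for W f
    using that
  proof (induction "card W" arbitrary: W f rule: less_induct)
    case less
    have "W \<noteq> {}"
    proof
      assume "W = {}"
      then have "keys f = {}" using gspan_keys[OF less.prems(3)] less.prems(2) by simp
      then show False using less.prems(4) by simp
    qed
    then obtain w where w: "w \<in> W" "\<And>s. s \<in> W \<Longrightarrow> leq s w"
      using exists_max[OF less.prems(1)] by blast
    let ?V = "W - {w}"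
    have V: "down ?V = ?V"
    proof
      show "?V \<subseteq> down ?V" by (rule subset_down)
      show "down ?V \<subseteq> ?V"
      proof
        fix s assume "s \<in> down ?V"
        then obtain v where v: "v \<in> W" "v \<noteq> w" "below s v" unfolding down_def by blast
        have "s \<in> W" using less.prems(2) v unfolding down_def by blast
        moreover have "s \<noteq> w"
        proof
          assume "s = w"
          then have "leq w v" using v(3) by (simp add: below_def)
          then show False using w(2)[OF v(1)] v(2) leq_antisym by blast
        qed
        ultimately show "s \<in> ?V" by simp
      qed
    qed
    have cV: "card ?V < card W" by (rule psubset_card_mono[OF less.prems(1)]) (use w(1) in blast)
    have fV: "finite ?V" using less.prems(1) by simp
    show ?case
    proof (cases "\<exists>q0\<in>Q. m q0 \<preceq> w")
      case False
      have "h \<in> gspan ?V" if "h \<in> gspan W" for h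
        using that
      proof (induction rule: gspan.induct)
        case gspan_0 then show ?case by (rule gspan.gspan_0)
      next
        case (gspan_step q u f c)
        have "u + m q \<noteq> w" using False gspan_step.hyps(1) mono_dvd_add(2) by blast
        then show ?case using gspan_step by (intro gspan.gspan_step) auto
      qed
      then show ?thesis using less.hyps[OF cV fV V] less.prems by blast
    next
      case True
      then obtain q0 where q0: "q0 \<in> Q" "m q0 \<preceq> w" by blast
      let ?x = "\<lambda>c. single (w - m q0) c * g q0"
      \<comment> \<open>All multiples with leading monomial \<open>w\<close> are traded for multiples of the one generator \<open>q0\<close>.\<close>
      have "\<exists>c. h - ?x c \<in> gspan ?V" if "h \<in> gspan W" for h
        using that
      proof (induction rule: gspan.induct)
        case gspan_0 then show ?case by (intro exI[of _ 0]) (simp add: gspan.gspan_0)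
      next
        case (gspan_step q u f c)
        then obtain d where d: "f - ?x d \<in> gspan ?V" by blast
        show ?case
        proof (cases "u + m q = w")
          case False
          then have "single u c * g q + (f - ?x d) \<in> gspan ?V"
            using gspan_step d by (intro gspan.gspan_step) auto
          then show ?thesis by (intro exI[of _ d]) (simp add: add_diff_eq)
        next
          case True
          then have wq: "m q \<preceq> w" "u = w - m q" by auto
          have "spair w q q0" by (rule spairs[OF gspan_step.hyps(1) q0(1) wq(1) q0(2)])
          then have "single 0 c * (single u 1 * g q - ?x 1) \<in> gspan ?V"
            unfolding spair_def wq(2)
          proof (rule gspan_shift)
            fix s assume "s \<in> strictly_below w"
            then show "0 + s \<in> ?V" using less.prems(2) w(1) by (auto simp: strictly_below_def down_def)
          qed
          then have "single u c * g q - ?x c \<in> gspan ?V"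
            by (simp add: right_diff_distrib mult_single flip: mult.assoc)
          from gspan_add[OF this d] have "single u c * g q + f - ?x (c + d) \<in> gspan ?V"
            by (simp add: single_add algebra_simps)
          then show ?thesis by blast
        qed
      qed
      then obtain c where c: "f - ?x c \<in> gspan ?V" using less.prems(3) by blast
      show ?thesis
      proof (cases "c = 0")
        case True
        then have "f \<in> gspan ?V" using c by simp
        then show ?thesis using less.hyps[OF cV fV V _ less.prems(4)] less.prems(5) by blast
      next
        case False
        have "w \<notin> keys (f - ?x c)" using gspan_keys[OF c] V by blast
        moreover have "lookup (?x c) w = c"
          using lookup_single_mult[of "w - m q0" c "g q0" "m q0"] monic[OF q0(1)] mono_dvd_diff_plus[OF q0(2)]
          by simp
        ultimately have "lookup f w = c" by (simp add: in_keys_iff lookup_minus)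
        then have "w \<in> keys f" using False by (simp add: in_keys_iff)
        then have "leq w t" by (rule less.prems(5))
        moreover have "leq t w" using w(2) gspan_keys[OF less.prems(3)] less.prems(2,4) by blast
        ultimately have "t = w" using leq_antisym by blast
        then show ?thesis using q0 by blast
      qed
    qed
  qed
  obtain W where W: "finite W" "f \<in> gspan W" using ideal_gspan[OF f] by blast
  show ?thesis
  proof (rule main[of "down W" f])
    show "finite (down W)" by (rule finite_down[OF W(1)])
    show "down (down W) = down W" using down_mono[of "down W" W] subset_down by blast
    show "f \<in> gspan (down W)" by (rule gspan_mono[OF W(2) subset_down])
  qed (use t in auto)
qed

end


section \<open>Minors and diagonal orders\<close>

text \<open>
  The product of the variables on the main diagonal, as an exponent vector.
\<close>
definition diag_mono :: "'n list \<Rightarrow> 'm list \<Rightarrow> ('n \<times> 'm) monomial" where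
  "diag_mono xs ys = (\<Sum>p<length xs. single (xs ! p, ys ! p) 1)"

text \<open>
  Minors for sorted lists of rows and columns, the form in which single entries can be exchanged.
\<close>
definition list_minor :: "'n list \<Rightarrow> 'm list \<Rightarrow> ('n \<times> 'm, 'k::field) polynomial" where
  "list_minor xs ys = det (mat (length xs) (length xs) (\<lambda>(p, q). var (xs ! p, ys ! q)))"

definition column_degree :: "('n::finite \<times> 'm) monomial \<Rightarrow> 'm \<Rightarrow> nat" where
  "column_degree t c = (\<Sum>\<rho>\<in>UNIV. lookup t (\<rho>, c))"

lemma column_degree_add: "column_degree (s + t) c = column_degree s c + column_degree t c"
  by (simp add: column_degree_def Poly_Mapping.lookup_add sum.distrib)

lemma column_degree_0: "column_degree 0 c = 0"
  by (simp add: column_degree_def)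

lemma column_degree_sum: "column_degree (\<Sum>x\<in>X. f x) c = (\<Sum>x\<in>X. column_degree (f x) c)"
  by (induction X rule: infinite_finite_induct) (simp_all add: column_degree_add column_degree_0)

lemma column_degree_single: "column_degree (single (x, y) 1) c = (if y = c then 1 else 0)"
proof -
  have "column_degree (single (x, y) 1) c = (\<Sum>\<rho>\<in>UNIV. if \<rho> = x then (if y = c then 1 else 0) else 0)"
    unfolding column_degree_def by (rule sum.cong) (auto simp: lookup_single when_def)
  then show ?thesis by simp
qed

lemma monomial_degree_column_degree:
  "monomial_degree t = (\<Sum>c\<in>UNIV. column_degree t c)" for t :: "('n::finite \<times> 'm::finite) monomial"
proof -
  have "monomial_degree t = (\<Sum>v\<in>UNIV \<times> UNIV. lookup t v)"
    using monomial_degree_sum[of UNIV t] by simp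
  also have "\<dots> = (\<Sum>\<rho>\<in>UNIV. \<Sum>c\<in>UNIV. lookup t (\<rho>, c))" by (simp add: sum.cartesian_product)
  also have "\<dots> = (\<Sum>c\<in>UNIV. \<Sum>\<rho>\<in>UNIV. lookup t (\<rho>, c))" by (rule sum.swap)
  finally show ?thesis by (simp add: column_degree_def)
qed

lemma graded_term_order_column_degree:
  fixes leq :: "('n::finite \<times> 'm::finite) monomial \<Rightarrow> _"
  assumes "term_order leq"
  shows "graded_term_order leq column_degree"
proof
  show "term_order leq" by fact
  fix s t u :: "('n \<times> 'm) monomial"
  assume st: "column_degree s = column_degree t"
  show "column_degree (s + u) = column_degree (t + u)"
    using st by (intro ext) (simp add: column_degree_add)
  show "monomial_degree s = monomial_degree t"
    using st by (simp add: monomial_degree_column_degree)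
qed

lemma prod_var: "(\<Prod>p\<in>P. var (v p)) = (single (\<Sum>p\<in>P. single (v p) 1) 1 :: ('x, 'k::comm_ring_1) polynomial)"
  by (induction P rule: infinite_finite_induct) (simp_all add: var_def mult_single)

lemma list_minor_carrier:
  "mat (length xs) (length xs) (\<lambda>(p, q). var (xs ! p, ys ! q)) \<in> carrier_mat (length xs) (length xs)"
  by simp

lemma keys_list_minor:
  assumes "s \<in> keys (list_minor xs ys :: ('n \<times> 'm, 'k::field) polynomial)"
  shows "\<exists>p. p permutes {0..<length xs} \<and> s = (\<Sum>i<length xs. single (xs ! i, ys ! (p i)) 1)"
proof -
  let ?n = "length xs"
  let ?t = "\<lambda>p. \<Sum>i<?n. single (xs ! i, ys ! (p i)) 1 :: ('n \<times> 'm) monomial"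
  have "list_minor xs ys = (\<Sum>p\<in>{p. p permutes {0..<?n}}. of_int (sign p) * (single (?t p) 1 :: ('n \<times> 'm, 'k) polynomial))"
    unfolding list_minor_def det_def'[OF list_minor_carrier]
  proof (rule sum.cong[OF refl])
    fix p assume "p \<in> {p. p permutes {0..<?n}}"
    then have p: "p permutes {0..<?n}" by simp
    have "(\<Prod>i=0..<?n. mat ?n ?n (\<lambda>(p, q). var (xs ! p, ys ! q)) $$ (i, p i))
        = (\<Prod>i\<in>{..<?n}. var (xs ! i, ys ! (p i)) :: ('n \<times> 'm, 'k) polynomial)"
    proof (rule prod.cong)
      fix i assume "i \<in> {..<?n}"
      then have "i < ?n" "p i < ?n" using permutes_in_image[OF p, of i] by simp_all
      then show "mat ?n ?n (\<lambda>(p, q). var (xs ! p, ys ! q)) $$ (i, p i) = (var (xs ! i, ys ! (p i)) :: ('n \<times> 'm, 'k) polynomial)"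
        by simp
    qed (rule atLeast0LessThan)
    then show "of_int (sign p) * (\<Prod>i=0..<?n. mat ?n ?n (\<lambda>(p, q). var (xs ! p, ys ! q)) $$ (i, p i))
        = of_int (sign p) * (single (?t p) 1 :: ('n \<times> 'm, 'k) polynomial)"
      by (simp add: prod_var)
  qed
  then have "(\<Sum>p\<in>{p. p permutes {0..<?n}}. lookup (of_int (sign p) * (single (?t p) 1 :: ('n \<times> 'm, 'k) polynomial)) s) \<noteq> 0"
    using assms by (simp add: in_keys_iff lookup_sum)
  then obtain p where p: "p \<in> {p. p permutes {0..<?n}}"
    "lookup (of_int (sign p) * (single (?t p) 1 :: ('n \<times> 'm, 'k) polynomial)) s \<noteq> 0"
    by (rule sum.not_neutral_contains_not_neutral)
  let ?X = "single (?t p) 1 :: ('n \<times> 'm, 'k) polynomial"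
  have "of_int (sign p) * ?X = ?X \<or> of_int (sign p) * ?X = - ?X" by (simp add: sign_def)
  then have "lookup ?X s \<noteq> 0" using p(2) by fastforce
  then have "s = ?t p" by (simp add: lookup_single when_def split: if_splits)
  then show ?thesis using p(1) by blast
qed

text \<open>
  Each term of a determinant takes one entry from every column.
\<close>
lemma column_degree_list_minor:
  fixes xs :: "'n::finite list" and ys :: "'m list"
  assumes "s \<in> keys (list_minor xs ys :: ('n \<times> 'm, 'k::field) polynomial)"
  shows "column_degree s = column_degree (diag_mono xs ys)"
proof
  fix c
  obtain p where p: "p permutes {0..<length xs}"
    and s: "s = (\<Sum>i<length xs. single (xs ! i, ys ! (p i)) 1)"
    using keys_list_minor[OF assms] by blast
  have "column_degree s c = (\<Sum>i\<in>{0..<length xs}. if ys ! (p i) = c then 1 else 0)"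
    by (simp add: s column_degree_sum column_degree_single lessThan_atLeast0 del: One_nat_def)
  also have "\<dots> = (\<Sum>i\<in>{0..<length xs}. if ys ! i = c then 1 else 0)"
    using sum.permute[OF p, of "\<lambda>i. if ys ! i = c then 1 else (0::nat)"] by (simp add: o_def)
  also have "\<dots> = column_degree (diag_mono xs ys) c"
    by (simp add: diag_mono_def column_degree_sum column_degree_single lessThan_atLeast0 del: One_nat_def)
  finally show "column_degree s c = column_degree (diag_mono xs ys) c" .
qed

definition drop_nth :: "nat \<Rightarrow> 'a list \<Rightarrow> 'a list" where
  "drop_nth i xs = take i xs @ drop (Suc i) xs"

lemma length_drop_nth: "i < length xs \<Longrightarrow> length (drop_nth i xs) = length xs - 1"
  by (simp add: drop_nth_def)

lemma nth_drop_nth: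
  "i < length xs \<Longrightarrow> k < length xs - 1 \<Longrightarrow> drop_nth i xs ! k = xs ! (if k < i then k else Suc k)"
  by (auto simp: drop_nth_def nth_append min_def)

lemma list_minor_first_column:
  assumes "length xs = Suc n"
  shows "list_minor xs (y # ys) = (\<Sum>i<Suc n. var (xs ! i, y) * ((-1) ^ i * list_minor (drop_nth i xs) ys))"
proof -
  let ?A = "mat (length xs) (length xs) (\<lambda>(p, q). var (xs ! p, (y # ys) ! q))"
  have "list_minor xs (y # ys) = (\<Sum>i<length xs. ?A $$ (i, 0) * cofactor ?A i 0)"
    unfolding list_minor_def using assms by (intro laplace_expansion_column) simp_all
  also have "\<dots> = (\<Sum>i<Suc n. var (xs ! i, y) * ((-1) ^ i * list_minor (drop_nth i xs) ys))"
  proof (rule sum.cong)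
    show "{..<length xs} = {..<Suc n}" by (simp add: assms)
    fix i assume "i \<in> {..<Suc n}"
    then have i: "i < length xs" using assms by simp
    have md: "mat_delete ?A i 0 = mat (length (drop_nth i xs)) (length (drop_nth i xs)) (\<lambda>(p, q). var (drop_nth i xs ! p, ys ! q))"
      using i by (intro eq_matI) (auto simp: mat_delete_def length_drop_nth nth_drop_nth)
    have cof: "cofactor ?A i 0 = (-1) ^ i * list_minor (drop_nth i xs) ys"
      unfolding cofactor_def md list_minor_def by simp
    have e: "?A $$ (i, 0) = var (xs ! i, y)" using i assms by simp
    show "?A $$ (i, 0) * cofactor ?A i 0 = var (xs ! i, y) * ((-1) ^ i * list_minor (drop_nth i xs) ys)"
      by (simp only: cof e)
  qed
  finally show ?thesis .
qed

lemma list_minor_Nil: "list_minor [] ys = 1"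
  by (simp add: list_minor_def)

text \<open>
  Expanded along its first column, this becomes the linear syzygy between the minors with one row of
  \<open>xs\<close> removed.
\<close>
lemma list_minor_repeated_column:
  assumes "length xs = Suc (length ys)" "p < length ys"
  shows "list_minor xs (ys ! p # ys) = 0"
  unfolding list_minor_def
proof (rule det_identical_columns[OF list_minor_carrier, of 0 "Suc p"])
  let ?A = "mat (length xs) (length xs) (\<lambda>(i, j). var (xs ! i, (ys ! p # ys) ! j))"
  show "col ?A 0 = col ?A (Suc p)" using assms by (intro eq_vecI) simp_all
qed (use assms in simp_all)

lemma list_minor_two:
  "list_minor [x, x'] [y, y'] = var (x, y) * var (x', y') - var (x', y) * var (x, y')"
  by (simp add: list_minor_first_column[where n = 1] list_minor_first_column[where n = 0] list_minor_Nil
      drop_nth_def numeral_2_eq_2)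

lemma strict_sorted_list_minor:
  fixes xs :: "'n::{finite,linorder} list" and ys :: "'m::{finite,linorder} list"
  assumes "sorted_wrt (<) xs" "sorted_wrt (<) ys"
  shows "(minor (set xs) (set ys) :: ('n \<times> 'm, 'k::field) polynomial) = list_minor xs ys"
proof -
  have "sorted_list_of_set (set xs) = xs" "sorted_list_of_set (set ys) = ys" "card (set xs) = length xs"
    using assms by (simp_all add: strict_sorted_iff distinct_card sorted_list_of_set.idem_if_sorted_distinct)
  then show ?thesis by (simp add: minor_def list_minor_def)
qed

context graded_term_order
begin

lemma lead_monomial_max:
  fixes f :: "('x, 'k::field) polynomial"
  assumes "f \<noteq> 0"
  shows "lead_monomial leq f \<in> keys f \<and> (\<forall>s\<in>keys f. leq s (lead_monomial leq f))"
proof -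
  have "keys f \<noteq> {}" using assms by simp
  then obtain m where m: "m \<in> keys f" "\<And>s. s \<in> keys f \<Longrightarrow> leq s m"
    using exists_max[OF finite_keys] by blast
  have "lead_monomial leq f = m"
    unfolding lead_monomial_def
  proof (rule the_equality)
    fix u assume "u \<in> keys f \<and> (\<forall>s\<in>keys f. leq s u)"
    then show "u = m" using m leq_antisym by blast
  qed (use m in blast)
  then show ?thesis using m by blast
qed

lemma lead_term_monic:
  assumes f: "lead_term leq f = single t (1 :: 'k::field)"
  shows "lookup f t = 1 \<and> (\<forall>s\<in>keys f. leq s t)"
proof -
  have "lookup (lead_term leq f) t = 1" using f by simp
  then have l: "lead_monomial leq f = t" "lookup f t = 1"
    by (auto simp: lead_term_def lookup_single when_def split: if_splits)
  then have "f \<noteq> 0" by auto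
  from lead_monomial_max[OF this] show ?thesis using l by simp
qed

end

text \<open>
  The grading is by columns: it refines the total degree, and minors are homogeneous for it.
\<close>
locale diagonal_term_order = graded_term_order leq column_degree
  for leq :: "('n::{finite,linorder} \<times> 'm::{finite,linorder}) monomial \<Rightarrow> ('n \<times> 'm) monomial \<Rightarrow> bool" +
  fixes k :: "'k::field itself"
  assumes diagonal: "diagonal_order k leq"
begin

lemma lead_term_list_minor:
  assumes "sorted_wrt (<) xs" "sorted_wrt (<) ys" "length xs = length ys"
  shows "lead_term leq (list_minor xs ys :: ('n \<times> 'm, 'k) polynomial) = single (diag_mono xs ys) 1"
proof -
  have s: "sorted_list_of_set (set xs) = xs" "sorted_list_of_set (set ys) = ys"
    "card (set xs) = length xs" "card (set ys) = length ys"
    using assms by (simp_all add: strict_sorted_iff distinct_card sorted_list_of_set.idem_if_sorted_distinct)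
  have "lead_term leq (minor (set xs) (set ys) :: ('n \<times> 'm, 'k) polynomial)
      = (\<Prod>p<card (set xs). var (sorted_list_of_set (set xs) ! p, sorted_list_of_set (set ys) ! p))"
    using diagonal s assms(3) unfolding diagonal_order_def by simp
  then show ?thesis
    by (simp add: strict_sorted_list_minor[OF assms(1,2)] s prod_var diag_mono_def)
qed

lemma list_minor_lead:
  assumes "sorted_wrt (<) xs" "sorted_wrt (<) ys" "length xs = length ys"
  shows "lookup (list_minor xs ys :: ('n \<times> 'm, 'k) polynomial) (diag_mono xs ys) = 1"
    and "s \<in> keys (list_minor xs ys :: ('n \<times> 'm, 'k) polynomial) \<Longrightarrow> below s (diag_mono xs ys)"
  using lead_term_monic[OF lead_term_list_minor[OF assms]] column_degree_list_minor[of s xs ys, where 'k = 'k]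
  unfolding below_def by blast+

text \<open>
  The two monomials are the terms of a 2-minor. All comparisons of monomials below reduce to this one.
\<close>
lemma exchange:
  assumes "x < x'" "y < y'"
  shows "below (single (x, y') 1 + single (x', y) 1)
           (single (x, y) 1 + single (x', y') 1)"
    and "single (x, y') (1::nat) + single (x', y) 1
           \<noteq> single (x, y) 1 + single (x', y') 1"
proof -
  let ?a = "single (x, y') 1 + single (x', y) 1 :: ('n \<times> 'm) monomial"
  let ?d = "single (x, y) 1 + single (x', y') 1 :: ('n \<times> 'm) monomial"
  have "lookup ?a (x, y) \<noteq> lookup ?d (x, y)"
    using assms by (auto simp: Poly_Mapping.lookup_add lookup_single when_def)
  then show ne: "?a \<noteq> ?d" by (intro notI) simp
  have "(list_minor [x, x'] [y, y'] :: ('n \<times> 'm, 'k) polynomial) = single ?d 1 - single ?a 1"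
    by (simp add: list_minor_two var_def mult_single add.commute)
  then have "?a \<in> keys (list_minor [x, x'] [y, y'] :: ('n \<times> 'm, 'k) polynomial)"
    using ne by (simp add: in_keys_iff lookup_minus lookup_single when_def)
  then have "below ?a (diag_mono [x, x'] [y, y'])" using assms by (intro list_minor_lead(2)) simp_all
  also have "diag_mono [x, x'] [y, y'] = ?d" by (simp add: diag_mono_def lessThan_Suc add.commute numeral_2_eq_2)
  finally show "below ?a ?d" .
qed

end


section \<open>Groebner bases of minors\<close>

definition row_lists :: "nat \<Rightarrow> 'n::linorder list set" where
  "row_lists r = {xs. sorted_wrt (<) xs \<and> length xs = r}"

lemma row_lists_nth_less: "xs \<in> row_lists r \<Longrightarrow> i < j \<Longrightarrow> j < r \<Longrightarrow> xs ! i < xs ! j"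
  by (auto simp: row_lists_def sorted_wrt_iff_nth_less)

lemma row_lists_length: "xs \<in> row_lists r \<Longrightarrow> length xs = r"
  by (simp add: row_lists_def)

lemma row_listsI: "length xs = r \<Longrightarrow> (\<And>i j. i < j \<Longrightarrow> j < r \<Longrightarrow> xs ! i < xs ! j) \<Longrightarrow> xs \<in> row_lists r"
  by (auto simp: row_lists_def sorted_wrt_iff_nth_less)

lemma lookup_diag_mono:
  assumes ys: "distinct ys" "length xs = length ys" and p: "p < length ys"
  shows "lookup (diag_mono xs ys) (x, ys ! p) = (if xs ! p = x then 1 else 0)"
proof -
  have "lookup (diag_mono xs ys) (x, ys ! p) = (\<Sum>q<length ys. if q = p then (if xs ! p = x then 1 else 0) else 0)"
    unfolding diag_mono_def lookup_sum ys(2)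
    by (rule sum.cong) (use p ys(1) in \<open>auto simp: lookup_single when_def nth_eq_iff_index_eq\<close>)
  then show ?thesis using p by simp
qed

lemma lookup_diag_mono_0: "y \<notin> set ys \<Longrightarrow> length xs = length ys \<Longrightarrow> lookup (diag_mono xs ys) (x, y) = 0"
  unfolding diag_mono_def lookup_sum by (rule sum.neutral) (auto simp: lookup_single when_def)

lemma diag_mono_dvd_iff:
  assumes ys: "distinct ys" "length xs = length ys"
  shows "diag_mono xs ys \<preceq> t \<longleftrightarrow> (\<forall>p<length ys. 1 \<le> lookup t (xs ! p, ys ! p))"
proof
  assume "diag_mono xs ys \<preceq> t"
  then have le: "lookup (diag_mono xs ys) v \<le> lookup t v" for v unfolding mono_dvd_iff_lookup by blast
  show "\<forall>p<length ys. 1 \<le> lookup t (xs ! p, ys ! p)"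
  proof (intro allI impI)
    fix p assume "p < length ys"
    then show "1 \<le> lookup t (xs ! p, ys ! p)"
      using le[of "(xs ! p, ys ! p)"] lookup_diag_mono[OF ys, of p "xs ! p"] by simp
  qed
next
  assume t: "\<forall>p<length ys. 1 \<le> lookup t (xs ! p, ys ! p)"
  have "lookup (diag_mono xs ys) (x, y) \<le> lookup t (x, y)" for x y
  proof (cases "y \<in> set ys")
    case True
    then obtain p where p: "p < length ys" "y = ys ! p" by (metis in_set_conv_nth)
    then show ?thesis using lookup_diag_mono[OF ys p(1), of x] t by auto
  next
    case False
    then show ?thesis using lookup_diag_mono_0[OF False ys(2), of x] by simp
  qed
  then show "diag_mono xs ys \<preceq> t" by (auto simp: mono_dvd_iff_lookup)
qed

definition insert_nth :: "nat \<Rightarrow> 'a \<Rightarrow> 'a list \<Rightarrow> 'a list" where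
  "insert_nth p x xs = take p xs @ x # drop p xs"

lemma insert_nth_simps:
  assumes "p < length xs"
  shows "length (insert_nth p x xs) = Suc (length xs)"
    "drop_nth p (insert_nth p x xs) = xs"
    "drop_nth (Suc p) (insert_nth p x xs) = xs[p := x]"
  using assms by (simp_all add: insert_nth_def drop_nth_def upd_conv_take_nth_drop)

lemma nth_insert_nth:
  "p \<le> length xs \<Longrightarrow> i \<le> length xs \<Longrightarrow>
     insert_nth p x xs ! i = (if i < p then xs ! i else if i = p then x else xs ! (i - 1))"
  by (auto simp: insert_nth_def nth_append nth_Cons' min_def)

lemma insert_nth_row_list:
  assumes xs: "xs \<in> row_lists r" and p: "p < r" and x: "x < xs ! p" "p > 0 \<Longrightarrow> xs ! (p - 1) < x"
  shows "insert_nth p x xs \<in> row_lists (Suc r)"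
proof (rule row_listsI)
  have l: "length xs = r" by (rule row_lists_length[OF xs])
  show "length (insert_nth p x xs) = Suc r" using p l by (simp add: insert_nth_simps)
  fix i j assume ij: "i < j" "j < Suc r"
  have lt: "i' < j' \<Longrightarrow> j' < r \<Longrightarrow> xs ! i' < xs ! j'" for i' j' by (rule row_lists_nth_less[OF xs])
  have lo: "xs ! i < x" if "i < p"
  proof (cases "i = p - 1")
    case False
    then have "xs ! i < xs ! (p - 1)" using lt[of i "p - 1"] that p by simp
    then show ?thesis using x(2) that by simp
  qed (use x(2) that in simp)
  have hi: "x < xs ! (j - 1)" if "p < j"
  proof (cases "j - 1 = p")
    case False
    then have "xs ! p < xs ! (j - 1)" using lt[of p "j - 1"] that ij by simp
    then show ?thesis using x(1) by simp
  qed (use x(1) in simp)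
  show "insert_nth p x xs ! i < insert_nth p x xs ! j"
    using ij p l lo hi lt[of i j] lt[of i "j - 1"] lt[of "i - 1" "j - 1"]
    by (auto simp: nth_insert_nth)
qed

lemma drop_nth_row_list: "xs \<in> row_lists (Suc r) \<Longrightarrow> i < Suc r \<Longrightarrow> drop_nth i xs \<in> row_lists r"
proof (rule row_listsI)
  assume xs: "xs \<in> row_lists (Suc r)" and i: "i < Suc r"
  have l: "length xs = Suc r" by (rule row_lists_length[OF xs])
  then show "length (drop_nth i xs) = r" using i by (simp add: length_drop_nth)
  fix a b assume "a < b" "b < r"
  then show "drop_nth i xs ! a < drop_nth i xs ! b"
    using i l row_lists_nth_less[OF xs] by (auto simp: nth_drop_nth)
qed

lemma update_row_list:
  assumes xs: "xs \<in> row_lists r" and p: "p < r" and x: "x < xs ! p" "p > 0 \<Longrightarrow> xs ! (p - 1) < x"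
  shows "xs[p := x] \<in> row_lists r"
  using drop_nth_row_list[OF insert_nth_row_list[OF assms], of "Suc p"] p row_lists_length[OF xs]
  by (simp add: insert_nth_simps)

text \<open>
  Removing two neighbouring entries of \<open>A\<close> gives lists that differ in a single place.
\<close>
lemma diag_mono_drop_nth:
  assumes A: "length A = Suc (length ys)" and j: "j < length ys"
  shows "\<exists>R. diag_mono (drop_nth j A) ys = R + single (A ! Suc j, ys ! j) 1 \<and>
             diag_mono (drop_nth (Suc j) A) ys = R + single (A ! j, ys ! j) 1"
proof -
  let ?f = "\<lambda>j k. single (drop_nth j A ! k, ys ! k) (1::nat)"
  let ?K = "{..<length ys} - {j}"
  have d: "diag_mono (drop_nth i A) ys = (\<Sum>k\<in>?K. ?f i k) + ?f i j" if "i < Suc (length ys)" for i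
  proof -
    have "length (drop_nth i A) = length ys" using that A by (simp add: length_drop_nth)
    then show ?thesis unfolding diag_mono_def
      using j by (subst sum.remove[of _ j]) (auto simp: add.commute)
  qed
  have "(\<Sum>k\<in>?K. ?f (Suc j) k) = (\<Sum>k\<in>?K. ?f j k)"
    using A j by (intro sum.cong) (auto simp: nth_drop_nth)
  moreover have "drop_nth j A ! j = A ! Suc j" "drop_nth (Suc j) A ! j = A ! j"
    using A j by (simp_all add: nth_drop_nth)
  ultimately show ?thesis using d[of j] d[of "Suc j"] j by (intro exI[of _ "\<Sum>k\<in>?K. ?f j k"]) simp
qed

lemma alternating_sum_neighbours:
  fixes v g :: "nat \<Rightarrow> 'a::comm_ring_1"
  assumes p: "p < r" and zero: "(\<Sum>j<Suc r. v j * ((-1) ^ j * g j)) = 0"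
  shows "(-1) ^ p * (v p * g p - v (Suc p) * g (Suc p))
       = - (\<Sum>j\<in>{..<Suc r} - {p, Suc p}. v j * ((-1) ^ j * g j))"
proof -
  let ?F = "\<lambda>j. v j * ((-1) ^ j * g j)"
  let ?R = "\<Sum>j\<in>{..<Suc r} - {p, Suc p}. ?F j"
  have split: "(\<Sum>j<Suc r. ?F j) = ?R + (\<Sum>j\<in>{p, Suc p}. ?F j)"
    using p by (intro sum.subset_diff) auto
  have pair: "(\<Sum>j\<in>{p, Suc p}. ?F j) = ?F p + ?F (Suc p)" by (simp del: power_Suc)
  have alg: "a * (e * b) + c * (- e * d) = e * (a * b - c * d)" for a b c d e :: 'a
    by (simp add: algebra_simps)
  have "?R + (?F p + ?F (Suc p)) = 0"
    unfolding pair[symmetric] by (rule trans[OF split[symmetric] zero])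
  then have m: "- ?R = v p * ((-1) ^ p * g p) + v (Suc p) * (- ((-1) ^ p) * g (Suc p))"
    by (intro minus_unique) simp
  show ?thesis unfolding m by (rule alg[symmetric])
qed

text \<open>
  Blocks of columns whose diagonals involve pairwise disjoint sets of variables.
\<close>
locale clique_family = diagonal_term_order leq k
  for leq :: "('n::{finite,linorder} \<times> 'm::{finite,linorder}) monomial \<Rightarrow> ('n \<times> 'm) monomial \<Rightarrow> bool"
    and k :: "'k::field itself" +
  fixes r :: nat and B :: "'m list set"
  assumes B_rows: "B \<subseteq> row_lists r"
    and cross: "ys \<in> B \<Longrightarrow> ys' \<in> B \<Longrightarrow> ys \<noteq> ys' \<Longrightarrow> xs \<in> row_lists r \<Longrightarrow> xs' \<in> row_lists r \<Longrightarrow>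
      keys (diag_mono (xs :: 'n list) ys) \<inter> keys (diag_mono xs' ys') = {}"
begin

lemma B_facts: "ys \<in> B \<Longrightarrow> sorted_wrt (<) ys \<and> distinct ys \<and> length ys = r"
  using B_rows by (auto simp: row_lists_def strict_sorted_iff)

sublocale marked_family leq column_degree "row_lists r \<times> B"
  "case_prod (list_minor :: 'n list \<Rightarrow> 'm list \<Rightarrow> ('n \<times> 'm, 'k) polynomial)" "case_prod diag_mono"
proof
  fix q :: "'n list \<times> 'm list" and s
  assume q: "q \<in> row_lists r \<times> B"
  then obtain xs ys where [simp]: "q = (xs, ys)" and xs: "xs \<in> row_lists r" and ys: "ys \<in> B" by auto
  have h: "sorted_wrt (<) xs" "sorted_wrt (<) ys" "length xs = length ys"
    using xs B_facts[OF ys] by (simp_all add: row_lists_def)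
  show "lookup (case_prod list_minor q :: ('n \<times> 'm, 'k) polynomial) (case_prod diag_mono q) = 1"
    using list_minor_lead(1)[OF h] by simp
  show "s \<in> keys (case_prod list_minor q :: ('n \<times> 'm, 'k) polynomial) \<Longrightarrow>
      below s (case_prod diag_mono q)"
    using list_minor_lead(2)[OF h] by simp
qed

lemma strictly_below_trans: "s \<in> strictly_below t \<Longrightarrow> t \<in> strictly_below u \<Longrightarrow> s \<in> strictly_below u"
  unfolding strictly_below_def using below_trans[of s t u] below_antisym[of u t] by auto

lemma gspan_sign: "f \<in> gspan W \<Longrightarrow> (-1) ^ j * f \<in> gspan W"
  using gspan_uminus[of f W] by (cases "even j") simp_all

lemma gspan_sign_iff: "(-1) ^ j * f \<in> gspan W \<Longrightarrow> f \<in> gspan W"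
  using gspan_sign[of "(-1) ^ j * f" W j] by (simp flip: mult.assoc power_add)

text \<open>
  \<open>T j\<close> is the leading monomial of the \<open>j\<close>-th product in the expansion of the determinant with rows \<open>A\<close>, the
  columns \<open>ys\<close> and a second copy of the column \<open>ys ! p\<close>. Neighbouring products differ by an exchange in a
  2-minor on the columns \<open>ys ! p\<close> and \<open>ys ! j\<close>, so \<open>T\<close> increases up to \<open>j = p\<close>, where two
  leading monomials coincide, and decreases afterwards.
\<close>
lemma expansion_lead:
  assumes A: "A \<in> row_lists (Suc r)" and ys: "ys \<in> B" and p: "p < r"
  defines "T \<equiv> \<lambda>j. single (A ! j, ys ! p) 1 + diag_mono (drop_nth j A) ys"
  shows "T (Suc p) = T p"
    and "j < Suc r \<Longrightarrow> j \<noteq> p \<Longrightarrow> j \<noteq> Suc p \<Longrightarrow> T j \<in> strictly_below (T p)"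
proof -
  have ly: "length ys = r" using B_facts[OF ys] by simp
  have yl: "ys ! i < ys ! j" if "i < j" "j < r" for i j
    using row_lists_nth_less[OF _ that] ys B_rows by blast
  have la: "length A = Suc (length ys)" using row_lists_length[OF A] ly by simp
  let ?s = "\<lambda>x y. single (x, y) 1 :: ('n \<times> 'm) monomial"
  have T2: "\<exists>R. T j = R + (?s (A ! j) (ys ! p) + ?s (A ! Suc j) (ys ! j)) \<and>
      T (Suc j) = R + (?s (A ! j) (ys ! j) + ?s (A ! Suc j) (ys ! p))" if j: "j < r" for j
  proof -
    obtain R where R: "diag_mono (drop_nth j A) ys = R + ?s (A ! Suc j) (ys ! j)"
      "diag_mono (drop_nth (Suc j) A) ys = R + ?s (A ! j) (ys ! j)"
      using diag_mono_drop_nth[OF la, of j] j ly by blast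
    show ?thesis unfolding T_def R by (intro exI[of _ R]) (simp add: ac_simps)
  qed
  show Tp: "T (Suc p) = T p" using T2[OF p] by (auto simp: add.commute)
  have up: "T j \<in> strictly_below (T (Suc j))" if j: "j < p" for j
  proof -
    obtain R where R: "T j = R + (?s (A ! j) (ys ! p) + ?s (A ! Suc j) (ys ! j))"
      "T (Suc j) = R + (?s (A ! j) (ys ! j) + ?s (A ! Suc j) (ys ! p))" using T2[of j] j p by auto
    have "?s (A ! j) (ys ! p) + ?s (A ! Suc j) (ys ! j) \<in> strictly_below (?s (A ! j) (ys ! j) + ?s (A ! Suc j) (ys ! p))"
      unfolding strictly_below_def using exchange[of "A ! j" "A ! Suc j" "ys ! j" "ys ! p"] j p
        row_lists_nth_less[OF A, of j "Suc j"] yl[of j p] by simp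
    then show ?thesis unfolding R by (rule strictly_below_add)
  qed
  have dn: "T (Suc j) \<in> strictly_below (T j)" if j: "p < j" "j < r" for j
  proof -
    obtain R where R: "T j = R + (?s (A ! j) (ys ! p) + ?s (A ! Suc j) (ys ! j))"
      "T (Suc j) = R + (?s (A ! j) (ys ! j) + ?s (A ! Suc j) (ys ! p))" using T2[of j] j by auto
    have "?s (A ! j) (ys ! j) + ?s (A ! Suc j) (ys ! p) \<in> strictly_below (?s (A ! j) (ys ! p) + ?s (A ! Suc j) (ys ! j))"
      unfolding strictly_below_def using exchange[of "A ! j" "A ! Suc j" "ys ! p" "ys ! j"] j
        row_lists_nth_less[OF A, of j "Suc j"] yl[of p j] by simp
    then show ?thesis unfolding R by (rule strictly_below_add)
  qed
  have lower: "T (p - Suc i) \<in> strictly_below (T p)" if "Suc i \<le> p" for i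
    using that
  proof (induction i)
    case 0
    then show ?case using up[of "p - 1"] by simp
  next
    case (Suc i)
    then have "T (p - Suc (Suc i)) \<in> strictly_below (T (p - Suc i))"
      using up[of "p - Suc (Suc i)"] by (simp add: Suc_diff_Suc)
    moreover have "T (p - Suc i) \<in> strictly_below (T p)" using Suc by simp
    ultimately show ?case by (rule strictly_below_trans)
  qed
  have upper: "T (Suc (Suc p) + i) \<in> strictly_below (T p)" if "Suc (Suc p) + i < Suc r" for i
    using that
  proof (induction i)
    case 0
    then show ?case using dn[of "Suc p"] Tp by simp
  next
    case (Suc i)
    then have "T (Suc (Suc p) + Suc i) \<in> strictly_below (T (Suc (Suc p) + i))"
      using dn[of "Suc (Suc p) + i"] by simp
    moreover have "T (Suc (Suc p) + i) \<in> strictly_below (T p)" using Suc by simp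
    ultimately show ?case by (rule strictly_below_trans)
  qed
  assume j: "j < Suc r" "j \<noteq> p" "j \<noteq> Suc p"
  show "T j \<in> strictly_below (T p)"
  proof (cases "j < p")
    case True
    then show ?thesis using lower[of "p - Suc j"] by (simp add: Suc_diff_Suc)
  next
    case False
    define i where "i = j - Suc (Suc p)"
    have ji: "j = Suc (Suc p) + i" using False j by (simp add: i_def)
    show ?thesis using upper[of i] j(1) unfolding ji by blast
  qed
qed

text \<open>
  The expansion along the doubled column \<open>ys ! p\<close> vanishes. Its two largest products form the S-polynomial,
  and \<open>expansion_lead\<close> puts the others below.
\<close>
lemma spair_linear:
  assumes xs: "xs \<in> row_lists r" and ys: "ys \<in> B" and p: "p < r"
    and x: "x < xs ! p" "p > 0 \<Longrightarrow> xs ! (p - 1) < x"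
  shows "spair (single (x, ys ! p) 1 + diag_mono xs ys) (xs, ys) (xs[p := x], ys)"
proof -
  let ?A = "insert_nth p x xs"
  have lx: "length xs = r" by (rule row_lists_length[OF xs])
  have ly: "length ys = r" using B_facts[OF ys] by simp
  have A: "?A \<in> row_lists (Suc r)" by (rule insert_nth_row_list[OF xs p x])
  have drop: "drop_nth p ?A = xs" "drop_nth (Suc p) ?A = xs[p := x]"
    using p lx by (simp_all add: insert_nth_simps)
  have nth: "?A ! p = x" using p lx by (simp add: nth_insert_nth)
  define T where "T j = single (?A ! j, ys ! p) 1 + diag_mono (drop_nth j ?A) ys" for j
  let ?g = "\<lambda>j. list_minor (drop_nth j ?A) ys :: ('n \<times> 'm, 'k) polynomial"
  let ?v = "\<lambda>j. var (?A ! j, ys ! p) :: ('n \<times> 'm, 'k) polynomial"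
  let ?F = "\<lambda>j. ?v j * ((-1) ^ j * ?g j)"
  have Tp: "T (Suc p) = T p" unfolding T_def by (rule expansion_lead(1)[OF A ys p])
  have low: "?F j \<in> gspan (strictly_below (T p))" if j: "j \<in> {..<Suc r} - {p, Suc p}" for j
  proof -
    have "T j \<in> strictly_below (T p)"
      unfolding T_def using j by (intro expansion_lead(2)[OF A ys p]) auto
    moreover have "(drop_nth j ?A, ys) \<in> row_lists r \<times> B"
      using drop_nth_row_list[OF A, of j] j ys by simp
    ultimately have "?v j * ?g j \<in> gspan (strictly_below (T p))"
      using gspan_gen[of "(drop_nth j ?A, ys)" "single (?A ! j, ys ! p) 1" "strictly_below (T p)" 1]
      by (simp add: T_def var_def)
    from gspan_sign[OF this, of j] show ?thesis by (simp only: mult.left_commute)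
  qed
  have "(\<Sum>j<Suc r. ?F j) = list_minor ?A (ys ! p # ys)"
    using p lx by (intro list_minor_first_column[symmetric]) (simp add: insert_nth_simps)
  also have "list_minor ?A (ys ! p # ys) = (0 :: ('n \<times> 'm, 'k) polynomial)"
    using p ly lx by (intro list_minor_repeated_column) (simp_all add: insert_nth_simps)
  finally have zero: "(\<Sum>j<Suc r. ?F j) = 0" .
  have eq: "(-1) ^ p * (?v p * ?g p - ?v (Suc p) * ?g (Suc p)) = - (\<Sum>j\<in>{..<Suc r} - {p, Suc p}. ?F j)"
    by (rule alternating_sum_neighbours[OF p zero])
  have "- (\<Sum>j\<in>{..<Suc r} - {p, Suc p}. ?F j) \<in> gspan (strictly_below (T p))"
    by (intro gspan_uminus gspan_sum low)
  then have "(-1) ^ p * (?v p * ?g p - ?v (Suc p) * ?g (Suc p)) \<in> gspan (strictly_below (T p))"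
    unfolding eq .
  then have 1: "?v p * ?g p - ?v (Suc p) * ?g (Suc p) \<in> gspan (strictly_below (T p))"
    by (rule gspan_sign_iff)
  have t1: "T p - diag_mono xs ys = single (?A ! p, ys ! p) 1"
    by (simp add: T_def drop)
  have t2: "T p - diag_mono (xs[p := x]) ys = single (?A ! Suc p, ys ! p) 1"
    unfolding Tp[symmetric] by (simp add: T_def drop)
  have "spair (T p) (xs, ys) (xs[p := x], ys)"
    unfolding spair_def prod.case t1 t2 using 1 unfolding drop var_def .
  then show ?thesis by (simp add: T_def drop nth)
qed

text \<open>
  Replace the entries of \<open>xs\<close> by those of \<open>zs\<close> from left to right. The intermediate lists remain sorted,
  and their diagonals use only variables from the two given diagonals, so they divide \<open>t\<close> as well.
\<close>
lemma spair_descend: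
  assumes xs: "xs \<in> row_lists r" and zs: "zs \<in> row_lists r" and ys: "ys \<in> B"
    and le: "\<And>p. p < r \<Longrightarrow> zs ! p \<le> xs ! p"
    and dvd: "diag_mono xs ys \<preceq> t" "diag_mono zs ys \<preceq> t"
  shows "spair t (xs, ys) (zs, ys)"
proof -
  have l: "length xs = r" "length zs = r" "length ys = r" "distinct ys"
    using row_lists_length[OF xs] row_lists_length[OF zs] B_facts[OF ys] by simp_all
  define w where "w j = take j zs @ drop j xs" for j
  have wn: "w j ! i = (if i < j then zs ! i else xs ! i)" if "j \<le> r" "i < r" for i j
    using that l by (auto simp: w_def nth_append min_def)
  have wl: "length (w j) = r" if "j \<le> r" for j using that l by (simp add: w_def)
  have wr: "w j \<in> row_lists r" if "j \<le> r" for j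
  proof (rule row_listsI[OF wl[OF that]])
    fix a b assume ab: "a < b" "b < r"
    have "zs ! a < zs ! b" "xs ! a < xs ! b" using row_lists_nth_less ab xs zs by blast+
    then show "w j ! a < w j ! b"
      using wn[OF that, of a] wn[OF that, of b] ab le[of a] le[of b] by auto
  qed
  have dv: "1 \<le> lookup t (xs ! i, ys ! i)" "1 \<le> lookup t (zs ! i, ys ! i)" if "i < r" for i
    using that dvd l by (auto simp: diag_mono_dvd_iff)
  have wd: "diag_mono (w j) ys \<preceq> t" if "j \<le> r" for j
    using wn[OF that] wl[OF that] l dv by (subst diag_mono_dvd_iff) auto
  have "spair t (xs, ys) (w j, ys)" if "j \<le> r" for j
    using that
  proof (induction j)
    case 0
    then show ?case by (simp add: w_def spair_refl)
  next
    case (Suc j)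
    then have j: "j < r" "j \<le> r" by auto
    have upd: "w (Suc j) = (w j)[j := zs ! j]"
      by (rule nth_equalityI) (use j l wn wl in \<open>auto simp: nth_list_update less_Suc_eq\<close>)
    have "spair t (w j, ys) (w (Suc j), ys)"
    proof (cases "zs ! j = xs ! j")
      case True
      then have "w (Suc j) = w j" unfolding upd using wn[OF j(2,1)] by (simp add: list_update_same_conv wl j)
      then show ?thesis by (simp add: spair_refl)
    next
      case False
      let ?T = "single (zs ! j, ys ! j) 1 + diag_mono (w j) ys"
      have lt: "zs ! j < w j ! j" using False le[OF j(1)] wn[OF j(2,1)] by simp
      have prev: "w j ! (j - 1) < zs ! j" if "j > 0"
        using wn[OF j(2), of "j - 1"] that j row_lists_nth_less[OF zs, of "j - 1" j] by simp
      have sp: "spair ?T (w j, ys) (w (Suc j), ys)"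
        unfolding upd by (rule spair_linear[OF wr[OF j(2)] ys j(1) lt prev])
      have z0: "lookup (diag_mono (w j) ys) (zs ! j, ys ! j) = 0"
        using lookup_diag_mono[of ys "w j" j "zs ! j"] l wl[OF j(2)] j lt by auto
      have Tt: "?T \<preceq> t"
        unfolding mono_dvd_iff_lookup
      proof
        fix v
        have "lookup (diag_mono (w j) ys) v \<le> lookup t v" using wd[OF j(2)] unfolding mono_dvd_iff_lookup by blast
        then show "lookup ?T v \<le> lookup t v"
          using z0 dv(2)[OF j(1)] by (cases "v = (zs ! j, ys ! j)") (auto simp: Poly_Mapping.lookup_add lookup_single when_def)
      qed
      have "diag_mono (w (Suc j)) ys \<preceq> ?T"
      proof (subst diag_mono_dvd_iff)
        show "distinct ys" "length (w (Suc j)) = length ys" using l wl[OF Suc.prems] by simp_all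
        show "\<forall>i<length ys. 1 \<le> lookup ?T (w (Suc j) ! i, ys ! i)"
        proof (intro allI impI)
          fix i assume "i < length ys"
          then have i: "i < r" using l by simp
          show "1 \<le> lookup ?T (w (Suc j) ! i, ys ! i)"
          proof (cases "i = j")
            case True
            then show ?thesis using wn[OF Suc.prems i] by (simp add: Poly_Mapping.lookup_add)
          next
            case False
            then have "w (Suc j) ! i = w j ! i" using wn[OF Suc.prems i] wn[OF j(2) i] by auto
            then show ?thesis using lookup_diag_mono[of ys "w j" i "w j ! i"] l wl[OF j(2)] i
              by (simp add: Poly_Mapping.lookup_add)
          qed
        qed
      qed
      then show ?thesis using spair_shift[OF sp _ _ Tt] by simp
    qed
    then show ?case using Suc.IH[OF j(2)] spair_trans by blast
  qed
  from this[of r] show ?thesis using l by (simp add: w_def)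
qed

text \<open>
  Both lists of rows descend to their componentwise minimum.
\<close>
lemma spair_same_columns:
  assumes xs: "xs \<in> row_lists r" and xs': "xs' \<in> row_lists r" and ys: "ys \<in> B"
    and dvd: "diag_mono xs ys \<preceq> t" "diag_mono xs' ys \<preceq> t"
  shows "spair t (xs, ys) (xs', ys)"
proof -
  have l: "length xs = r" "length xs' = r" "length ys = r" "distinct ys"
    using row_lists_length[OF xs] row_lists_length[OF xs'] B_facts[OF ys] by simp_all
  define z where "z = map (\<lambda>p. min (xs ! p) (xs' ! p)) [0..<r]"
  have zn: "z ! p = min (xs ! p) (xs' ! p)" if "p < r" for p using that by (simp add: z_def)
  have zl: "length z = r" by (simp add: z_def)
  have zr: "z \<in> row_lists r"
  proof (rule row_listsI[OF zl])
    fix i j assume ij: "i < j" "j < r"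
    then have "xs ! i < xs ! j" "xs' ! i < xs' ! j" using row_lists_nth_less xs xs' by blast+
    then show "z ! i < z ! j" using ij zn[of i] zn[of j] by (auto simp: min_def)
  qed
  have dv: "1 \<le> lookup t (xs ! i, ys ! i)" "1 \<le> lookup t (xs' ! i, ys ! i)" if "i < r" for i
    using that dvd l by (auto simp: diag_mono_dvd_iff)
  have zd: "diag_mono z ys \<preceq> t"
    using zl l dv zn by (subst diag_mono_dvd_iff) (auto simp: min_def)
  have "spair t (xs, ys) (z, ys)" "spair t (xs', ys) (z, ys)"
    using zn by (intro spair_descend xs xs' zr ys dvd zd; simp)+
  then show ?thesis using spair_sym spair_trans by blast
qed

theorem minors_groebner:
  assumes f: "f \<in> ideal_generated {list_minor xs ys :: ('n \<times> 'm, 'k) polynomial | xs ys. xs \<in> row_lists r \<and> ys \<in> B}"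
    and t: "t \<in> keys f" "\<And>s. s \<in> keys f \<Longrightarrow> leq s t"
  shows "\<exists>xs\<in>row_lists r. \<exists>ys\<in>B. diag_mono xs ys \<preceq> t"
proof -
  have eq: "{list_minor xs ys :: ('n \<times> 'm, 'k) polynomial | xs ys. xs \<in> row_lists r \<and> ys \<in> B}
      = case_prod list_minor ` (row_lists r \<times> B)" by auto
  have "\<exists>q\<in>row_lists r \<times> B. case_prod diag_mono q \<preceq> t"
  proof (rule buchberger[OF _ f[unfolded eq] t])
    fix q q' :: "'n list \<times> 'm list" and s
    assume q: "q \<in> row_lists r \<times> B" "q' \<in> row_lists r \<times> B"
      and dvd: "case_prod diag_mono q \<preceq> s" "case_prod diag_mono q' \<preceq> s"
    obtain xs ys xs' ys' where [simp]: "q = (xs, ys)" "q' = (xs', ys')" by fastforce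
    show "spair s q q'"
    proof (cases "ys = ys'")
      case True
      then show ?thesis using q dvd spair_same_columns[of xs xs' ys s] by simp
    next
      case False
      then have "keys (diag_mono xs ys) \<inter> keys (diag_mono xs' ys') = {}"
        using q by (intro cross) auto
      then show ?thesis using q dvd by (intro spair_coprime) auto
    qed
  qed
  then show ?thesis by auto
qed

end


section \<open>Resolution of the ideal of diagonals\<close>

text \<open>
  All variables that occur in diagonals of the block \<open>ys\<close>.
\<close>
definition band_vars :: "nat \<Rightarrow> 'm list \<Rightarrow> ('n::linorder \<times> 'm) set" where
  "band_vars r ys = {(xs ! p, ys ! p) | xs p. xs \<in> row_lists r \<and> p < r}"

definition diag_ideal :: "nat \<Rightarrow> 'm list set \<Rightarrow> ('n::linorder \<times> 'm) monomial set" where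
  "diag_ideal r B = {t. \<exists>xs\<in>row_lists r. \<exists>ys\<in>B. diag_mono xs ys \<preceq> t}"

lemma upclosed_diag_ideal: "upclosed (diag_ideal r B)"
  unfolding upclosed_def diag_ideal_def using mono_dvd_trans[OF _ mono_dvd_add(1)] by blast

lemma keys_diag_mono:
  assumes "xs \<in> row_lists r" shows "keys (diag_mono xs ys) \<subseteq> band_vars r ys"
proof
  fix v assume "v \<in> keys (diag_mono xs ys)"
  then have "(\<Sum>p<length xs. lookup (single (xs ! p, ys ! p) (1::nat)) v) \<noteq> 0"
    by (simp add: in_keys_iff diag_mono_def lookup_sum del: sum_eq_0_iff)
  then obtain p where "p \<in> {..<length xs}" "lookup (single (xs ! p, ys ! p) (1::nat)) v \<noteq> 0"
    by (rule sum.not_neutral_contains_not_neutral)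
  then have "p < r" "v = (xs ! p, ys ! p)"
    using row_lists_length[OF assms] by (auto simp: lookup_single when_def split: if_splits)
  then show "v \<in> band_vars r ys" using assms unfolding band_vars_def by blast
qed

lemma monomial_degree_single: "monomial_degree (single v c) = c"
  by (simp add: monomial_degree_def)

lemma monomial_degree_sum_fun: "monomial_degree (\<Sum>x\<in>X. f x) = (\<Sum>x\<in>X. monomial_degree (f x))"
  by (induction X rule: infinite_finite_induct) (simp_all add: monomial_degree_add)

lemma monomial_degree_diag_mono: "monomial_degree (diag_mono xs ys) = length xs"
  by (simp add: diag_mono_def monomial_degree_sum_fun monomial_degree_single del: One_nat_def)

text \<open>
  Colon ideals by monomials in the variables \<open>W\<close> do not change \<open>U\<close>.
\<close>
definition independent_of :: "'x set \<Rightarrow> 'x monomial set \<Rightarrow> bool" where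
  "independent_of W U \<longleftrightarrow> (\<forall>t w. keys w \<subseteq> W \<longrightarrow> t + w \<in> U \<longrightarrow> t \<in> U)"

lemma independent_of_diag_ideal:
  assumes "\<And>ys'. ys' \<in> B \<Longrightarrow> band_vars r ys' \<inter> W = {}"
  shows "independent_of W (diag_ideal r B)"
  unfolding independent_of_def
proof (intro allI impI)
  fix t w assume w: "keys w \<subseteq> W" and tw: "t + w \<in> diag_ideal r B"
  then obtain xs ys where xy: "xs \<in> row_lists r" "ys \<in> B" "diag_mono xs ys \<preceq> t + w"
    unfolding diag_ideal_def by blast
  have "lookup (diag_mono xs ys) v \<le> lookup t v" for v
  proof (cases "v \<in> band_vars r ys")
    case True
    then have "lookup w v = 0" using assms[OF xy(2)] w by (auto simp: in_keys_iff)
    moreover have "lookup (diag_mono xs ys) v \<le> lookup (t + w) v" using xy(3) unfolding mono_dvd_iff_lookup by blast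
    ultimately show ?thesis by (simp add: Poly_Mapping.lookup_add)
  next
    case False
    then have "v \<notin> keys (diag_mono xs ys)" using keys_diag_mono[OF xy(1)] by blast
    then show ?thesis by (simp add: in_keys_iff)
  qed
  then show "t \<in> diag_ideal r B" using xy unfolding diag_ideal_def mono_dvd_iff_lookup by blast
qed

lemma single_dvd_iff: "single v 1 \<preceq> t \<longleftrightarrow> 1 \<le> lookup t v"
  unfolding mono_dvd_iff_lookup
proof
  assume "\<forall>u. lookup (single v 1) u \<le> lookup t u"
  then have "lookup (single v 1) v \<le> lookup t v" by blast
  then show "1 \<le> lookup t v" by simp
qed (auto simp: lookup_single when_def)

text \<open>
  Adding a variable \<open>v\<close> that is a nonzerodivisor modulo the ideal: the colon ideal by \<open>v\<close> is the ideal
  itself, and the cone raises labels and homological degree by \<open>v\<close> and by one. The condition on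
  \<open>V = {}\<close> only serves to record that no variable was used.
\<close>
lemma frame_with_variables:
  assumes U: "upclosed U" "independent_of W U" and P: "frame_with k P U"
    and V: "finite V" "V \<subseteq> W"
  shows "frame_with k (\<lambda>i t. \<exists>j s w l. P j s \<and> keys w \<subseteq> W \<and> monomial_degree w = l \<and>
            i = j + l \<and> t = s + w \<and> (V = {} \<longrightarrow> l = 0)) (U \<union> {t. \<exists>v\<in>V. single v 1 \<preceq> t})"
  using V
proof (induction V rule: finite_induct)
  case empty
  show ?case
  proof (rule frame_with_mono)
    show "frame_with k P (U \<union> {t. \<exists>v\<in>{}. single v 1 \<preceq> t})" using P by simp
    fix i t assume "P i t"
    then show "\<exists>j s w l. P j s \<and> keys w \<subseteq> W \<and> monomial_degree w = l \<and>
            i = j + l \<and> t = s + w \<and> ({} = {} \<longrightarrow> l = 0)"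
      by (intro exI[of _ i] exI[of _ t] exI[of _ 0]) simp
  qed
next
  case (insert v V)
  let ?P = "\<lambda>V i t. \<exists>j s w l. P j s \<and> keys w \<subseteq> W \<and> monomial_degree w = l \<and>
            i = j + l \<and> t = s + w \<and> (V = {} \<longrightarrow> l = 0)"
  let ?V = "U \<union> {t. \<exists>v\<in>V. single v 1 \<preceq> t}"
  let ?m = "single v 1"
  have IH: "frame_with k (?P V) ?V" using insert by simp
  have up: "upclosed ?V"
    using U(1) mono_dvd_trans[OF _ mono_dvd_add(1)] unfolding upclosed_def by blast
  have colon: "{t. t + ?m \<in> ?V} = ?V"
    unfolding set_eq_iff
  proof (rule allI)
    fix t
    have "t + ?m \<in> U \<longleftrightarrow> t \<in> U"
    proof
      assume "t + ?m \<in> U"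
      moreover have "keys ?m \<subseteq> W" using insert.prems by simp
      ultimately show "t \<in> U" using U(2) unfolding independent_of_def by blast
    next
      assume "t \<in> U" then show "t + ?m \<in> U" using U(1) unfolding upclosed_def by blast
    qed
    moreover have "single u 1 \<preceq> t + ?m \<longleftrightarrow> single u 1 \<preceq> t" if "u \<in> V" for u
    proof -
      have "u \<noteq> v" using that insert.hyps by blast
      then show ?thesis unfolding single_dvd_iff by (simp add: Poly_Mapping.lookup_add lookup_single when_def)
    qed
    ultimately show "t \<in> {t. t + ?m \<in> ?V} \<longleftrightarrow> t \<in> ?V" by blast
  qed
  have "frame_with k (?P V) {t. t + ?m \<in> ?V}" unfolding colon by (rule IH)
  from frame_with_cone[OF up IH this]
  have F: "frame_with k (\<lambda>i t. ?P V i t \<or> (\<exists>h s. i = Suc h \<and> t = s + ?m \<and> ?P V h s)) (?V \<union> {t. ?m \<preceq> t})" .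
  have eq: "?V \<union> {t. ?m \<preceq> t} = U \<union> {t. \<exists>u\<in>insert v V. single u 1 \<preceq> t}" by blast
  show ?case
  proof (rule frame_with_mono[OF F[unfolded eq]])
    fix i t assume "?P V i t \<or> (\<exists>h s. i = Suc h \<and> t = s + ?m \<and> ?P V h s)"
    then show "?P (insert v V) i t"
    proof
      assume "?P V i t"
      then show ?thesis by blast
    next
      assume "\<exists>h s. i = Suc h \<and> t = s + ?m \<and> ?P V h s"
      then obtain h s j s' w l where h: "i = Suc h" "t = s + ?m" "P j s'" "keys w \<subseteq> W"
        "monomial_degree w = l" "h = j + l" "s = s' + w" by blast
      have k: "keys (w + ?m) \<subseteq> W"
        using Poly_Mapping.keys_add[of w ?m] h(4) insert.prems by auto
      have d: "monomial_degree (w + ?m) = Suc l"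
        using h(5) by (simp add: monomial_degree_add monomial_degree_single)
      have t: "t = s' + (w + ?m)" using h by (simp add: add.assoc)
      have i: "i = j + Suc l" using h by simp
      show ?thesis using h(3) k d t i by blast
    qed
  qed
qed

definition rows_le :: "'n::linorder list \<Rightarrow> 'n list \<Rightarrow> bool" where
  "rows_le xs xs' \<longleftrightarrow> (\<forall>p<length xs. xs ! p \<le> xs' ! p)"

text \<open>
  The sum of the positions of the entries is strictly monotone for \<open>rows_le\<close>.
\<close>
lemma exists_maximal_row:
  fixes D :: "'n::{finite,linorder} list set"
  assumes D: "D \<subseteq> row_lists r" "D \<noteq> {}" and fin: "finite D"
  shows "\<exists>xs\<in>D. \<forall>xs'\<in>D. rows_le xs xs' \<longrightarrow> xs' = xs"
proof -
  define h where "h xs = (\<Sum>p<r. card {x. x < xs ! p})" for xs :: "'n list"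
  have "finite (h ` D)" "h ` D \<noteq> {}" using fin D(2) by auto
  then have "Max (h ` D) \<in> h ` D" by (rule Max_in)
  then obtain xs where xs: "xs \<in> D" "h xs = Max (h ` D)" by auto
  have "xs' = xs" if xs': "xs' \<in> D" "rows_le xs xs'" for xs'
  proof (rule ccontr)
    assume ne: "xs' \<noteq> xs"
    have l: "length xs = r" "length xs' = r" using row_lists_length D(1) xs(1) xs'(1) by blast+
    have le: "xs ! p \<le> xs' ! p" if "p < r" for p using xs'(2) that l by (simp add: rows_le_def)
    obtain p where p: "p < r" "xs ! p \<noteq> xs' ! p" using ne l nth_equalityI[of xs xs'] by auto
    have "h xs < h xs'"
      unfolding h_def
    proof (rule sum_strict_mono_ex1)
      show "\<forall>p\<in>{..<r}. card {x. x < xs ! p} \<le> card {x. x < xs' ! p}"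
        using le by (auto intro!: card_mono intro: less_le_trans)
      have "{x. x < xs ! p} \<subset> {x. x < xs' ! p}" using le[OF p(1)] p(2) by force
      then show "\<exists>p\<in>{..<r}. card {x. x < xs ! p} < card {x. x < xs' ! p}"
        using p(1) psubset_card_mono[OF finite] by blast
    qed simp
    moreover have "h xs' \<le> h xs" unfolding xs(2) using fin xs'(1) by simp
    ultimately show False by simp
  qed
  then show ?thesis using xs(1) by blast
qed

lemma finite_row_lists: "finite (row_lists r :: 'n::{finite,linorder} list set)"
proof -
  have "row_lists r \<subseteq> {xs :: 'n list. set xs \<subseteq> UNIV \<and> length xs = r}" by (auto simp: row_lists_def)
  then show ?thesis using finite_lists_length_eq[of UNIV r] by (rule finite_subset) simp
qed

text \<open>
  The variables that generate the colon ideal of the componentwise smaller diagonals by the diagonal of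
  \<open>xs\<close>, see \<open>diag_colon\<close>: in the \<open>p\<close>-th column, the rows strictly between two neighbours in \<open>xs\<close>.
\<close>
definition colon_vars :: "'n::linorder list \<Rightarrow> 'm list \<Rightarrow> ('n \<times> 'm) set" where
  "colon_vars xs ys = {(x, ys ! p) | x p. p < length xs \<and> x < xs ! p \<and> (p > 0 \<longrightarrow> xs ! (p - 1) < x)}"

text \<open>
  Linear quotients, for any order of the diagonals in which componentwise smaller ones come first. If a list
  \<open>a\<close> came before \<open>xs\<close>, it is smaller somewhere. At the first such place \<open>p\<close> the entry \<open>a ! p\<close> still exceeds
  \<open>xs ! (p - 1)\<close>, hence it may replace \<open>xs ! p\<close>, and the variable there divides the quotient of the
  two diagonals.
\<close>
lemma diag_colon:
  fixes xs :: "'n::linorder list"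
  assumes ys: "distinct ys" "length ys = r" and xs: "xs \<in> row_lists r" "xs \<in> D" and D: "D \<subseteq> row_lists r"
    and down: "\<And>a b. a \<in> row_lists r \<Longrightarrow> b \<in> D \<Longrightarrow> rows_le a b \<Longrightarrow> a \<in> D"
    and max: "\<And>b. b \<in> D \<Longrightarrow> rows_le xs b \<Longrightarrow> b = xs"
  shows "(\<exists>a\<in>D - {xs}. diag_mono a ys \<preceq> t + diag_mono xs ys) \<longleftrightarrow>
    (\<exists>v\<in>colon_vars xs ys. single v 1 \<preceq> t)"
proof
  have lx: "length xs = r" by (rule row_lists_length[OF xs(1)])
  have lxs: "lookup (diag_mono xs ys) (x, ys ! p) = (if xs ! p = x then 1 else 0)" if "p < r" for x p
    using lookup_diag_mono[of ys xs p x] ys lx that by simp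
  {
    assume "\<exists>a\<in>D - {xs}. diag_mono a ys \<preceq> t + diag_mono xs ys"
    then obtain a where a: "a \<in> D" "a \<noteq> xs" "diag_mono a ys \<preceq> t + diag_mono xs ys" by blast
    have la: "length a = r" using row_lists_length a(1) D by blast
    have "\<not> rows_le xs a" using max a by blast
    \<comment> \<open>The first place where \<open>a\<close> is smaller; before it, the entries of \<open>a\<close> are at least those of \<open>xs\<close>.\<close>
    then have ex: "\<exists>p. p < r \<and> a ! p < xs ! p" by (auto simp: rows_le_def lx not_le)
    define p where "p = (LEAST p. p < r \<and> a ! p < xs ! p)"
    have p: "p < r" "a ! p < xs ! p" using LeastI_ex[OF ex] unfolding p_def by blast+
    have prev: "xs ! (p - 1) < a ! p" if "p > 0"
    proof -
      have "\<not> (p - 1 < r \<and> a ! (p - 1) < xs ! (p - 1))"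
        using not_less_Least[of "p - 1" "\<lambda>p. p < r \<and> a ! p < xs ! p"] that unfolding p_def[symmetric] by simp
      then have "xs ! (p - 1) \<le> a ! (p - 1)" using p(1) by auto
      also have "a ! (p - 1) < a ! p" using row_lists_nth_less[of a r "p - 1" p] a(1) D p(1) that by auto
      finally show ?thesis .
    qed
    have "1 \<le> lookup (t + diag_mono xs ys) (a ! p, ys ! p)"
      using a(3) p(1) ys la by (simp add: diag_mono_dvd_iff)
    moreover have "xs ! p \<noteq> a ! p" using p(2) by simp
    ultimately have "1 \<le> lookup t (a ! p, ys ! p)" using lxs[OF p(1), of "a ! p"] by (simp add: Poly_Mapping.lookup_add)
    moreover have "(a ! p, ys ! p) \<in> colon_vars xs ys"
      unfolding colon_vars_def using p prev lx by blast
    ultimately show "\<exists>v\<in>colon_vars xs ys. single v 1 \<preceq> t" unfolding single_dvd_iff by blast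
  next
    assume "\<exists>v\<in>colon_vars xs ys. single v 1 \<preceq> t"
    then obtain x p where p: "p < r" "x < xs ! p" "p > 0 \<Longrightarrow> xs ! (p - 1) < x"
      and t: "1 \<le> lookup t (x, ys ! p)" unfolding colon_vars_def single_dvd_iff lx by blast
    let ?a = "xs[p := x]"
    have a: "?a \<in> row_lists r" by (rule update_row_list[OF xs(1) p])
    have "rows_le ?a xs" using p(2) lx p(1) by (auto simp: rows_le_def nth_list_update)
    then have "?a \<in> D" using down a xs(2) by blast
    moreover have "?a \<noteq> xs"
    proof
      assume "?a = xs"
      then have "?a ! p = xs ! p" by simp
      then show False using p lx by simp
    qed
    moreover have "diag_mono ?a ys \<preceq> t + diag_mono xs ys"
    proof (subst diag_mono_dvd_iff)
      show "\<forall>q<length ys. 1 \<le> lookup (t + diag_mono xs ys) (?a ! q, ys ! q)"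
      proof (intro allI impI)
        fix q assume "q < length ys"
        then show "1 \<le> lookup (t + diag_mono xs ys) (?a ! q, ys ! q)"
          using t lxs[of q "xs ! q"] ys lx p(1)
          by (cases "q = p") (simp_all add: Poly_Mapping.lookup_add)
      qed
    qed (use ys lx in simp_all)
    ultimately show "\<exists>a\<in>D - {xs}. diag_mono a ys \<preceq> t + diag_mono xs ys" by blast
  }
qed

lemma colon_vars_band: "xs \<in> row_lists r \<Longrightarrow> colon_vars xs ys \<subseteq> band_vars r ys"
proof
  fix v assume xs: "xs \<in> row_lists r" and "v \<in> colon_vars xs ys"
  then obtain x p where p: "v = (x, ys ! p)" "p < r" "x < xs ! p" "p > 0 \<Longrightarrow> xs ! (p - 1) < x"
    unfolding colon_vars_def using row_lists_length[OF xs] by blast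
  have "xs[p := x] \<in> row_lists r" by (rule update_row_list[OF xs p(2-4)])
  moreover have "v = (xs[p := x] ! p, ys ! p)" using p(1,2) row_lists_length[OF xs] by simp
  ultimately show "v \<in> band_vars r ys" using p(2) unfolding band_vars_def by blast
qed

text \<open>
  If \<open>r\<close> equals the number of rows, a block has a single minor. This and the next lemma give the
  exceptional bound on the labels that the case \<open>r = n\<close> of \<open>clique_labels_separated\<close> uses.
\<close>
lemma row_lists_full:
  assumes "r = CARD('n::{finite,linorder})" "xs \<in> row_lists r" "xs' \<in> row_lists r"
  shows "xs = (xs' :: 'n list)"
proof -
  have "zs = sorted_list_of_set UNIV" if "zs \<in> row_lists r" for zs :: "'n list"
  proof -
    have z: "sorted zs" "distinct zs" "length zs = r" using that by (auto simp: row_lists_def strict_sorted_iff)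
    then have "card (set zs) = CARD('n)" using assms(1) by (simp add: distinct_card)
    then have "set zs = UNIV" by (intro card_subset_eq) simp_all
    then show ?thesis using z sorted_list_of_set.idem_if_sorted_distinct by metis
  qed
  then show ?thesis using assms by metis
qed

lemma colon_vars_full:
  assumes "r = CARD('n::{finite,linorder})" "xs \<in> row_lists r"
  shows "colon_vars (xs :: 'n list) ys = {}"
proof (rule ccontr)
  assume "colon_vars xs ys \<noteq> {}"
  then obtain x p where p: "p < r" "x < xs ! p" "p > 0 \<Longrightarrow> xs ! (p - 1) < x"
    unfolding colon_vars_def using row_lists_length[OF assms(2)] by blast
  have "xs[p := x] = xs" by (rule row_lists_full[OF assms(1) update_row_list[OF assms(2) p] assms(2)])
  then have "xs[p := x] ! p = xs ! p" by simp
  then show False using p row_lists_length[OF assms(2)] by simp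
qed

text \<open>
  Adds the diagonals of one block, componentwise smaller ones first, by cones over the colon ideals of
  \<open>diag_colon\<close>. A new label is an old one times a monomial \<open>w\<close> in the band of the block: the diagonal of
  degree \<open>r\<close> in homological degree one, and a further variable for each further homological degree.
\<close>
lemma frame_with_clique:
  fixes ys :: "'m::finite list" and U :: "('n::{finite,linorder} \<times> 'm) monomial set"
  assumes r: "1 \<le> r" and ys: "distinct ys" "length ys = r"
    and U: "upclosed U" "independent_of (band_vars r ys) U" and P: "frame_with k P U"
  shows "frame_with k (\<lambda>i t. P i t \<or> (\<exists>j s w l. P j s \<and> keys w \<subseteq> band_vars r ys \<and>
           monomial_degree w = l + (r - 1) \<and> 1 \<le> l \<and> (CARD('n) = r \<longrightarrow> l = 1) \<and> i = j + l \<and> t = s + w))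
         (U \<union> {t. \<exists>xs\<in>row_lists r. diag_mono xs ys \<preceq> t})"
proof -
  let ?W = "band_vars r ys :: ('n \<times> 'm) set"
  let ?P = "\<lambda>i t. P i t \<or> (\<exists>j s w l. P j s \<and> keys w \<subseteq> ?W \<and>
           monomial_degree w = l + (r - 1) \<and> 1 \<le> l \<and> (CARD('n) = r \<longrightarrow> l = 1) \<and> i = j + l \<and> t = s + w)"
  have "frame_with k ?P (U \<union> {t. \<exists>xs\<in>D. diag_mono xs ys \<preceq> t})"
    if "D \<subseteq> row_lists r" "\<And>a b. a \<in> row_lists r \<Longrightarrow> b \<in> D \<Longrightarrow> rows_le a b \<Longrightarrow> a \<in> D"
    for D :: "'n list set"
    using that
  proof (induction "card D" arbitrary: D)
    case 0
    then have "D = {}" using finite_subset[OF 0(2) finite_row_lists] by simp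
    then have "U \<union> {t. \<exists>xs\<in>D. diag_mono xs ys \<preceq> t} = U" by simp
    then show ?case using frame_with_mono[OF P, of ?P] by simp
  next
    case (Suc c)
    have finD: "finite D" by (rule finite_subset[OF Suc.prems(1) finite_row_lists])
    have "D \<noteq> {}" using Suc.hyps(2) by auto
    then obtain xs where xs: "xs \<in> D" "\<And>b. b \<in> D \<Longrightarrow> rows_le xs b \<Longrightarrow> b = xs"
      using exists_maximal_row[OF Suc.prems(1) _ finD] by blast
    have xr: "xs \<in> row_lists r" using xs(1) Suc.prems(1) by blast
    let ?D = "D - {xs}"
    let ?V = "U \<union> {t. \<exists>a\<in>?D. diag_mono a ys \<preceq> t}"
    let ?m = "diag_mono xs ys"
    have IH: "frame_with k ?P ?V"
    proof (rule Suc.hyps(1))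
      show "c = card ?D" using Suc.hyps(2) xs(1) by simp
      show "?D \<subseteq> row_lists r" using Suc.prems(1) by blast
      fix a b assume ab: "a \<in> row_lists r" "b \<in> ?D" "rows_le a b"
      have "a \<in> D" using Suc.prems(2) ab by blast
      moreover have "a \<noteq> xs" using xs(2)[of b] ab by blast
      ultimately show "a \<in> ?D" by blast
    qed
    have up: "upclosed ?V"
      using U(1) mono_dvd_trans[OF _ mono_dvd_add(1)] unfolding upclosed_def by blast
    have colon: "{t. t + ?m \<in> ?V} = U \<union> {t. \<exists>v\<in>colon_vars xs ys. single v 1 \<preceq> t}"
      unfolding set_eq_iff
    proof (rule allI)
      fix t
      have "t + ?m \<in> U \<longleftrightarrow> t \<in> U"
        using U keys_diag_mono[OF xr, of ys] unfolding independent_of_def upclosed_def by blast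
      moreover have "(\<exists>a\<in>?D. diag_mono a ys \<preceq> t + ?m) \<longleftrightarrow> (\<exists>v\<in>colon_vars xs ys. single v 1 \<preceq> t)"
        by (rule diag_colon[OF ys xr xs(1) Suc.prems(1) Suc.prems(2) xs(2)])
      ultimately show "t \<in> {t. t + ?m \<in> ?V} \<longleftrightarrow> t \<in> U \<union> {t. \<exists>v\<in>colon_vars xs ys. single v 1 \<preceq> t}"
        by simp
    qed
    let ?Q = "\<lambda>i t. \<exists>j s w l. P j s \<and> keys w \<subseteq> ?W \<and> monomial_degree w = l \<and>
            i = j + l \<and> t = s + w \<and> (colon_vars xs ys = {} \<longrightarrow> l = 0)"
    have Q: "frame_with k ?Q {t. t + ?m \<in> ?V}"
      unfolding colon by (rule frame_with_variables[OF U P _ colon_vars_band[OF xr]]) simp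
    have F: "frame_with k (\<lambda>i t. ?P i t \<or> (\<exists>h s. i = Suc h \<and> t = s + ?m \<and> ?Q h s)) (?V \<union> {t. ?m \<preceq> t})"
      by (rule frame_with_cone[OF up IH Q])
    have eq: "?V \<union> {t. ?m \<preceq> t} = U \<union> {t. \<exists>a\<in>D. diag_mono a ys \<preceq> t}" using xs(1) by blast
    show ?case
    proof (rule frame_with_mono[OF F[unfolded eq]])
      fix i t assume "?P i t \<or> (\<exists>h s. i = Suc h \<and> t = s + ?m \<and> ?Q h s)"
      then show "?P i t"
      proof
        assume "\<exists>h s. i = Suc h \<and> t = s + ?m \<and> ?Q h s"
        then obtain h s j s' w l where h: "i = Suc h" "t = s + ?m" "P j s'" "keys w \<subseteq> ?W"
          "monomial_degree w = l" "h = j + l" "s = s' + w" "colon_vars xs ys = {} \<longrightarrow> l = 0" by blast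
        have kw: "keys (w + ?m) \<subseteq> ?W"
          using Poly_Mapping.keys_add[of w ?m] h(4) keys_diag_mono[OF xr, of ys] by blast
        have d: "monomial_degree (w + ?m) = Suc l + (r - 1)"
          using h(5) r row_lists_length[OF xr] by (simp add: monomial_degree_add monomial_degree_diag_mono)
        have full: "CARD('n) = r \<longrightarrow> Suc l = 1" using h(8) colon_vars_full[OF _ xr, of ys] by auto
        have "t = s' + (w + ?m)" "i = j + Suc l" using h by (simp_all add: add.assoc)
        then show "?P i t" using h(3) kw d full by (metis One_nat_def le_add1 plus_1_eq_Suc)
      qed
    qed
  qed
  from this[of "row_lists r"] show ?thesis by blast
qed

text \<open>
  \<open>clique_label r K i t\<close> describes the labels of the iterated cone in homological degree \<open>i\<close>. Each block
  in \<open>K\<close> contributes \<open>l\<close> to the homological degree and a monomial of degree \<open>l + (r - 1)\<close> in its band.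
\<close>
inductive clique_label :: "nat \<Rightarrow> 'm list set \<Rightarrow> nat \<Rightarrow> ('n::linorder \<times> 'm) monomial \<Rightarrow> bool" for r where
  clique_label_empty: "clique_label r {} 0 0"
| clique_label_insert: "clique_label r K i (t :: ('n::linorder \<times> 'm) monomial) \<Longrightarrow> ys \<notin> K \<Longrightarrow>
    keys w \<subseteq> band_vars r ys \<Longrightarrow> monomial_degree w = l + (r - 1) \<Longrightarrow> 1 \<le> l \<Longrightarrow>
    (CARD('n) = r \<longrightarrow> l = 1) \<Longrightarrow> clique_label r (insert ys K) (i + l) (t + w)"

theorem frame_diag_ideal:
  fixes B :: "'m::{finite,linorder} list set"
  assumes r: "1 \<le> r" and B: "finite B" "B \<subseteq> row_lists r"
    and disj: "\<And>ys ys'. ys \<in> B \<Longrightarrow> ys' \<in> B \<Longrightarrow> ys \<noteq> ys' \<Longrightarrow>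
      band_vars r ys \<inter> (band_vars r ys' :: ('n::{finite,linorder} \<times> 'm) set) = {}"
  shows "frame_with k (\<lambda>i t. \<exists>K\<subseteq>B. clique_label r K i t) (diag_ideal r B :: ('n \<times> 'm) monomial set)"
  using B disj
proof (induction B rule: finite_induct)
  case empty
  have "diag_ideal r {} = ({} :: ('n \<times> 'm) monomial set)" by (simp add: diag_ideal_def)
  then show ?case using frame_with_mono[OF frame_with_empty] clique_label_empty by (metis (no_types, lifting) order_refl)
next
  case (insert ys B)
  let ?P = "\<lambda>B i t. \<exists>K\<subseteq>B. clique_label r K i (t :: ('n \<times> 'm) monomial)"
  have IH: "frame_with k (?P B) (diag_ideal r B)" using insert by simp
  have ys: "distinct ys" "length ys = r" using insert.prems(1) by (auto simp: row_lists_def strict_sorted_iff)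
  have ind: "independent_of (band_vars r ys) (diag_ideal r B :: ('n \<times> 'm) monomial set)"
    using insert.prems(2) insert.hyps(2) by (intro independent_of_diag_ideal) blast
  note F = frame_with_clique[OF r ys upclosed_diag_ideal ind IH]
  have eq: "diag_ideal r B \<union> {t. \<exists>xs\<in>row_lists r. diag_mono xs ys \<preceq> t}
      = (diag_ideal r (insert ys B) :: ('n \<times> 'm) monomial set)" by (auto simp: diag_ideal_def)
  show ?case
  proof (rule frame_with_mono[OF F[unfolded eq]])
    fix i t assume "?P B i t \<or> (\<exists>j s w l. ?P B j s \<and> keys w \<subseteq> band_vars r ys \<and>
           monomial_degree w = l + (r - 1) \<and> 1 \<le> l \<and> (CARD('n) = r \<longrightarrow> l = 1) \<and> i = j + l \<and> t = s + w)"
    then show "?P (insert ys B) i t"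
    proof
      assume "?P B i t" then show ?thesis by blast
    next
      assume "\<exists>j s w l. ?P B j s \<and> keys w \<subseteq> band_vars r ys \<and>
           monomial_degree w = l + (r - 1) \<and> 1 \<le> l \<and> (CARD('n) = r \<longrightarrow> l = 1) \<and> i = j + l \<and> t = s + w"
      then obtain j s w l K where h: "K \<subseteq> B" "clique_label r K j s" "keys w \<subseteq> band_vars r ys"
           "monomial_degree w = l + (r - 1)" "1 \<le> l" "CARD('n) = r \<longrightarrow> l = 1" "i = j + l" "t = s + w" by blast
      have "ys \<notin> K" using h(1) insert.hyps(2) by blast
      from clique_label_insert[OF h(2) this h(3-6)] have "clique_label r (insert ys K) i t"
        using h(7,8) by simp
      moreover have "insert ys K \<subseteq> insert ys B" using h(1) by blast
      ultimately show ?thesis by blast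
    qed
  qed
qed


section \<open>Labels, bands and cliques\<close>

lemma column_degree_ge: "lookup t (x, y) \<le> column_degree t y"
  unfolding column_degree_def using member_le_sum[of x UNIV "\<lambda>\<rho>. lookup t (\<rho>, y)"] by simp

lemma column_degree_nonzeroD: "column_degree t y \<noteq> 0 \<Longrightarrow> \<exists>x. (x, y) \<in> keys t"
proof (rule ccontr)
  assume "column_degree t y \<noteq> 0" "\<nexists>x. (x, y) \<in> keys t"
  then show False by (simp add: column_degree_def in_keys_iff)
qed

lemma clique_label_degree:
  assumes "clique_label r K i (t :: ('n::{finite,linorder} \<times> 'm) monomial)"
  shows "finite K \<and> monomial_degree t = i + (r - 1) * card K \<and> (CARD('n) = r \<longrightarrow> i = card K)"
  using assms by (induction rule: clique_label.induct) (auto simp: monomial_degree_add)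

lemma clique_label_columns:
  assumes "clique_label r K i (t :: ('n::{finite,linorder} \<times> 'm::linorder) monomial)" "K \<subseteq> row_lists r"
  shows "(\<forall>c. column_degree t c \<noteq> 0 \<longrightarrow> (\<exists>ys\<in>K. c \<in> set ys)) \<and>
         (\<forall>ys\<in>K. \<exists>c\<in>set ys. column_degree t c \<noteq> 0)"
  using assms
proof (induction rule: clique_label.induct)
  case clique_label_empty
  then show ?case by (simp add: column_degree_0)
next
  case (clique_label_insert K i t ys w l)
  have ly: "length ys = r" using clique_label_insert.prems by (simp add: row_lists_def)
  have w: "y \<in> set ys" if xy: "(x, y) \<in> keys w" for x y
  proof -
    have "(x, y) \<in> band_vars r ys" using clique_label_insert.hyps(3) xy by blast
    then obtain p where "p < r" "y = ys ! p" unfolding band_vars_def by blast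
    then show ?thesis using ly by simp
  qed
  have "w \<noteq> 0"
  proof
    assume "w = 0"
    then have "monomial_degree w = 0" by simp
    then show False using clique_label_insert.hyps(4,5) by linarith
  qed
  then have "keys w \<noteq> {}" by simp
  then obtain v where "v \<in> keys w" by blast
  then obtain x y where xy: "(x, y) \<in> keys w" by (cases v) simp
  have "lookup w (x, y) \<noteq> 0" using xy by (simp add: in_keys_iff)
  then have "column_degree w y \<noteq> 0" using column_degree_ge[of w x y] by linarith
  then have "column_degree (t + w) y \<noteq> 0" by (simp add: column_degree_add)
  then have new: "\<exists>c\<in>set ys. column_degree (t + w) c \<noteq> 0" using w[OF xy] by blast
  have KK: "K \<subseteq> row_lists r" using clique_label_insert.prems by blast
  have IH: "\<And>c. column_degree t c \<noteq> 0 \<Longrightarrow> \<exists>ys\<in>K. c \<in> set ys" "\<And>ys. ys \<in> K \<Longrightarrow> \<exists>c\<in>set ys. column_degree t c \<noteq> 0"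
    using clique_label_insert.IH[OF KK] by blast+
  have 1: "\<exists>zs\<in>insert ys K. c \<in> set zs" if "column_degree (t + w) c \<noteq> 0" for c
  proof (cases "column_degree t c = 0")
    case True
    then have "column_degree w c \<noteq> 0" using that by (simp add: column_degree_add)
    from column_degree_nonzeroD[OF this] obtain x where "(x, c) \<in> keys w" ..
    from w[OF this] show ?thesis by (rule bexI) simp
  next
    case False
    from IH(1)[OF this] show ?thesis by simp
  qed
  have 2: "\<exists>c\<in>set zs. column_degree (t + w) c \<noteq> 0" if zs: "zs \<in> insert ys K" for zs
  proof (cases "zs = ys")
    case True
    show ?thesis unfolding True by (rule new)
  next
    case False
    then have "zs \<in> K" using zs by simp
    from IH(2)[OF this] obtain c where c: "c \<in> set zs" "column_degree t c \<noteq> 0" ..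
    have "column_degree (t + w) c \<noteq> 0" using c(2) by (simp add: column_degree_add)
    then show ?thesis using c(1) by (rule bexI)
  qed
  show ?case by (intro conjI allI impI ballI 1 2)
qed

text \<open>
  The total degrees are \<open>i + (r - 1) |K|\<close> and \<open>i + 1 + (r - 1) |K'|\<close>. If they agree then \<open>r - 1\<close> divides \<open>1\<close>, so
  \<open>r = 2\<close>. For \<open>n = 2\<close>, \<open>i = |K|\<close> and \<open>i + 1 = |K'|\<close>, which is contradictory. For \<open>n > 2\<close> the blocks
  have no columns in common, and \<open>K = K'\<close> consists of the blocks that meet the column degree.
\<close>
lemma clique_labels_separated:
  fixes t t' :: "('n::{finite,linorder} \<times> 'm::{finite,linorder}) monomial"
  assumes r: "1 \<le> r" "r \<le> CARD('n)" and B: "B \<subseteq> row_lists r"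
    and disj: "\<And>ys ys'. r = 2 \<Longrightarrow> CARD('n) > 2 \<Longrightarrow> ys \<in> B \<Longrightarrow> ys' \<in> B \<Longrightarrow> ys \<noteq> ys' \<Longrightarrow> set ys \<inter> set ys' = {}"
    and K: "K \<subseteq> B" "clique_label r K i t" and K': "K' \<subseteq> B" "clique_label r K' (Suc i) t'"
  shows "column_degree t \<noteq> column_degree t'"
proof
  assume eq: "column_degree t = column_degree t'"
  have h: "monomial_degree t = i + (r - 1) * card K" "CARD('n) = r \<longrightarrow> i = card K"
    "monomial_degree t' = Suc i + (r - 1) * card K'" "CARD('n) = r \<longrightarrow> Suc i = card K'" "finite K'"
    using clique_label_degree[OF K(2)] clique_label_degree[OF K'(2)] by auto
  have "monomial_degree t = monomial_degree t'"
    using eq by (simp add: monomial_degree_column_degree)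
  then have e: "(r - 1) * card K = 1 + (r - 1) * card K'" using h by simp
  then have "(r - 1) * (card K - card K') = 1" by (simp only: diff_mult_distrib2 diff_add_inverse2)
  then have "r - 1 = 1" by (simp only: nat_mult_eq_1_iff)
  then have r2: "r = 2" using r by simp
  show False
  proof (cases "CARD('n) = 2")
    case True
    then show ?thesis using e h r2 by simp
  next
    case False
    then have n: "CARD('n) > 2" using r r2 by simp
    have KB: "L = {ys \<in> B. \<exists>c\<in>set ys. column_degree s c \<noteq> 0}"
      if L: "L \<subseteq> B" "clique_label r L j s" for L j and s :: "('n \<times> 'm) monomial"
    proof -
      have c: "\<And>c. column_degree s c \<noteq> 0 \<Longrightarrow> \<exists>ys\<in>L. c \<in> set ys"
        "\<And>ys. ys \<in> L \<Longrightarrow> \<exists>c\<in>set ys. column_degree s c \<noteq> 0"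
        using clique_label_columns[OF L(2)] L(1) B by blast+
      have "ys \<in> L" if ys: "ys \<in> B" "c \<in> set ys" "column_degree s c \<noteq> 0" for ys c
      proof -
        obtain zs where zs: "zs \<in> L" "c \<in> set zs" using c(1)[OF ys(3)] by blast
        then have "zs = ys" using disj[OF r2 n, of zs ys] L(1) ys by blast
        then show ?thesis using zs by simp
      qed
      then show ?thesis using c(2) L(1) by blast
    qed
    have "K = K'" using KB[OF K] KB[OF K'] eq by simp
    then show ?thesis using e r2 by simp
  qed
qed

text \<open>
  The \<open>p\<close>-th entry (counted from \<open>0\<close>) of an increasing list has at least \<open>p\<close> rows before it and, itself
  included, at least \<open>r - p\<close> rows from it on. This confines the diagonals to a band.
\<close>
lemma row_position_bounds:
  fixes xs :: "'n::{finite,linorder} list"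
  assumes xs: "xs \<in> row_lists r" and p: "p < r"
  shows "p \<le> card {x. x < xs ! p}" and "card {x. x < xs ! p} + (r - p) \<le> CARD('n)"
proof -
  have inj: "inj_on ((!) xs) {..<r}"
    using xs by (auto simp: row_lists_def strict_sorted_iff inj_on_def nth_eq_iff_index_eq)
  have "(!) xs ` {..<p} \<subseteq> {x. x < xs ! p}" using row_lists_nth_less[OF xs _ p] by auto
  then have "card ((!) xs ` {..<p}) \<le> card {x. x < xs ! p}" by (intro card_mono) simp_all
  moreover have "card ((!) xs ` {..<p}) = p"
    using inj_on_subset[OF inj, of "{..<p}"] p by (simp add: card_image)
  ultimately show "p \<le> card {x. x < xs ! p}" by simp
  have "card ((!) xs ` {p..<r}) = r - p"
  proof -
    have "{p..<r} \<subseteq> {..<r}" by auto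
    from card_image[OF inj_on_subset[OF inj this]] show ?thesis by simp
  qed
  moreover have "{x. x < xs ! p} \<inter> (!) xs ` {p..<r} = {}"
  proof -
    have "\<not> xs ! q < xs ! p" if "q \<in> {p..<r}" for q
      using row_lists_nth_less[OF xs, of p q] that by (cases "q = p") auto
    then show ?thesis by auto
  qed
  then have "card ({x. x < xs ! p} \<union> (!) xs ` {p..<r}) = card {x. x < xs ! p} + card ((!) xs ` {p..<r})"
    by (intro card_Un_disjoint) simp_all
  moreover have "card ({x. x < xs ! p} \<union> (!) xs ` {p..<r}) \<le> CARD('n)" by (intro card_mono) simp_all
  ultimately show "card {x. x < xs ! p} + (r - p) \<le> CARD('n)" by simp
qed

lemma interval_position:
  assumes ys: "ys \<in> row_lists r" "set ys = {a..b}" and p: "p < r"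
  shows "card {a..<ys ! p} = p"
proof -
  have ly: "length ys = r" by (rule row_lists_length[OF ys(1)])
  have "{a..<ys ! p} = (!) ys ` {..<p}"
  proof
    show "(!) ys ` {..<p} \<subseteq> {a..<ys ! p}"
    proof
      fix y assume "y \<in> (!) ys ` {..<p}"
      then obtain q where q: "q < p" "y = ys ! q" by auto
      then have "y \<in> set ys" using p ly by simp
      then show "y \<in> {a..<ys ! p}" using row_lists_nth_less[OF ys(1) q(1) p] q(2) ys(2) by simp
    qed
    show "{a..<ys ! p} \<subseteq> (!) ys ` {..<p}"
    proof
      fix y assume y: "y \<in> {a..<ys ! p}"
      have "ys ! p \<in> {a..b}" using p ly ys(2) nth_mem by blast
      then have "y \<in> set ys" using y ys(2) by auto
      then obtain q where q: "q < r" "y = ys ! q" using ly by (auto simp: in_set_conv_nth)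
      have "q < p"
      proof (rule ccontr)
        assume "\<not> q < p"
        then have "ys ! p \<le> ys ! q"
          using row_lists_nth_less[OF ys(1), of p q] q(1) by (cases "q = p") auto
        moreover have "ys ! q < ys ! p" using y q(2) by simp
        ultimately show False using leD by blast
      qed
      then show "y \<in> (!) ys ` {..<p}" using q(2) by blast
    qed
  qed
  moreover have "inj_on ((!) ys) {..<p}"
    using ys(1) p by (auto simp: row_lists_def strict_sorted_iff inj_on_def nth_eq_iff_index_eq)
  ultimately show ?thesis by (simp add: card_image)
qed

text \<open>
  Let the second block start \<open>d\<close> columns after the first. A common column has position \<open>p = d + p'\<close> in the
  first block and \<open>p'\<close> in the second, so a common variable would need \<open>p \<le> n - r + p'\<close>, that is \<open>d \<le> n - r\<close>.
  But the blocks share \<open>r - d > 0\<close> columns, and the bound on the intersection gives \<open>d > n - r\<close>.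
\<close>
lemma band_vars_disjoint_aux:
  fixes ys ys' :: "'m::{finite,linorder} list"
  assumes r: "r \<le> CARD('n::{finite,linorder})"
    and ys: "ys \<in> row_lists r" "set ys = {a..b}" and ys': "ys' \<in> row_lists r" "set ys' = {a'..b'}"
    and less: "a < a'"
    and inter: "int (card (set ys \<inter> set ys')) \<le> max 0 (2 * int r - int CARD('n) - 1)"
  shows "band_vars r ys \<inter> (band_vars r ys' :: ('n \<times> 'm) set) = {}"
proof (rule ccontr)
  assume "band_vars r ys \<inter> (band_vars r ys' :: ('n \<times> 'm) set) \<noteq> {}"
  then obtain v :: "'n \<times> 'm" where v: "v \<in> band_vars r ys" "v \<in> band_vars r ys'" by blast
  obtain xs p where xp: "xs \<in> row_lists r" "p < r" "v = (xs ! p, ys ! p)" using v(1) unfolding band_vars_def by blast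
  obtain xs' p' where xp': "xs' \<in> row_lists r" "p' < r" "v = (xs' ! p', ys' ! p')" using v(2) unfolding band_vars_def by blast
  define x y where "x = xs ! p" and "y = ys ! p"
  have e: "xs' ! p' = x" "ys' ! p' = y" using xp(3) xp'(3) by (simp_all add: x_def y_def)
  have c: "card (set ys) = r" "card (set ys') = r"
    using ys(1) ys'(1) by (simp_all add: row_lists_def strict_sorted_iff distinct_card)
  have yin: "y \<in> {a..b}" "y \<in> {a'..b'}"
    using xp(2) xp'(2) ys ys' row_lists_length nth_mem e(2) unfolding y_def by metis+
  have bb: "b \<le> b'"
  proof (rule ccontr)
    assume "\<not> b \<le> b'"
    then have "{a'..b'} \<subset> {a..b}" using less yin by auto
    then have "card {a'..b'} < card {a..b}" by (intro psubset_card_mono) simp_all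
    then show False using c ys(2) ys'(2) by simp
  qed
  have p: "card {a..<y} = p" unfolding y_def by (rule interval_position[OF ys xp(2)])
  have p': "card {a'..<y} = p'" using interval_position[OF ys' xp'(2)] e(2) by simp
  have "{a..<y} = {a..<a'} \<union> {a'..<y}" "{a..b} = {a..<a'} \<union> {a'..b}" using less yin by auto
  then have d: "card {a..<y} = card {a..<a'} + card {a'..<y}" "card {a..b} = card {a..<a'} + card {a'..b}"
    by (simp_all add: card_Un_disjoint ivl_disj_int)
  have "{a'..b} \<subseteq> set ys \<inter> set ys'" using ys(2) ys'(2) less bb by auto
  then have ci: "card {a'..b} \<le> card (set ys \<inter> set ys')" by (intro card_mono) simp_all
  have "y \<in> {a'..b}" using yin by simp
  then have "card {a'..b} \<ge> 1" using card_gt_0_iff[of "{a'..b}"] by auto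
  then have "int (card {a'..b}) \<le> 2 * int r - int CARD('n) - 1" using ci inter by linarith
  moreover have "p \<le> card {z. z < x}" unfolding x_def by (rule row_position_bounds(1)[OF xp(1,2)])
  moreover have "card {z. z < x} + (r - p') \<le> CARD('n)"
    using row_position_bounds(2)[OF xp'(1,2)] e(1) by simp
  ultimately show False using p p' d c(1) ys(2) xp'(2) r by simp
qed

lemma band_vars_disjoint:
  fixes ys ys' :: "'m::{finite,linorder} list"
  assumes r: "r \<le> CARD('n::{finite,linorder})"
    and ys: "ys \<in> row_lists r" "set ys = {a..b}" and ys': "ys' \<in> row_lists r" "set ys' = {a'..b'}"
    and ne: "ys \<noteq> ys'"
    and inter: "int (card (set ys \<inter> set ys')) \<le> max 0 (2 * int r - int CARD('n) - 1)"
  shows "band_vars r ys \<inter> (band_vars r ys' :: ('n \<times> 'm) set) = {}"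
proof (cases a a' rule: linorder_cases)
  case less
  then show ?thesis using band_vars_disjoint_aux[OF r ys ys'] inter by blast
next
  case greater
  have "int (card (set ys' \<inter> set ys)) \<le> max 0 (2 * int r - int CARD('n) - 1)"
    using inter by (simp add: Int_commute)
  from band_vars_disjoint_aux[OF r ys' ys greater this] show ?thesis by blast
next
  case equal
  have c: "card {a..b} = r" "card {a..b'} = r"
  proof -
    have "card (set ys) = r" "card (set ys') = r"
      using ys(1) ys'(1) by (simp_all add: row_lists_def strict_sorted_iff distinct_card)
    then show "card {a..b} = r" "card {a..b'} = r" using ys(2) ys'(2) equal by simp_all
  qed
  have "{a..b} = {a..b'}"
  proof (cases "b \<le> b'")
    case True
    then have "{a..b} \<subseteq> {a..b'}" by auto
    then show ?thesis using c by (intro card_subset_eq) simp_all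
  next
    case False
    then have "{a..b'} \<subseteq> {a..b}" by auto
    then have "{a..b'} = {a..b}" using c by (intro card_subset_eq) simp_all
    then show ?thesis by (rule sym)
  qed
  then have "set ys = set ys'" using ys(2) ys'(2) equal by simp
  then have "ys = ys'"
    using ys(1) ys'(1) sorted_distinct_set_unique by (auto simp: row_lists_def strict_sorted_iff)
  then show ?thesis using ne by simp
qed

lemma poly_ideal_generated: "poly_ideal (ideal_generated G)"
  unfolding poly_ideal_def ideal_generated_def
  by (auto intro: Modules.module.span_zero[OF module_ring_itself] Modules.module.span_add[OF module_ring_itself]
      Modules.module.span_scale[OF module_ring_itself])

lemma ideal_generated_base: "g \<in> G \<Longrightarrow> g \<in> ideal_generated G"
  unfolding ideal_generated_def by (rule Modules.module.span_base[OF module_ring_itself])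

text \<open>
  The homogeneous parts of a multiple \<open>c * g\<close> are multiples of \<open>g\<close> by homogeneous parts of \<open>c\<close>.
\<close>
lemma graded_ideal_generated:
  assumes "\<And>g. g \<in> G \<Longrightarrow> \<exists>e. homogeneous e g"
  shows "graded_ideal (ideal_generated G)"
  unfolding graded_ideal_def
proof (intro conjI ballI allI poly_ideal_generated)
  fix f d assume "f \<in> ideal_generated G"
  then show "hom_part d f \<in> ideal_generated G"
    unfolding ideal_generated_def
  proof (induction rule: Modules.module.span_induct_alt[OF module_ring_itself, consumes 1, case_names base step])
    case base
    then show ?case using Modules.module.span_zero[OF module_ring_itself] by simp
  next
    case (step c x y)
    obtain e where e: "homogeneous e x" using assms[OF step.hyps] by blast
    have "hom_part (d - e) c * x \<in> Modules.module.span (*) G"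
      by (rule Modules.module.span_scale[OF module_ring_itself Modules.module.span_base[OF module_ring_itself step.hyps]])
    then show ?case unfolding hom_part_add hom_part_mult[OF e]
      using step.IH by (rule Modules.module.span_add[OF module_ring_itself])
  qed
qed

context clique_family
begin

definition minor_ideal :: "('n \<times> 'm, 'k) polynomial set" where
  "minor_ideal = ideal_generated {list_minor xs ys | xs ys. xs \<in> row_lists r \<and> ys \<in> B}"

lemma list_minor_in: "xs \<in> row_lists r \<Longrightarrow> ys \<in> B \<Longrightarrow> list_minor xs ys \<in> minor_ideal"
  unfolding minor_ideal_def by (rule ideal_generated_base) blast

lemma family_lead:
  assumes "xs \<in> row_lists r" "ys \<in> B"
  shows "lookup (list_minor xs ys :: ('n \<times> 'm, 'k) polynomial) (diag_mono xs ys) = 1"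
    and "s \<in> keys (list_minor xs ys :: ('n \<times> 'm, 'k) polynomial) \<Longrightarrow> below s (diag_mono xs ys)"
  using list_minor_lead[of xs ys] B_facts[OF assms(2)] assms(1) by (simp_all add: row_lists_def)

lemma graded_minor_ideal: "graded_ideal minor_ideal"
  unfolding minor_ideal_def
proof (rule graded_ideal_generated)
  fix g :: "('n \<times> 'm, 'k) polynomial"
  assume "g \<in> {list_minor xs ys | xs ys. xs \<in> row_lists r \<and> ys \<in> B}"
  then obtain xs ys where g: "g = list_minor xs ys" "xs \<in> row_lists r" "ys \<in> B" by blast
  have "homogeneous (int (monomial_degree (diag_mono xs ys))) g"
    unfolding homogeneous_def
  proof
    fix s assume "s \<in> keys g"
    then have "column_degree s = column_degree (diag_mono xs ys)"
      using family_lead(2)[OF g(2,3), of s] unfolding g(1) below_def by blast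
    from fine_degree[OF this]
    show "int (monomial_degree s) = int (monomial_degree (diag_mono xs ys))" by simp
  qed
  then show "\<exists>e. homogeneous e g" by blast
qed

lemma minor_ideal_lead:
  assumes "f \<in> minor_ideal" "t \<in> keys f" "\<And>s. s \<in> keys f \<Longrightarrow> leq s t"
  shows "t \<in> diag_ideal r B"
  using minors_groebner[OF assms(1)[unfolded minor_ideal_def] assms(2,3)] unfolding diag_ideal_def by blast

lemma graded_initial_ideal: "graded_ideal (initial_ideal leq minor_ideal)"
  unfolding initial_ideal_def
proof (rule graded_ideal_generated)
  fix g assume "g \<in> lead_term leq ` minor_ideal"
  then obtain f where "g = lead_term leq f" by blast
  then have "homogeneous (int (monomial_degree (lead_monomial leq f))) g"
    by (auto simp: homogeneous_def lead_term_def split: if_splits)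
  then show "\<exists>e. homogeneous e g" by blast
qed

lemma initial_ideal_keys:
  assumes "f \<in> initial_ideal leq minor_ideal"
  shows "keys f \<subseteq> diag_ideal r B"
  using assms unfolding initial_ideal_def ideal_generated_def
proof (induction rule: Modules.module.span_induct_alt[OF module_ring_itself, consumes 1, case_names base step])
  case base
  then show ?case by simp
next
  case (step c x y)
  then obtain f where f: "f \<in> minor_ideal" "x = lead_term leq f" by blast
  have "keys (c * x) \<subseteq> diag_ideal r B"
  proof (cases "f = 0")
    case True
    then have "x = 0" by (simp add: f(2) lead_term_def)
    then show ?thesis by simp
  next
    case False
    have "lead_monomial leq f \<in> diag_ideal r B"
      using lead_monomial_max[OF False] by (intro minor_ideal_lead[OF f(1)]) blast+
    moreover have "keys x \<subseteq> {lead_monomial leq f}" by (simp add: f(2) lead_term_def)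
    moreover have "u + lead_monomial leq f \<in> diag_ideal r B" if "lead_monomial leq f \<in> diag_ideal r B" for u
      by (rule upclosedD[OF upclosed_diag_ideal that mono_dvd_add(2)])
    ultimately show ?thesis using keys_mult[of c x] by blast
  qed
  then show ?case using step.IH Poly_Mapping.keys_add[of "c * x" y] by blast
qed

lemma diag_ideal_generators:
  assumes "t \<in> diag_ideal r B"
  shows "\<exists>g\<in>minor_ideal. lookup g t = 1 \<and> (\<forall>s\<in>keys g. below s t)"
    and "\<exists>g\<in>initial_ideal leq minor_ideal. lookup g t = 1 \<and> (\<forall>s\<in>keys g. below s t)"
proof -
  obtain xs ys where xy: "xs \<in> row_lists r" "ys \<in> B" "diag_mono xs ys \<preceq> t"
    using assms unfolding diag_ideal_def by blast
  define u where "u = t - diag_mono xs ys"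
  have t: "u + diag_mono xs ys = t" unfolding u_def by (rule mono_dvd_diff_plus[OF xy(3)])
  let ?f = "list_minor xs ys :: ('n \<times> 'm, 'k) polynomial"
  let ?g = "single u 1 * ?f"
  have "?g \<in> minor_ideal"
    using list_minor_in[OF xy(1,2)] graded_minor_ideal unfolding graded_ideal_def poly_ideal_def by blast
  moreover have "lookup ?g t = 1"
    using lookup_single_mult[of u 1 ?f "diag_mono xs ys"] family_lead(1)[OF xy(1,2)] t by simp
  moreover have "below s t" if s: "s \<in> keys ?g" for s
  proof -
    obtain s' where "s = u + s'" "s' \<in> keys ?f" using keys_single_mult[of u 1 ?f] s by blast
    then show ?thesis using family_lead(2)[OF xy(1,2)] below_add_left[of s' "diag_mono xs ys" u] t by simp
  qed
  ultimately show "\<exists>g\<in>minor_ideal. lookup g t = 1 \<and> (\<forall>s\<in>keys g. below s t)" by blast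
  have "lead_term leq ?f = single (diag_mono xs ys) 1"
    using lead_term_list_minor[of xs ys] B_facts[OF xy(2)] xy(1) by (simp add: row_lists_def)
  then have "single (diag_mono xs ys) 1 \<in> initial_ideal leq minor_ideal"
    unfolding initial_ideal_def using list_minor_in[OF xy(1,2)] by (intro ideal_generated_base) force
  then have "single u 1 * single (diag_mono xs ys) 1 \<in> initial_ideal leq minor_ideal"
    using graded_initial_ideal unfolding graded_ideal_def poly_ideal_def by blast
  then have "(single t 1 :: ('n \<times> 'm, 'k) polynomial) \<in> initial_ideal leq minor_ideal"
    by (simp add: mult_single t)
  then show "\<exists>g\<in>initial_ideal leq minor_ideal. lookup g t = 1 \<and> (\<forall>s\<in>keys g. below s t)"
    by (intro bexI[of _ "single t 1"]) simp_all
qed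

text \<open>
  Both ideals have the same leading monomials, so that both resolutions are lifts of the same frame.
\<close>
theorem betti_minor_ideal_eq_initial:
  fixes A :: "('n \<times> 'm, 'k) frame"
  assumes A: "frame_of (diag_ideal r B) A"
    and sep: "\<And>i p q. p < rnk A i \<Longrightarrow> q < rnk A (Suc i) \<Longrightarrow> column_degree (lbl A i p) \<noteq> column_degree (lbl A (Suc i) q)"
  shows "graded_betti minor_ideal i j = graded_betti (initial_ideal leq minor_ideal) i j"
proof -
  have "graded_betti minor_ideal i j = card {q. q < rnk A i \<and> int (monomial_degree (lbl A i q)) = j}"
    by (rule lifted_betti[OF A graded_minor_ideal minor_ideal_lead diag_ideal_generators(1) sep])
  moreover have "graded_betti (initial_ideal leq minor_ideal) i j = card {q. q < rnk A i \<and> int (monomial_degree (lbl A i q)) = j}"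
    by (rule lifted_betti[OF A graded_initial_ideal _ diag_ideal_generators(2) sep])
       (use initial_ideal_keys in blast)
  ultimately show ?thesis by simp
qed

end

text \<open>
  A face \<open>b\<close> with \<open>r\<close> elements spans a clique. A maximal clique above it has \<open>r\<close> vertices, too, hence the
  same ones.
\<close>
lemma maximal_clique_of_facet:
  fixes \<Delta> :: "'m::finite set set"
  assumes r: "1 \<le> r" and sc: "simplicial_complex \<Delta>"
    and size: "\<forall>C\<in>clique_decomposition r \<Delta>. card (vertex_set C) = r"
    and b: "b \<in> \<Delta>" "card b = r"
  shows "\<exists>C\<in>clique_decomposition r \<Delta>. vertex_set C = b"
proof -
  have "Pow b \<in> clique_simplices r \<Delta>"
    unfolding clique_simplices_def
    using sc b by (auto simp: skeleton_def face_dim_def simplicial_complex_def)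
  moreover have "finite (clique_simplices r \<Delta>)" by simp
  ultimately obtain G where G: "G \<in> clique_simplices r \<Delta>" "Pow b \<subseteq> G"
    "\<forall>H\<in>clique_simplices r \<Delta>. G \<subseteq> H \<longrightarrow> G = H"
    using finite_has_maximal2[of "clique_simplices r \<Delta>" "Pow b"] by blast
  then have "G \<in> maximal_cliques r \<Delta>" unfolding maximal_cliques_def by blast
  then have C: "skeleton (int r - 1) G \<in> clique_decomposition r \<Delta>" unfolding clique_decomposition_def by blast
  obtain V where V: "G = Pow V" using G(1) unfolding clique_simplices_def by blast
  have vs: "vertex_set (skeleton (int r - 1) G) = V"
  proof
    show "vertex_set (skeleton (int r - 1) G) \<subseteq> V" by (auto simp: vertex_set_def skeleton_def V)
    show "V \<subseteq> vertex_set (skeleton (int r - 1) G)"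
    proof
      fix v assume "v \<in> V"
      then have "{v} \<in> skeleton (int r - 1) G" using r by (simp add: skeleton_def V face_dim_def)
      then show "v \<in> vertex_set (skeleton (int r - 1) G)" unfolding vertex_set_def by blast
    qed
  qed
  have "b \<subseteq> V" using G(2) V by blast
  moreover have "card V = r" using size C vs by auto
  ultimately have "V = b" using b(2) by (metis card_subset_eq finite)
  then show ?thesis using C vs by blast
qed


section \<open>Equality of the Betti numbers\<close>

theorem corollary3p3:
  fixes r :: nat
    and leq :: "('n::{finite,linorder} \<times> 'm::{finite,linorder}) monomial \<Rightarrow> ('n \<times> 'm) monomial \<Rightarrow> bool"
    and \<Delta> :: "'m set set"
    and J :: "('n \<times> 'm, 'k::field) polynomial set"
  assumes "1 \<le> r" and "r \<le> CARD('n)" and "CARD('n) \<le> CARD('m)"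
    and "diagonal_order TYPE('k) leq"
    and "simplicial_complex \<Delta>" and "pure_of_dim (int r - 1) \<Delta>"
    and "J = facet_ideal r \<Delta>"
    and "unit_interval r \<Delta>"
    and "\<forall>C\<in>clique_decomposition r \<Delta>. \<forall>D\<in>clique_decomposition r \<Delta>. C \<noteq> D \<longrightarrow>
           int (card (vertex_set C \<inter> vertex_set D)) \<le> max 0 (2 * int r - int CARD('n) - 1)"
    and "\<forall>C\<in>clique_decomposition r \<Delta>. card (vertex_set C) = r"
  shows "\<forall>i j. graded_betti J i j = graded_betti (initial_ideal leq J) i j"
proof -
  define B where "B = sorted_list_of_set ` {b \<in> \<Delta>. card b = r}"
  have rows: "sorted_list_of_set b \<in> row_lists r" if "card b = r" for b :: "'m set"
    using that by (simp add: row_lists_def)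
  have B_rows: "B \<subseteq> row_lists r" using rows by (auto simp: B_def)
  have facet: "\<exists>C\<in>clique_decomposition r \<Delta>. vertex_set C = b" if "b \<in> \<Delta>" "card b = r" for b
    by (rule maximal_clique_of_facet[OF assms(1,5,10) that])
  have interval: "\<exists>a b. set ys = {a..b}" if ys: "ys \<in> B" for ys
  proof -
    obtain b where b: "b \<in> \<Delta>" "card b = r" "ys = sorted_list_of_set b" using ys unfolding B_def by blast
    obtain C where C: "C \<in> clique_decomposition r \<Delta>" "vertex_set C = b" using facet[OF b(1,2)] by blast
    then obtain a b' where "vertex_set C = {a..b'}" using assms(8) unfolding unit_interval_def by blast
    then show ?thesis using C(2) b(3) by auto
  qed
  have inter: "int (card (set ys \<inter> set ys')) \<le> max 0 (2 * int r - int CARD('n) - 1)"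
    if ys: "ys \<in> B" "ys' \<in> B" "ys \<noteq> ys'" for ys ys'
  proof -
    obtain b where b: "b \<in> \<Delta>" "card b = r" "ys = sorted_list_of_set b" using ys(1) unfolding B_def by blast
    obtain b' where b': "b' \<in> \<Delta>" "card b' = r" "ys' = sorted_list_of_set b'" using ys(2) unfolding B_def by blast
    obtain C where C: "C \<in> clique_decomposition r \<Delta>" "vertex_set C = b" using facet[OF b(1,2)] by blast
    obtain C' where C': "C' \<in> clique_decomposition r \<Delta>" "vertex_set C' = b'" using facet[OF b'(1,2)] by blast
    have "C \<noteq> C'" using ys(3) b(3) b'(3) C(2) C'(2) by auto
    then have "int (card (vertex_set C \<inter> vertex_set C')) \<le> max 0 (2 * int r - int CARD('n) - 1)"
      using assms(9) C(1) C'(1) by blast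
    then show ?thesis using b(3) b'(3) C(2) C'(2) by simp
  qed
  have disj: "band_vars r ys \<inter> (band_vars r ys' :: ('n \<times> 'm) set) = {}"
    if ys: "ys \<in> B" "ys' \<in> B" "ys \<noteq> ys'" for ys ys'
  proof -
    obtain a b where ab: "set ys = {a..b}" using interval[OF ys(1)] by blast
    obtain a' b' where ab': "set ys' = {a'..b'}" using interval[OF ys(2)] by blast
    show ?thesis
      using B_rows ys by (intro band_vars_disjoint[OF assms(2) _ ab _ ab' ys(3) inter[OF ys]]) blast+
  qed
  have order: "term_order leq" using assms(4) by (simp add: diagonal_order_def)
  interpret graded_term_order leq column_degree by (rule graded_term_order_column_degree[OF order])
  interpret clique_family leq "TYPE('k)" r B
  proof
    show "diagonal_order TYPE('k) leq" by (rule assms(4))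
    show "B \<subseteq> row_lists r" by (rule B_rows)
    fix ys ys' :: "'m list" and xs xs' :: "'n list"
    assume "ys \<in> B" "ys' \<in> B" "ys \<noteq> ys'" "xs \<in> row_lists r" "xs' \<in> row_lists r"
    then show "keys (diag_mono xs ys) \<inter> keys (diag_mono xs' ys') = {}"
      using disj[of ys ys'] keys_diag_mono[of xs r ys] keys_diag_mono[of xs' r ys'] by blast
  qed
  have lm: "minor a b = (list_minor (sorted_list_of_set a) (sorted_list_of_set b) :: ('n \<times> 'm, 'k) polynomial)" for a b
    using strict_sorted_list_minor[of "sorted_list_of_set a" "sorted_list_of_set b", where 'k = 'k] by simp
  have "{minor a b | a b. card a = r \<and> b \<in> \<Delta> \<and> face_dim b = int r - 1}
      = {list_minor xs ys :: ('n \<times> 'm, 'k) polynomial | xs ys. xs \<in> row_lists r \<and> ys \<in> B}"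
  proof (intro subset_antisym subsetI)
    fix f :: "('n \<times> 'm, 'k) polynomial"
    assume "f \<in> {minor a b | a b. card a = r \<and> b \<in> \<Delta> \<and> face_dim b = int r - 1}"
    then obtain a b where f: "f = minor a b" "card a = r" "b \<in> \<Delta>" "card b = r"
      by (auto simp: face_dim_def)
    have "sorted_list_of_set a \<in> row_lists r" using f(2) by (simp add: row_lists_def)
    moreover have "sorted_list_of_set b \<in> B" using f(3,4) unfolding B_def by blast
    ultimately show "f \<in> {list_minor xs ys | xs ys. xs \<in> row_lists r \<and> ys \<in> B}" unfolding f(1) lm by blast
  next
    fix f :: "('n \<times> 'm, 'k) polynomial"
    assume "f \<in> {list_minor xs ys | xs ys. xs \<in> row_lists r \<and> ys \<in> B}"
    then obtain xs ys where f: "f = list_minor xs ys" "xs \<in> row_lists r" "ys \<in> B" by blast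
    obtain b where b: "b \<in> \<Delta>" "card b = r" "ys = sorted_list_of_set b" using f(3) unfolding B_def by blast
    have "sorted_list_of_set (set xs) = xs" "card (set xs) = r"
      using f(2) by (simp_all add: row_lists_def strict_sorted_iff distinct_card sorted_list_of_set.idem_if_sorted_distinct)
    then have "f = minor (set xs) b" "card (set xs) = r" using f(1) b(3) lm by simp_all
    moreover have "face_dim b = int r - 1" using b(2) by (simp add: face_dim_def)
    ultimately show "f \<in> {minor a b | a b. card a = r \<and> b \<in> \<Delta> \<and> face_dim b = int r - 1}" using b(1) by blast
  qed
  then have J: "J = minor_ideal" unfolding assms(7) facet_ideal_def minor_ideal_def by (rule arg_cong)
  have finB: "finite B" by (rule finite_subset[OF B_rows finite_row_lists])
  have "frame_with TYPE('k) (\<lambda>i t. \<exists>K\<subseteq>B. clique_label r K i t) (diag_ideal r B :: ('n \<times> 'm) monomial set)"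
    by (rule frame_diag_ideal[OF assms(1) finB B_rows disj])
  then obtain A :: "('n \<times> 'm, 'k) frame" where A: "frame_of (diag_ideal r B) A"
    "\<And>i q. q < rnk A i \<Longrightarrow> \<exists>K\<subseteq>B. clique_label r K i (lbl A i q)"
    unfolding frame_with_def by blast
  have cols: "set ys \<inter> set ys' = {}"
    if "r = 2" "CARD('n) > 2" "ys \<in> B" "ys' \<in> B" "ys \<noteq> ys'" for ys ys'
  proof -
    have "card (set ys \<inter> set ys') = 0" using inter[OF that(3-5)] that(1,2) by simp
    then show ?thesis by simp
  qed
  have "column_degree (lbl A i p) \<noteq> column_degree (lbl A (Suc i) q)"
    if pq: "p < rnk A i" "q < rnk A (Suc i)" for i p q
  proof -
    obtain K where K: "K \<subseteq> B" "clique_label r K i (lbl A i p)" using A(2)[OF pq(1)] by blast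
    obtain K' where K': "K' \<subseteq> B" "clique_label r K' (Suc i) (lbl A (Suc i) q)" using A(2)[OF pq(2)] by blast
    show ?thesis by (rule clique_labels_separated[OF assms(1,2) B_rows cols K K'])
  qed
  from betti_minor_ideal_eq_initial[OF A(1) this] show ?thesis unfolding J by blast
qed

end
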